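(* Let $(M,g)$ be a closed connected oriented smooth Riemannian manifold. For each affine connection $\nabla$ on $M$, \begin{enumerate} \item[(i)] $\boldsymbol\nabla^\nabla$ is torsion-free if and only if $\nabla$ is torsion-free; \item[(ii)] $\boldsymbol\nabla^\nabla$ is $\mathbf G^{\mathrm{der}}$-metric-compatible if and only if $\nabla$ is $g$-metric-compatible; \item[(iii)] $\boldsymbol\nabla^\nabla$ is $\mathbf G^{\mathrm{der}}$-metric-compatible and torsion-free if and only if $\nabla=\nabla^{\mathrm{LC}}$ is the Levi-Civita connection on $(M,g)$; \end{enumerate} and $\boldsymbol\nabla^{\mathrm{LC}}:=\boldsymbol\nabla^{\nabla^{\mathrm{LC}}}$ is the unique $\mathbf G^{\mathrm{der}}$-metric-compatible torsion-free affine connection on $\mathscr P$.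
   Context: $\mathscr P$ is the set of Borel probability measures on $M$; $\mathfrak X^\infty$ the smooth vector fields on $M$; $\Omega^\infty_1$ the smooth $1$-forms on $M$. For $f\in C^\infty(M)$ put $f^\star(\mu)=\mu f=\int f\,d\mu$. Cylinder functions: $\mathscr F\mathscr C^\infty_b$ is the algebra of functions $u:\mathscr P\to\mathbb R$ of the form $u=F\circ(f_1^\star,\dots,f_k^\star)$, $k\in\mathbb N_0$, $F\in C^\infty(\mathbb R^k)$, $f_i\in C^\infty(M)$. Cylinder vector fields: $\mathscr V\mathscr C^\infty_b:=\mathscr F\mathscr C^\infty_b\otimes_{\mathbb R}\mathfrak X^\infty$ (algebraic tensor product), a module over $\mathscr F\mathscr C^\infty_b$; for $V=\sum_iu_i\otimes w_i$ set $V_\mu=\sum_iu_i(\mu)w_i\in\mathfrak X^\infty$. Cylinder $1$-forms: $\Omega_1\mathscr C^\infty_b:=\mathscr F\mathscr C^\infty_b\otimes_{\mathbb R}\Omega_1^\infty$, with evaluation $\Omega_\mu$ defined similarly. Differential: $\mathbf D:\mathscr F\mathscr C^\infty_b\to\Omega_1\mathscr C^\infty_b$, $\mathbf D_\mu u=\sum_i(\partial_iF)(f_1^\star\mu,\dots,f_k^\star\mu)\,df_i$ (independent of the representation of $u$). Action on functions: $(Vu)(\mu)=\int(\mathbf D_\mu u)(V_\mu)\,d\mu$, so $Vu\in\mathscr F\mathscr C^\infty_b$. The map sending $V$ to the derivation $u\mapsto Vu$ is injective, and cylinder vector fields are identified with the corresponding derivations. Bracket: $\llbracket V,Z\rrbracket\in\mathscr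 V\mathscr C^\infty_b$ is the cylinder vector field with $\llbracket V,Z\rrbracket u=V(Zu)-Z(Vu)$ for all $u\in\mathscr F\mathscr C^\infty_b$. Affine connection on $\mathscr P$ (acting on $\mathscr V\mathscr C^\infty_b$): an $\mathbb R$-bilinear map $(V,Z)\mapsto\boldsymbol\nabla_VZ\in\mathscr V\mathscr C^\infty_b$, $\mathscr F\mathscr C^\infty_b$-linear in $V$, with $\boldsymbol\nabla_V(vZ)=v\boldsymbol\nabla_VZ+(Vv)Z$ for $v\in\mathscr F\mathscr C^\infty_b$. It is torsion-free if $\boldsymbol\nabla_VZ-\boldsymbol\nabla_ZV=\llbracket V,Z\rrbracket$ for all $V,Z$. Intrinsic connection: $\boldsymbol\nabla^{\mathrm{int}}$ is determined by $\mathbb R$-linearity in $Z$ and $\boldsymbol\nabla^{\mathrm{int}}_V(u\otimes w)=(Vu)\otimes w$ for $u\in\mathscr F\mathscr C^\infty_b$, $w\in\mathfrak X^\infty$. Connection pullback: for an affine connection $\nabla$ on $M$, $\big((\boldsymbol\Omega^\nabla Z)V\big)_\mu=\nabla_{V_\mu}Z_\mu$ (an $\mathscr F\mathscr C^\infty_b$-bilinear map in $V,Z\in\mathscr V\mathscr C^\infty_b$, with values in $\mathscr V\mathscr C^\infty_b$). Set $\boldsymbol\nabla^\nabla:=\boldsymbol\nabla^{\mathrm{int}}+\boldsymbol\Omega^\nabla$, i.e. $\boldsymbol\nabla^\nabla_VZ=\boldsymbol\nabla^{\mathrm{int}}_VZ+(\boldsymbol\Omega^\nabla Z)V$, which is an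 affine connection on $\mathscr P$. Metric: $\mathbf G^{\mathrm{der}}(V,Z)\in\mathscr F\mathscr C^\infty_b$ is $\mathbf G^{\mathrm{der}}_\mu(V,Z)=\int g(V_\mu,Z_\mu)\,d\mu$. A connection $\boldsymbol\nabla$ on $\mathscr P$ is $\mathbf G^{\mathrm{der}}$-metric-compatible if $V^1\mathbf G^{\mathrm{der}}(V^2,V^3)=\mathbf G^{\mathrm{der}}(\boldsymbol\nabla_{V^1}V^2,V^3)+\mathbf G^{\mathrm{der}}(V^2,\boldsymbol\nabla_{V^1}V^3)$ for all $V^1,V^2,V^3\in\mathscr V\mathscr C^\infty_b$; $\nabla$ is $g$-metric-compatible if $w^1g(w^2,w^3)=g(\nabla_{w^1}w^2,w^3)+g(w^2,\nabla_{w^1}w^3)$ for all $w^1,w^2,w^3\in\mathfrak X^\infty$. *)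

theory Defs
  imports "HOL-Probability.Probability"
begin

section \<open>Smooth functions on open subsets of $R^k$\<close>

text \<open>
  Points of $R^k$ are the points of the library space \<^term>\<open>Euclidean_space k\<close>, i.e. functions
  \<^typ>\<open>nat \<Rightarrow> real\<close> vanishing at all indices \<open>i \<ge> k\<close>, so that \<open>k\<close> (possibly 0) can be quantified
  over. \<open>C_on r k U F\<close>: all iterated partial derivatives of \<open>F\<close> of order at most \<open>r\<close> exist and are
  continuous on \<open>U\<close>. It is only used for \<open>U\<close> open in \<^term>\<open>Euclidean_space k\<close>.
\<close>

definition partial :: "nat \<Rightarrow> ((nat \<Rightarrow> real) \<Rightarrow> real) \<Rightarrow> (nat \<Rightarrow> real) \<Rightarrow> real" where
  "partial i F x = deriv (\<lambda>t. F (x(i := t))) (x i)"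

primrec C_on :: "nat \<Rightarrow> nat \<Rightarrow> (nat \<Rightarrow> real) set \<Rightarrow> ((nat \<Rightarrow> real) \<Rightarrow> real) \<Rightarrow> bool" where
  "C_on 0 k U F \<longleftrightarrow> continuous_on U F"
| "C_on (Suc r) k U F \<longleftrightarrow> continuous_on U F \<and>
     (\<forall>i<k. (\<forall>x\<in>U. (\<lambda>t. F (x(i := t))) differentiable (at (x i))) \<and> C_on r k U (partial i F))"

definition smooth_on :: "nat \<Rightarrow> (nat \<Rightarrow> real) set \<Rightarrow> ((nat \<Rightarrow> real) \<Rightarrow> real) \<Rightarrow> bool" where
  "smooth_on k U F \<longleftrightarrow> (\<forall>r. C_on r k U F)"


section \<open>Smooth manifolds\<close>

text \<open>
  The manifold is the whole type \<open>'m\<close> (whose type class supplies the topology) with an atlas.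
  A chart is a pair of its domain and its coordinate map; the values of the coordinate map outside
  the domain are irrelevant.
\<close>

record 'm manifold =
  mdim :: nat
  atlas :: "('m set \<times> ('m \<Rightarrow> nat \<Rightarrow> real)) set"

definition is_chart :: "nat \<Rightarrow> 'm::topological_space set \<Rightarrow> ('m \<Rightarrow> nat \<Rightarrow> real) \<Rightarrow> bool" where
  "is_chart n U \<phi> \<longleftrightarrow> open U \<and> openin (Euclidean_space n) (\<phi> ` U) \<and>
     homeomorphism U (\<phi> ` U) \<phi> (inv_into U \<phi>)"

definition transition :: "'m set \<Rightarrow> ('m \<Rightarrow> nat \<Rightarrow> real) \<Rightarrow> ('m \<Rightarrow> nat \<Rightarrow> real) \<Rightarrow>
    nat \<Rightarrow> (nat \<Rightarrow> real) \<Rightarrow> real" where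
  "transition U \<phi> \<psi> i x = \<psi> (inv_into U \<phi> x) i"

definition smooth_manifold :: "'m::{t2_space,second_countable_topology} manifold \<Rightarrow> bool" where
  "smooth_manifold M \<longleftrightarrow>
     (\<forall>(U,\<phi>)\<in>atlas M. is_chart (mdim M) U \<phi>) \<and>
     (\<Union>(U,\<phi>)\<in>atlas M. U) = UNIV \<and>
     (\<forall>(U,\<phi>)\<in>atlas M. \<forall>(V,\<psi>)\<in>atlas M. \<forall>i<mdim M.
        smooth_on (mdim M) (\<phi> ` (U \<inter> V)) (transition U \<phi> \<psi> i))"

definition jacobian_det :: "nat \<Rightarrow> (nat \<Rightarrow> (nat \<Rightarrow> real) \<Rightarrow> real) \<Rightarrow> (nat \<Rightarrow> real) \<Rightarrow> real" where
  "jacobian_det n \<tau> x =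
     (\<Sum>p | p permutes {..<n}. of_int (sign p) * (\<Prod>i<n. partial (p i) (\<tau> i) x))"

text \<open>
  An orientation is given by the choice of an atlas all of whose transition maps preserve
  orientation.
\<close>

definition oriented :: "'m manifold \<Rightarrow> bool" where
  "oriented M \<longleftrightarrow>
     (\<forall>(U,\<phi>)\<in>atlas M. \<forall>(V,\<psi>)\<in>atlas M. \<forall>x\<in>\<phi> ` (U \<inter> V).
        jacobian_det (mdim M) (transition U \<phi> \<psi>) x > 0)"

definition smooth_functions :: "'m manifold \<Rightarrow> ('m \<Rightarrow> real) set" where
  "smooth_functions M =
     {f. \<forall>(U,\<phi>)\<in>atlas M. smooth_on (mdim M) (\<phi> ` U) (f \<circ> inv_into U \<phi>)}"


section \<open>Vector fields, forms, metrics and connections on the manifold\<close>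

text \<open>
  Tangent vectors at \<open>x\<close> are the derivations at \<open>x\<close> of the algebra of smooth functions, made total
  by the value 0 on non-smooth functions. A vector field \<open>w\<close> is smooth if it maps smooth functions
  to smooth functions; likewise smoothness of 1-forms and metrics is tested on smooth vector
  fields.
\<close>

type_synonym 'm tvec = "('m \<Rightarrow> real) \<Rightarrow> real"
type_synonym 'm vfield = "'m \<Rightarrow> 'm tvec"
type_synonym 'm oneform = "'m \<Rightarrow> 'm tvec \<Rightarrow> real"

definition tangent_space :: "'m manifold \<Rightarrow> 'm \<Rightarrow> 'm tvec set" where
  "tangent_space M x = {v.
     (\<forall>f\<in>smooth_functions M. \<forall>h\<in>smooth_functions M. \<forall>c.
        v (\<lambda>y. f y + h y) = v f + v h \<and>
        v (\<lambda>y. c * f y) = c * v f \<and>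
        v (\<lambda>y. f y * h y) = v f * h x + f x * v h) \<and>
     (\<forall>f. f \<notin> smooth_functions M \<longrightarrow> v f = 0)}"

definition vapply :: "'m vfield \<Rightarrow> ('m \<Rightarrow> real) \<Rightarrow> 'm \<Rightarrow> real" where
  "vapply w f = (\<lambda>x. w x f)"

definition vector_fields :: "'m manifold \<Rightarrow> 'm vfield set" where
  "vector_fields M = {w. (\<forall>x. w x \<in> tangent_space M x) \<and>
     (\<forall>f\<in>smooth_functions M. vapply w f \<in> smooth_functions M)}"

text \<open>Linear operations on vector fields (and, with the same formulas, on 1-forms).\<close>

definition vadd :: "('m \<Rightarrow> 'a \<Rightarrow> real) \<Rightarrow> ('m \<Rightarrow> 'a \<Rightarrow> real) \<Rightarrow> 'm \<Rightarrow> 'a \<Rightarrow> real" where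
  "vadd w z = (\<lambda>x a. w x a + z x a)"

definition vdiff :: "('m \<Rightarrow> 'a \<Rightarrow> real) \<Rightarrow> ('m \<Rightarrow> 'a \<Rightarrow> real) \<Rightarrow> 'm \<Rightarrow> 'a \<Rightarrow> real" where
  "vdiff w z = (\<lambda>x a. w x a - z x a)"

definition vscale :: "('m \<Rightarrow> real) \<Rightarrow> ('m \<Rightarrow> 'a \<Rightarrow> real) \<Rightarrow> 'm \<Rightarrow> 'a \<Rightarrow> real" where
  "vscale h w = (\<lambda>x a. h x * w x a)"

definition vzero :: "'m \<Rightarrow> 'a \<Rightarrow> real" where
  "vzero = (\<lambda>x a. 0)"

definition lie_bracket :: "'m vfield \<Rightarrow> 'm vfield \<Rightarrow> 'm vfield" where
  "lie_bracket w z = (\<lambda>x f. w x (vapply z f) - z x (vapply w f))"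

definition differential :: "'m manifold \<Rightarrow> ('m \<Rightarrow> real) \<Rightarrow> 'm oneform" where
  "differential M f = (\<lambda>x v. if v \<in> tangent_space M x then v f else 0)"

definition one_forms :: "'m manifold \<Rightarrow> 'm oneform set" where
  "one_forms M = {\<alpha>.
     (\<forall>x. (\<forall>v\<in>tangent_space M x. \<forall>v'\<in>tangent_space M x. \<forall>c.
             \<alpha> x (\<lambda>f. v f + v' f) = \<alpha> x v + \<alpha> x v' \<and> \<alpha> x (\<lambda>f. c * v f) = c * \<alpha> x v) \<and>
          (\<forall>v. v \<notin> tangent_space M x \<longrightarrow> \<alpha> x v = 0)) \<and>
     (\<forall>w\<in>vector_fields M. (\<lambda>x. \<alpha> x (w x)) \<in> smooth_functions M)}"

type_synonym 'm metric = "'m \<Rightarrow> 'm tvec \<Rightarrow> 'm tvec \<Rightarrow> real"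

definition riemannian_metric :: "'m manifold \<Rightarrow> 'm metric \<Rightarrow> bool" where
  "riemannian_metric M g \<longleftrightarrow>
     (\<forall>x. \<forall>v\<in>tangent_space M x. \<forall>v'\<in>tangent_space M x. \<forall>z\<in>tangent_space M x. \<forall>c.
        g x (\<lambda>f. v f + v' f) z = g x v z + g x v' z \<and>
        g x (\<lambda>f. c * v f) z = c * g x v z \<and>
        g x v z = g x z v \<and>
        (v \<noteq> (\<lambda>f. 0) \<longrightarrow> g x v v > 0)) \<and>
     (\<forall>w\<in>vector_fields M. \<forall>z\<in>vector_fields M.
        (\<lambda>x. g x (w x) (z x)) \<in> smooth_functions M)"

text \<open>
  \<open>nabla w z\<close> stands for $\nabla_w z$. Connections are total functions, normalised to be 0 when an
  argument is not a smooth vector field; thus two connections are equal iff they agree on smooth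
  vector fields.
\<close>

type_synonym 'm connection = "'m vfield \<Rightarrow> 'm vfield \<Rightarrow> 'm vfield"

definition affine_connection :: "'m manifold \<Rightarrow> 'm connection \<Rightarrow> bool" where
  "affine_connection M nabla \<longleftrightarrow>
     (\<forall>w\<in>vector_fields M. \<forall>z\<in>vector_fields M. nabla w z \<in> vector_fields M) \<and>
     (\<forall>w\<in>vector_fields M. \<forall>w'\<in>vector_fields M. \<forall>z\<in>vector_fields M.
        nabla (vadd w w') z = vadd (nabla w z) (nabla w' z) \<and>
        nabla z (vadd w w') = vadd (nabla z w) (nabla z w')) \<and>
     (\<forall>w\<in>vector_fields M. \<forall>z\<in>vector_fields M. \<forall>c.
        nabla (vscale (\<lambda>_. c) w) z = vscale (\<lambda>_. c) (nabla w z) \<and>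
        nabla w (vscale (\<lambda>_. c) z) = vscale (\<lambda>_. c) (nabla w z)) \<and>
     (\<forall>w\<in>vector_fields M. \<forall>z\<in>vector_fields M. \<forall>h\<in>smooth_functions M.
        nabla (vscale h w) z = vscale h (nabla w z) \<and>
        nabla w (vscale h z) = vadd (vscale h (nabla w z)) (vscale (vapply w h) z)) \<and>
     (\<forall>w z. w \<notin> vector_fields M \<or> z \<notin> vector_fields M \<longrightarrow> nabla w z = vzero)"

definition torsion_free :: "'m manifold \<Rightarrow> 'm connection \<Rightarrow> bool" where
  "torsion_free M nabla \<longleftrightarrow>
     (\<forall>w\<in>vector_fields M. \<forall>z\<in>vector_fields M.
        vdiff (nabla w z) (nabla z w) = lie_bracket w z)"

definition metric_compatible :: "'m manifold \<Rightarrow> 'm metric \<Rightarrow> 'm connection \<Rightarrow> bool" where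
  "metric_compatible M g nabla \<longleftrightarrow>
     (\<forall>w\<^sub>1\<in>vector_fields M. \<forall>w\<^sub>2\<in>vector_fields M. \<forall>w\<^sub>3\<in>vector_fields M.
        vapply w\<^sub>1 (\<lambda>x. g x (w\<^sub>2 x) (w\<^sub>3 x)) =
        (\<lambda>x. g x (nabla w\<^sub>1 w\<^sub>2 x) (w\<^sub>3 x) + g x (w\<^sub>2 x) (nabla w\<^sub>1 w\<^sub>3 x)))"

definition levi_civita :: "'m manifold \<Rightarrow> 'm metric \<Rightarrow> 'm connection" where
  "levi_civita M g =
     (THE nabla. affine_connection M nabla \<and> metric_compatible M g nabla \<and> torsion_free M nabla)"


section \<open>Borel probability measures and cylinder functions\<close>

typedef (overloaded) 'm borel_prob =
  "{\<mu> :: 'm::topological_space measure. prob_space \<mu> \<and> sets \<mu> = sets borel}"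
  morphisms measure_of_prob Abs_borel_prob
proof
  show "return borel undefined \<in> {\<mu> :: 'm measure. prob_space \<mu> \<and> sets \<mu> = sets borel}"
    by (auto intro: prob_space_return)
qed

definition pintegral :: "'m::topological_space borel_prob \<Rightarrow> ('m \<Rightarrow> real) \<Rightarrow> real" where
  "pintegral \<mu> f = integral\<^sup>L (measure_of_prob \<mu>) f"

text \<open>The point $(f_1^\star\mu,\dots,f_k^\star\mu)$ of $R^k$; functions are indexed from 0.\<close>

definition star_point :: "nat \<Rightarrow> (nat \<Rightarrow> 'm \<Rightarrow> real) \<Rightarrow> 'm::topological_space borel_prob \<Rightarrow>
    nat \<Rightarrow> real" where
  "star_point k f \<mu> = (\<lambda>i. if i < k then pintegral \<mu> (f i) else 0)"

definition cyl_representation :: "'m::topological_space manifold \<Rightarrow> ('m borel_prob \<Rightarrow> real) \<Rightarrow>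
    nat \<Rightarrow> ((nat \<Rightarrow> real) \<Rightarrow> real) \<Rightarrow> (nat \<Rightarrow> 'm \<Rightarrow> real) \<Rightarrow> bool" where
  "cyl_representation M u k F f \<longleftrightarrow>
     smooth_on k (topspace (Euclidean_space k)) F \<and>
     (\<forall>i<k. f i \<in> smooth_functions M) \<and>
     u = (\<lambda>\<mu>. F (star_point k f \<mu>))"

definition cyl_functions :: "'m::topological_space manifold \<Rightarrow> ('m borel_prob \<Rightarrow> real) set" where
  "cyl_functions M = {u. \<exists>k F f. cyl_representation M u k F f}"


section \<open>Cylinder vector fields and cylinder 1-forms\<close>

text \<open>
  An element $\sum_i u_i\otimes e_i$ of the algebraic tensor product of a space of functions on
  \<open>'p\<close> with a space of fields is represented by its evaluation $\mu\mapsto\sum_i u_i(\mu)e_i$.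
  No information is lost: by \<open>tensor_sum_faithful\<close> below, every bilinear map annihilates
  $\sum_i u_i\otimes e_i$ as soon as its evaluation vanishes identically, i.e. the evaluation map is
  injective on the algebraic tensor product.
\<close>

definition tensor_sum :: "nat \<Rightarrow> (nat \<Rightarrow> 'p \<Rightarrow> real) \<Rightarrow> (nat \<Rightarrow> 'm \<Rightarrow> 'a \<Rightarrow> real) \<Rightarrow>
    'p \<Rightarrow> 'm \<Rightarrow> 'a \<Rightarrow> real" where
  "tensor_sum n u e = (\<lambda>\<mu> x a. \<Sum>i<n. u i \<mu> * e i x a)"

lemma tensor_sum_faithful:
  fixes B :: "('p \<Rightarrow> real) \<Rightarrow> ('m \<Rightarrow> 'a \<Rightarrow> real) \<Rightarrow> 'z::real_vector"
  assumes A: "\<And>u v c. u \<in> A \<Longrightarrow> v \<in> A \<Longrightarrow> (\<lambda>\<mu>. u \<mu> + c * v \<mu>) \<in> A"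
    and E: "\<And>e d c. e \<in> E \<Longrightarrow> d \<in> E \<Longrightarrow> (\<lambda>x a. e x a + c * d x a) \<in> E"
    and BA: "\<And>u v c e. u \<in> A \<Longrightarrow> v \<in> A \<Longrightarrow> e \<in> E \<Longrightarrow>
               B (\<lambda>\<mu>. u \<mu> + c * v \<mu>) e = B u e + c *\<^sub>R B v e"
    and BE: "\<And>u e d c. u \<in> A \<Longrightarrow> e \<in> E \<Longrightarrow> d \<in> E \<Longrightarrow>
               B u (\<lambda>x a. e x a + c * d x a) = B u e + c *\<^sub>R B u d"
    and ue: "\<And>i. i < n \<Longrightarrow> u i \<in> A" "\<And>i. i < n \<Longrightarrow> e i \<in> E"
    and zero: "tensor_sum n u e = (\<lambda>\<mu>. vzero)"
  shows "(\<Sum>i<n. B (u i) (e i)) = 0"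
  using ue zero
proof (induction n arbitrary: u)
  case 0
  then show ?case by simp
next
  case (Suc n)
  have uA: "\<And>i. i \<le> n \<Longrightarrow> u i \<in> A" and eE: "\<And>i. i \<le> n \<Longrightarrow> e i \<in> E"
    using Suc.prems by auto
  have z: "(\<Sum>i<n. u i \<mu> * e i x a) + u n \<mu> * e n x a = 0" for \<mu> x a
    using fun_cong[OF fun_cong[OF fun_cong[OF Suc.prems(3), of \<mu>], of x], of a]
    by (simp add: tensor_sum_def vzero_def)
  show ?case
  proof (cases "u n = (\<lambda>\<mu>. 0)")
    case True
    have "B (\<lambda>\<mu>. u n \<mu> + (-1) * u n \<mu>) (e n) = B (u n) (e n) + (-1) *\<^sub>R B (u n) (e n)"
      by (intro BA uA eE) auto
    then have "B (u n) (e n) = 0"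
      using True by simp
    moreover have "tensor_sum n u e = (\<lambda>\<mu>. vzero)"
      using z True by (auto simp: tensor_sum_def vzero_def fun_eq_iff)
    ultimately show ?thesis
      using Suc.IH[of u] uA eE by simp
  next
    case False
    then obtain \<mu>0 where \<mu>0: "u n \<mu>0 \<noteq> 0" by auto
    define c where "c i = u i \<mu>0 / u n \<mu>0" for i
    have en: "e n x a = - (\<Sum>i<n. c i * e i x a)" for x a
    proof -
      have "u n \<mu>0 * e n x a = - (\<Sum>i<n. u i \<mu>0 * e i x a)"
        using z[of \<mu>0 x a] by simp
      then have "e n x a = - (\<Sum>i<n. u i \<mu>0 * e i x a) / u n \<mu>0"
        using \<mu>0 by (simp add: field_simps)
      then show ?thesis
        by (simp add: c_def sum_divide_distrib)
    qed
    have part: "(\<lambda>x a. e n x a + (\<Sum>i<m. c i * e i x a)) \<in> E \<and>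
        B (u n) (\<lambda>x a. e n x a + (\<Sum>i<m. c i * e i x a)) =
        B (u n) (e n) + (\<Sum>i<m. c i *\<^sub>R B (u n) (e i))" if "m \<le> n" for m
      using that
    proof (induction m)
      case 0
      then show ?case using eE by simp
    next
      case (Suc m)
      then have IH: "(\<lambda>x a. e n x a + (\<Sum>i<m. c i * e i x a)) \<in> E"
        "B (u n) (\<lambda>x a. e n x a + (\<Sum>i<m. c i * e i x a)) =
         B (u n) (e n) + (\<Sum>i<m. c i *\<^sub>R B (u n) (e i))" and m: "m \<le> n"
        by auto
      show ?case
        using E[OF IH(1) eE[OF m], of "c m"] BE[OF uA[OF order_refl] IH(1) eE[OF m], of "c m"] IH(2)
        by (simp add: add.assoc)
    qed
    have "B (u n) (\<lambda>x a. e n x a + (-1) * e n x a) = B (u n) (e n) + (-1) *\<^sub>R B (u n) (e n)"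
      by (intro BE uA eE) auto
    then have "B (u n) (\<lambda>x a. 0) = 0"
      by simp
    with part[OF order_refl] have Bn: "B (u n) (e n) = - (\<Sum>i<n. c i *\<^sub>R B (u n) (e i))"
      by (simp add: en add_eq_0_iff2)
    define u' where "u' i = (\<lambda>\<mu>. u i \<mu> + (- c i) * u n \<mu>)" for i
    have u': "u' i \<in> A" if "i < n" for i
      unfolding u'_def using that by (intro A uA) auto
    have "(\<Sum>i<n. u' i \<mu> * e i x a) = 0" for \<mu> x a
    proof -
      have "(\<Sum>i<n. u' i \<mu> * e i x a) =
          (\<Sum>i<n. u i \<mu> * e i x a) + u n \<mu> * (- (\<Sum>i<n. c i * e i x a))"
        by (simp add: u'_def algebra_simps sum.distrib sum_subtractf sum_distrib_left)
      then show ?thesis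
        using z[of \<mu> x a] en by simp
    qed
    then have "tensor_sum n u' e = (\<lambda>\<mu>. vzero)"
      by (simp add: tensor_sum_def vzero_def fun_eq_iff)
    then have "(\<Sum>i<n. B (u' i) (e i)) = 0"
      using Suc.IH[of u'] u' eE by simp
    moreover have "B (u' i) (e i) = B (u i) (e i) - c i *\<^sub>R B (u n) (e i)" if "i < n" for i
      using BA[OF uA[of i] uA[of n] eE[of i], of "- c i"] that by (simp add: u'_def)
    ultimately show ?thesis
      using Bn by (simp add: sum_subtractf)
  qed
qed

definition cyl_tensors :: "'m::topological_space manifold \<Rightarrow> ('m \<Rightarrow> 'a \<Rightarrow> real) set \<Rightarrow>
    ('m borel_prob \<Rightarrow> 'm \<Rightarrow> 'a \<Rightarrow> real) set" where
  "cyl_tensors M E = {V. \<exists>n u e. (\<forall>i<n. u i \<in> cyl_functions M \<and> e i \<in> E) \<and> V = tensor_sum n u e}"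

type_synonym 'm cyl_vfield = "'m borel_prob \<Rightarrow> 'm vfield"

definition cyl_vector_fields :: "'m::topological_space manifold \<Rightarrow> 'm cyl_vfield set" where
  "cyl_vector_fields M = cyl_tensors M (vector_fields M)"

definition cyl_one_forms :: "'m::topological_space manifold \<Rightarrow> ('m borel_prob \<Rightarrow> 'm oneform) set" where
  "cyl_one_forms M = cyl_tensors M (one_forms M)"

definition cadd :: "('p \<Rightarrow> 'm \<Rightarrow> 'a \<Rightarrow> real) \<Rightarrow> ('p \<Rightarrow> 'm \<Rightarrow> 'a \<Rightarrow> real) \<Rightarrow>
    'p \<Rightarrow> 'm \<Rightarrow> 'a \<Rightarrow> real" where
  "cadd V Z = (\<lambda>\<mu>. vadd (V \<mu>) (Z \<mu>))"

definition cdiff :: "('p \<Rightarrow> 'm \<Rightarrow> 'a \<Rightarrow> real) \<Rightarrow> ('p \<Rightarrow> 'm \<Rightarrow> 'a \<Rightarrow> real) \<Rightarrow>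
    'p \<Rightarrow> 'm \<Rightarrow> 'a \<Rightarrow> real" where
  "cdiff V Z = (\<lambda>\<mu>. vdiff (V \<mu>) (Z \<mu>))"

definition cscale :: "('p \<Rightarrow> real) \<Rightarrow> ('p \<Rightarrow> 'm \<Rightarrow> 'a \<Rightarrow> real) \<Rightarrow> 'p \<Rightarrow> 'm \<Rightarrow> 'a \<Rightarrow> real" where
  "cscale u V = (\<lambda>\<mu>. vscale (\<lambda>_. u \<mu>) (V \<mu>))"

definition czero :: "'p \<Rightarrow> 'm \<Rightarrow> 'a \<Rightarrow> real" where
  "czero = (\<lambda>\<mu>. vzero)"

text \<open>The differential of a cylinder function, computed from an arbitrary representation.\<close>

definition cyl_differential :: "'m::topological_space manifold \<Rightarrow> ('m borel_prob \<Rightarrow> real) \<Rightarrow>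
    'm borel_prob \<Rightarrow> 'm oneform" where
  "cyl_differential M u = (THE \<Theta>. \<Theta> \<in> cyl_one_forms M \<and>
     (\<exists>k F f. cyl_representation M u k F f \<and>
       \<Theta> = tensor_sum k (\<lambda>i \<mu>. partial i F (star_point k f \<mu>)) (\<lambda>i. differential M (f i))))"

definition cyl_apply :: "'m::topological_space manifold \<Rightarrow> 'm cyl_vfield \<Rightarrow>
    ('m borel_prob \<Rightarrow> real) \<Rightarrow> 'm borel_prob \<Rightarrow> real" where
  "cyl_apply M V u = (\<lambda>\<mu>. pintegral \<mu> (\<lambda>x. cyl_differential M u \<mu> x (V \<mu> x)))"

definition cyl_bracket :: "'m::topological_space manifold \<Rightarrow> 'm cyl_vfield \<Rightarrow> 'm cyl_vfield \<Rightarrow>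
    'm cyl_vfield" where
  "cyl_bracket M V Z = (THE Y. Y \<in> cyl_vector_fields M \<and>
     (\<forall>u\<in>cyl_functions M. cyl_apply M Y u =
        (\<lambda>\<mu>. cyl_apply M V (cyl_apply M Z u) \<mu> - cyl_apply M Z (cyl_apply M V u) \<mu>)))"


section \<open>Connections and the metric on the space of probability measures\<close>

text \<open>The same normalisation outside cylinder vector fields is used as for connections on \<open>M\<close>.\<close>

type_synonym 'm cyl_connection = "'m cyl_vfield \<Rightarrow> 'm cyl_vfield \<Rightarrow> 'm cyl_vfield"

definition cyl_affine_connection :: "'m::topological_space manifold \<Rightarrow> 'm cyl_connection \<Rightarrow> bool" where
  "cyl_affine_connection M Nabla \<longleftrightarrow>
     (\<forall>V\<in>cyl_vector_fields M. \<forall>Z\<in>cyl_vector_fields M. Nabla V Z \<in> cyl_vector_fields M) \<and>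
     (\<forall>V\<in>cyl_vector_fields M. \<forall>V'\<in>cyl_vector_fields M. \<forall>Z\<in>cyl_vector_fields M.
        Nabla (cadd V V') Z = cadd (Nabla V Z) (Nabla V' Z) \<and>
        Nabla Z (cadd V V') = cadd (Nabla Z V) (Nabla Z V')) \<and>
     (\<forall>V\<in>cyl_vector_fields M. \<forall>Z\<in>cyl_vector_fields M. \<forall>c.
        Nabla (cscale (\<lambda>_. c) V) Z = cscale (\<lambda>_. c) (Nabla V Z) \<and>
        Nabla V (cscale (\<lambda>_. c) Z) = cscale (\<lambda>_. c) (Nabla V Z)) \<and>
     (\<forall>V\<in>cyl_vector_fields M. \<forall>Z\<in>cyl_vector_fields M. \<forall>v\<in>cyl_functions M.
        Nabla (cscale v V) Z = cscale v (Nabla V Z) \<and>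
        Nabla V (cscale v Z) = cadd (cscale v (Nabla V Z)) (cscale (cyl_apply M V v) Z)) \<and>
     (\<forall>V Z. V \<notin> cyl_vector_fields M \<or> Z \<notin> cyl_vector_fields M \<longrightarrow> Nabla V Z = czero)"

definition cyl_torsion_free :: "'m::topological_space manifold \<Rightarrow> 'm cyl_connection \<Rightarrow> bool" where
  "cyl_torsion_free M Nabla \<longleftrightarrow>
     (\<forall>V\<in>cyl_vector_fields M. \<forall>Z\<in>cyl_vector_fields M.
        cdiff (Nabla V Z) (Nabla Z V) = cyl_bracket M V Z)"

definition G_der :: "'m::topological_space metric \<Rightarrow> 'm cyl_vfield \<Rightarrow> 'm cyl_vfield \<Rightarrow>
    'm borel_prob \<Rightarrow> real" where
  "G_der g V Z = (\<lambda>\<mu>. pintegral \<mu> (\<lambda>x. g x (V \<mu> x) (Z \<mu> x)))"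

definition cyl_metric_compatible :: "'m::topological_space manifold \<Rightarrow> 'm metric \<Rightarrow>
    'm cyl_connection \<Rightarrow> bool" where
  "cyl_metric_compatible M g Nabla \<longleftrightarrow>
     (\<forall>V\<^sub>1\<in>cyl_vector_fields M. \<forall>V\<^sub>2\<in>cyl_vector_fields M. \<forall>V\<^sub>3\<in>cyl_vector_fields M.
        cyl_apply M V\<^sub>1 (G_der g V\<^sub>2 V\<^sub>3) =
        (\<lambda>\<mu>. G_der g (Nabla V\<^sub>1 V\<^sub>2) V\<^sub>3 \<mu> + G_der g V\<^sub>2 (Nabla V\<^sub>1 V\<^sub>3) \<mu>))"

text \<open>
  The intrinsic connection is the linear extension of $u\otimes w\mapsto (Vu)\otimes w$, computed
  from an arbitrary representation of \<open>Z\<close>.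
\<close>

definition nabla_int :: "'m::topological_space manifold \<Rightarrow> 'm cyl_connection" where
  "nabla_int M V Z = (THE Y. \<exists>n u w.
     (\<forall>i<n. u i \<in> cyl_functions M \<and> w i \<in> vector_fields M) \<and>
     Z = tensor_sum n u w \<and>
     Y = tensor_sum n (\<lambda>i. cyl_apply M V (u i)) w)"

definition connection_pullback :: "'m connection \<Rightarrow> 'm::topological_space cyl_vfield \<Rightarrow>
    'm cyl_vfield \<Rightarrow> 'm cyl_vfield" where
  "connection_pullback nabla Z V = (\<lambda>\<mu>. nabla (V \<mu>) (Z \<mu>))"

definition lifted_connection :: "'m::topological_space manifold \<Rightarrow> 'm connection \<Rightarrow>
    'm cyl_connection" where
  "lifted_connection M nabla V Z =
     (if V \<in> cyl_vector_fields M \<and> Z \<in> cyl_vector_fields M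
      then cadd (nabla_int M V Z) (connection_pullback nabla Z V)
      else czero)"

end

theory Submission
  imports Defs
begin

text \<open>
  The intrinsic derivative \<open>nabla_int V Z\<close> is the derivative along \<open>V\<close> of the vector-valued cylinder
  function \<open>\<mu> \<mapsto> Z\<^sub>\<mu>\<close>. Consequently the bracket of \<open>V\<close> and \<open>Z\<close> is
  \<open>nabla_int V Z - nabla_int Z V + [V\<^sub>\<mu>, Z\<^sub>\<mu>]\<close>, and \<open>V (\<integral> H\<^sub>\<mu> d\<mu>) = \<integral> (V H) d\<mu> + \<integral> V\<^sub>\<mu> H\<^sub>\<mu> d\<mu>\<close>. The intrinsic
  parts cancel in the torsion and in the metric defect of a lifted connection, which leaves the
  torsion and the integrated metric defect of the connection on the manifold; constant fields and
  Dirac measures recover the latter pointwise. The right derivative of a cylinder function along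
  the segment from \<open>\<mu>\<close> to a Dirac measure determines its differential, and it also forces a field
  acting as 0 to be, at each measure, a derivation of finite rank, hence 0.

  Uniqueness on either space follows because a trilinear form that is symmetric in the first two
  and antisymmetric in the last two arguments vanishes. For the existence of the Levi-Civita
  connection the Koszul functional is represented near a point by solving the Gram system of a
  local frame over the ring of smooth functions; compactness glues finitely many local solutions.
\<close>

section \<open>Calculus in coordinate space\<close>

text \<open>Tangent vectors are derivations of globally defined smooth functions, and connections
  are known only on global fields, so nothing can simply be restricted to a chart. Local
  constructions are therefore cut off by a bump function, and divisions are postponed: an identity
  is first proved everywhere after multiplication by a global smooth function that is nonzero at the
  point of interest. On measures, \<open>flux D f \<mu> = 0\<close> only says that an integral
  vanishes against the very measure on which \<open>D \<mu>\<close> depends, so one measure alone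
  cannot show that the field is 0. Moving \<mu> towards the Dirac measure at x isolates the value at
  x: the derivative of the flux is \<open>D \<mu> x f\<close> plus the contribution of the
  coefficient functions. As D is a sum of finitely many elementary tensors, that contribution has
  finite rank as an operator on f. Mixtures with negative weight need not be measures, hence the
  right derivatives.\<close>

definition near :: "nat \<Rightarrow> (nat \<Rightarrow> real) \<Rightarrow> real \<Rightarrow> (nat \<Rightarrow> real) set" where
  "near k x d = {y. (\<forall>i<k. \<bar>y i - x i\<bar> < d) \<and> (\<forall>i\<ge>k. y i = 0)}"

abbreviation eopen :: "nat \<Rightarrow> (nat \<Rightarrow> real) set \<Rightarrow> bool" where
  "eopen k U \<equiv> openin (Euclidean_space k) U"

lemma Euclidean_space_eq: "Euclidean_space k = top_of_set {x. \<forall>i\<ge>k. x i = 0}"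
  by (simp add: Euclidean_space_def euclidean_product_topology)

lemma eopen_near: "eopen k (near k x d)"
proof -
  have "open (\<Inter>i<k. {y. \<bar>y i - x i\<bar> < d})"
    by (intro open_INT ballI open_Collect_less continuous_intros continuous_on_product_coordinates) auto
  moreover have "near k x d = {x. \<forall>i\<ge>k. x i = 0} \<inter> (\<Inter>i<k. {y. \<bar>y i - x i\<bar> < d})"
    by (auto simp: near_def)
  ultimately show ?thesis
    by (auto simp: Euclidean_space_eq openin_open)
qed

lemma eopenD_zero: "eopen k U \<Longrightarrow> x \<in> U \<Longrightarrow> i \<ge> k \<Longrightarrow> x i = 0"
  using openin_subset[of "Euclidean_space k" U] by (auto simp: topspace_Euclidean_space)

lemma eopen_near_subset:
  assumes "eopen k U" "x \<in> U"
  obtains d where "d > 0" "near k x d \<subseteq> U"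
proof -
  obtain T where T: "open T" "U = {x. \<forall>i\<ge>k. x i = 0} \<inter> T"
    using assms(1) by (auto simp: Euclidean_space_eq openin_open)
  have "openin (product_topology (\<lambda>i::nat. euclidean :: real topology) UNIV) T"
    using T(1) by (simp add: open_fun_def)
  then obtain W where W: "finite {i. W i \<noteq> (UNIV :: real set)}" "\<And>i::nat. open (W i)"
      "x \<in> Pi\<^sub>E UNIV W" "Pi\<^sub>E UNIV W \<subseteq> T"
    using assms(2) T(2) unfolding openin_product_topology_alt by auto
  have "\<exists>d>0. \<forall>t. \<bar>t - x i\<bar> < d \<longrightarrow> t \<in> W i" for i
  proof -
    have "x i \<in> W i" using W(3) by auto
    then obtain e where "e > 0" "ball (x i) e \<subseteq> W i" using W(2) open_contains_ball by blast
    then show ?thesis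
      by (intro exI[of _ e]) (auto simp: dist_real_def abs_minus_commute subset_iff)
  qed
  then obtain d where d: "\<And>i. d i > 0" "\<And>i t. \<bar>t - x i\<bar> < d i \<Longrightarrow> t \<in> W i" by metis
  \<comment> \<open>The \<open>1\<close> keeps the set nonempty when \<open>k = 0\<close>.\<close>
  define D where "D = Min (insert 1 (d ` {..<k}))"
  have D: "D > 0" "\<And>i. i < k \<Longrightarrow> D \<le> d i"
    unfolding D_def using d(1) by (auto simp: Min_gr_iff)
  have "near k x D \<subseteq> U"
  proof
    fix y assume y: "y \<in> near k x D"
    have "y i \<in> W i" for i
    proof (cases "i < k")
      case True
      then show ?thesis using y D(2)[of i] by (intro d(2)) (force simp: near_def)
    next
      case False
      then have "y i = x i" using y eopenD_zero[OF assms] by (auto simp: near_def)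
      then show ?thesis using W(3) by auto
    qed
    then show "y \<in> U" using W(4) y T(2) by (auto simp: near_def)
  qed
  then show thesis using that D(1) by blast
qed

lemma near_mono: "d \<le> e \<Longrightarrow> near k x d \<subseteq> near k x e"
  by (force simp: near_def)

lemma near_center: "eopen k U \<Longrightarrow> x \<in> U \<Longrightarrow> d > 0 \<Longrightarrow> x \<in> near k x d"
  by (auto simp: near_def eopenD_zero)

lemma continuous_near:
  assumes "eopen k U" "continuous_on U F" "x \<in> U" "e > (0::real)"
  shows "\<exists>d>0. near k x d \<subseteq> U \<and> (\<forall>y\<in>near k x d. \<bar>F y - F x\<bar> < e)"
proof -
  have "openin (top_of_set U) (U \<inter> F -` ball (F x) e)"
    by (rule continuous_openin_preimage_gen[OF assms(2)]) auto
  moreover have "top_of_set U = subtopology (Euclidean_space k) U"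
    using openin_subset[OF assms(1)]
    by (simp add: Euclidean_space_eq subtopology_subtopology inf_absorb2)
  ultimately have "eopen k (U \<inter> F -` ball (F x) e)"
    using assms(1) openin_trans_full by metis
  then obtain d where "d > 0" "near k x d \<subseteq> U \<inter> F -` ball (F x) e"
    using assms by (elim eopen_near_subset[of _ _ x]) auto
  then show ?thesis
    by (intro exI[of _ d]) (auto simp: dist_real_def abs_minus_commute subset_iff)
qed

lemma continuous_on_eopenI:
  assumes "eopen k U"
    "\<And>x e. x \<in> U \<Longrightarrow> e > 0 \<Longrightarrow> \<exists>d>0. \<forall>y\<in>near k x d \<inter> U. \<bar>F y - F x\<bar> < (e::real)"
  shows "continuous_on U F"
  unfolding continuous_on_def
proof (intro ballI tendstoI)
  fix x and e :: real assume x: "x \<in> U" and "e > 0"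
  then obtain d where d: "d > 0" "\<forall>y\<in>near k x d \<inter> U. \<bar>F y - F x\<bar> < e"
    using assms(2) by blast
  obtain T where T: "open T" "near k x d = {x. \<forall>i\<ge>k. x i = 0} \<inter> T"
    using eopen_near[of k x d] by (auto simp: Euclidean_space_eq openin_open)
  have "x \<in> T" using near_center[OF assms(1) x d(1)] T(2) by auto
  then show "\<forall>\<^sub>F y in at x within U. dist (F y) (F x) < e"
    unfolding eventually_at_topological using T d(2) assms(1)
    by (intro exI[of _ T]) (auto simp: dist_real_def eopenD_zero)
qed

lemma eopen_line:
  assumes "eopen k U" "x \<in> U" "i < k"
  shows "open {t. x(i := t) \<in> U}"
proof (subst open_subopen, intro ballI)
  fix t assume "t \<in> {t. x(i := t) \<in> U}"
  then obtain d where d: "d > 0" "near k (x(i := t)) d \<subseteq> U"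
    using eopen_near_subset assms by blast
  have "x(i := s) \<in> U" if "\<bar>s - t\<bar> < d" for s
    using d that eopenD_zero[OF assms(1,2)] assms(3)
    by (intro subsetD[OF d(2)]) (auto simp: near_def)
  then show "\<exists>T. open T \<and> t \<in> T \<and> T \<subseteq> {t. x(i := t) \<in> U}"
    by (intro exI[of _ "ball t d"]) (use d in \<open>auto simp: dist_real_def abs_minus_commute\<close>)
qed

section \<open>Closure properties of the differentiability classes\<close>

lemma has_real_derivative_cong_eopen:
  assumes "eopen k U" "x \<in> U" "i < k" "\<And>y. y \<in> U \<Longrightarrow> F y = G y"
    and "((\<lambda>t. F (x(i := t))) has_real_derivative D) (at (x i))"
  shows "((\<lambda>t. G (x(i := t))) has_real_derivative D) (at (x i))"
  using assms(5)
  by (rule has_field_derivative_transform_within_open[OF _ eopen_line[OF assms(1-3)]]) (use assms in auto)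

lemma C_on_continuous: "C_on r k U F \<Longrightarrow> continuous_on U F"
  by (cases r) auto

lemma C_on_SucD:
  assumes "C_on (Suc r) k U F" "i < k"
  shows "C_on r k U (partial i F)"
    and "x \<in> U \<Longrightarrow> ((\<lambda>t. F (x(i := t))) has_real_derivative partial i F x) (at (x i))"
  using assms by (auto simp: partial_def DERIV_deriv_iff_real_differentiable)

lemma C_on_cong:
  assumes "eopen k U" "\<And>y. y \<in> U \<Longrightarrow> F y = G y" "C_on r k U F"
  shows "C_on r k U G"
  using assms(2,3)
proof (induction r arbitrary: F G)
  case 0
  then show ?case using continuous_on_cong by auto
next
  case (Suc r)
  have "((\<lambda>t. G (x(i := t))) has_real_derivative partial i F x) (at (x i))" if "x \<in> U" "i < k" for x i
    using C_on_SucD[OF Suc.prems(2)] that Suc.prems(1)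
    by (blast intro: has_real_derivative_cong_eopen[OF assms(1)])
  note D = this
  then have "partial i F x = partial i G x" if "x \<in> U" "i < k" for x i
    using that by (metis DERIV_imp_deriv partial_def)
  then have "C_on r k U (partial i G)" if "i < k" for i
    using Suc.IH[of "partial i F" "partial i G"] C_on_SucD(1)[OF Suc.prems(2)] that by auto
  moreover have "continuous_on U G"
    using Suc.prems continuous_on_cong C_on_continuous by metis
  ultimately show ?case
    using D by (auto simp: real_differentiable_def simp del: fun_upd_apply)
qed

text \<open>\<open>partial\<close> is defined through \<open>deriv\<close>, which is awkward to
  compute; any family of known derivatives may stand in for it.\<close>

lemma C_on_SucI:
  assumes "eopen k U" "continuous_on U F"
    "\<And>i x. i < k \<Longrightarrow> x \<in> U \<Longrightarrow> ((\<lambda>t. F (x(i := t))) has_real_derivative G i x) (at (x i))"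
    "\<And>i. i < k \<Longrightarrow> C_on r k U (G i)"
  shows "C_on (Suc r) k U F"
proof -
  have "C_on r k U (partial i F)" if "i < k" for i
  proof (rule C_on_cong[OF assms(1) _ assms(4)[OF that]])
    show "G i y = partial i F y" if "y \<in> U" for y
      unfolding partial_def by (rule DERIV_imp_deriv[OF assms(3)[OF \<open>i < k\<close> that], symmetric])
  qed
  then show ?thesis
    using assms(2,3) by (auto simp: real_differentiable_def simp del: fun_upd_apply)
qed

lemma C_on_Suc_imp: "C_on (Suc r) k U F \<Longrightarrow> C_on r k U F"
  by (induction r arbitrary: F) auto

lemma C_on_subset:
  assumes "C_on r k U F" "V \<subseteq> U"
  shows "C_on r k V F"
  using assms(1)
proof (induction r arbitrary: F)
  case 0
  then show ?case using assms(2) continuous_on_subset by auto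
next
  case (Suc r)
  then show ?case using assms(2) continuous_on_subset by auto
qed

lemma C_on_local:
  assumes "eopen k U" "\<And>x. x \<in> U \<Longrightarrow> \<exists>V. eopen k V \<and> x \<in> V \<and> C_on r k V F"
  shows "C_on r k U F"
  using assms(2)
proof (induction r arbitrary: F)
  case 0
  have "continuous_on U F"
  proof (rule continuous_on_eopenI[OF assms(1)])
    fix x and e :: real assume "x \<in> U" "e > 0"
    then obtain V where V: "eopen k V" "x \<in> V" "continuous_on V F" using 0 by auto
    from continuous_near[OF V(1,3,2) \<open>e > 0\<close>]
    show "\<exists>d>0. \<forall>y\<in>near k x d \<inter> U. \<bar>F y - F x\<bar> < e"
      by auto
  qed
  then show ?case by simp
next
  case (Suc r)
  have "C_on r k U F"
    using Suc.prems C_on_Suc_imp by (intro Suc.IH) meson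
  moreover have "(\<lambda>t. F (x(i := t))) differentiable (at (x i))" if "x \<in> U" "i < k" for x i
    using Suc.prems[OF that(1)] that(2) by auto
  moreover have "C_on r k U (partial i F)" if "i < k" for i
    using Suc.prems C_on_SucD(1)[OF _ that] by (intro Suc.IH) meson
  ultimately show ?case
    using C_on_continuous by simp
qed

lemma partial_const [simp]: "partial i (\<lambda>_. c) = (\<lambda>_. 0)"
  by (simp add: partial_def fun_eq_iff)

lemma C_on_const: "C_on r k U (\<lambda>_. c)"
  by (induction r arbitrary: c) auto

lemma C_on_coord:
  assumes "eopen k U"
  shows "C_on r k U (\<lambda>x. x j)"
proof (cases r)
  case 0
  then show ?thesis
    using continuous_on_subset[OF continuous_on_product_coordinates] by auto
next
  case (Suc s)
  show ?thesis unfolding Suc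
  proof (rule C_on_SucI[OF assms, where G = "\<lambda>i x. if i = j then 1 else 0"])
    show "C_on s k U (\<lambda>x. if i = j then 1 else 0)" for i
      by (rule C_on_const)
    show "continuous_on U (\<lambda>x. x j)"
      using continuous_on_subset[OF continuous_on_product_coordinates] by auto
  qed (auto intro!: derivative_eq_intros)
qed

lemma C_on_add:
  assumes "eopen k U" "C_on r k U F" "C_on r k U G"
  shows "C_on r k U (\<lambda>x. F x + G x)"
  using assms(2,3)
proof (induction r arbitrary: F G)
  case 0
  then show ?case by (auto intro: continuous_intros)
next
  case (Suc r)
  show ?case
  proof (rule C_on_SucI[OF assms(1), where G = "\<lambda>i x. partial i F x + partial i G x"])
    show "continuous_on U (\<lambda>x. F x + G x)"
      using Suc.prems C_on_continuous by (blast intro: continuous_intros)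
    show "C_on r k U (\<lambda>x. partial i F x + partial i G x)" if "i < k" for i
      using Suc.IH C_on_SucD(1)[OF Suc.prems(1) that] C_on_SucD(1)[OF Suc.prems(2) that] by simp
    show "((\<lambda>t. F (x(i := t)) + G (x(i := t))) has_real_derivative
           partial i F x + partial i G x) (at (x i))" if "i < k" "x \<in> U" for i x
      by (rule DERIV_add[OF C_on_SucD(2)[OF Suc.prems(1) that] C_on_SucD(2)[OF Suc.prems(2) that]])
  qed
qed

lemma C_on_mult:
  assumes "eopen k U" "C_on r k U F" "C_on r k U G"
  shows "C_on r k U (\<lambda>x. F x * G x)"
  using assms(2,3)
proof (induction r arbitrary: F G)
  case 0
  then show ?case by (auto intro: continuous_intros)
next
  case (Suc r)
  show ?case
  proof (rule C_on_SucI[OF assms(1), where G = "\<lambda>i x. partial i F x * G x + partial i G x * F x"])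
    show "continuous_on U (\<lambda>x. F x * G x)"
      using Suc.prems C_on_continuous by (blast intro: continuous_intros)
    show "C_on r k U (\<lambda>x. partial i F x * G x + partial i G x * F x)" if "i < k" for i
      by (intro C_on_add[OF assms(1)] Suc.IH C_on_SucD(1)[OF Suc.prems(1) that] C_on_SucD(1)[OF Suc.prems(2) that] C_on_Suc_imp[OF Suc.prems(1)] C_on_Suc_imp[OF Suc.prems(2)])
    show "((\<lambda>t. F (x(i := t)) * G (x(i := t))) has_real_derivative
           partial i F x * G x + partial i G x * F x) (at (x i))" if "i < k" "x \<in> U" for i x
      using DERIV_mult[OF C_on_SucD(2)[OF Suc.prems(1) that] C_on_SucD(2)[OF Suc.prems(2) that]]
      by (simp del: fun_upd_apply)
  qed
qed


lemma C_on_sum: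
  assumes "eopen k U" "\<And>i. i \<in> I \<Longrightarrow> C_on r k U (F i)"
  shows "C_on r k U (\<lambda>x. \<Sum>i\<in>I. F i x)"
  using assms(2) by (induction I rule: infinite_finite_induct) (auto intro: C_on_const C_on_add[OF assms(1)])

lemma C_on_inverse:
  assumes "eopen k U" "C_on r k U F" "\<And>x. x \<in> U \<Longrightarrow> F x \<noteq> 0"
  shows "C_on r k U (\<lambda>x. inverse (F x))"
  using assms(2)
proof (induction r)
  case 0
  then show ?case using assms(3) by (auto intro!: continuous_intros)
next
  case (Suc r)
  show ?case
  proof (rule C_on_SucI[OF assms(1), where G = "\<lambda>i x. (-1) * (inverse (F x) * partial i F x * inverse (F x))"])
    show "continuous_on U (\<lambda>x. inverse (F x))"
      using C_on_continuous[OF Suc.prems] assms(3) by (auto intro!: continuous_intros)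
    show "C_on r k U (\<lambda>x. (-1) * (inverse (F x) * partial i F x * inverse (F x)))" if "i < k" for i
      using Suc.IH[OF C_on_Suc_imp[OF Suc.prems]]
      by (intro C_on_mult[OF assms(1)] C_on_const C_on_SucD(1)[OF Suc.prems that])
    show "((\<lambda>t. inverse (F (x(i := t)))) has_real_derivative
           (-1) * (inverse (F x) * partial i F x * inverse (F x))) (at (x i))" if "i < k" "x \<in> U" for i x
      using DERIV_inverse'[OF C_on_SucD(2)[OF Suc.prems that]] assms(3)[OF that(2)]
      by (simp del: fun_upd_apply)
  qed
qed

lemma C_on_mono: "r \<le> s \<Longrightarrow> C_on s k U F \<Longrightarrow> C_on r k U F"
proof (induction s)
  case (Suc s)
  then show ?case using C_on_Suc_imp by (cases "r = Suc s") auto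
qed simp

section \<open>Linear approximation and the chain rule\<close>

text \<open>Go from x to y by changing one coordinate at a time and apply the mean value inequality
  on each edge. Cubes contain all these edges, and continuity of the partials keeps the slope on
  each edge within e of the slope at x.\<close>

lemma C1_linear_approx:
  assumes U: "eopen k U" and F: "C_on (Suc 0) k U F" and x: "x \<in> U" and e: "e > 0"
  shows "\<exists>d>0. near k x d \<subseteq> U \<and> (\<forall>y\<in>near k x d.
      \<bar>F y - F x - (\<Sum>i<k. partial i F x * (y i - x i))\<bar> \<le> e * (\<Sum>i<k. \<bar>y i - x i\<bar>))"
proof -
  have "\<exists>d>0. near k x d \<subseteq> U \<and> (\<forall>y\<in>near k x d. \<bar>partial i F y - partial i F x\<bar> < e)" if "i < k" for i
    using continuous_near[OF U C_on_continuous[OF C_on_SucD(1)[OF F that]] x e] by metis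
  then obtain d where d: "\<And>i. i < k \<Longrightarrow> d i > 0"
      "\<And>i y. i < k \<Longrightarrow> y \<in> near k x (d i) \<Longrightarrow> \<bar>partial i F y - partial i F x\<bar> < e" by metis
  obtain d0 where d0: "d0 > 0" "near k x d0 \<subseteq> U" using eopen_near_subset[OF U x] by metis
  define D where "D = Min (insert d0 (d ` {..<k}))"
  have D: "D > 0" "D \<le> d0" "\<And>i. i < k \<Longrightarrow> D \<le> d i"
    unfolding D_def using d(1) d0(1) by (auto simp: Min_gr_iff)
  have DU: "near k x D \<subseteq> U" using near_mono[OF D(2)] d0(2) by blast
  have bound: "\<bar>partial i F y - partial i F x\<bar> \<le> e" if "i < k" "y \<in> near k x D" for i y
    using d(2)[OF that(1)] near_mono[OF D(3)[OF that(1)]] that(2) by (meson less_imp_le subsetD)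
  show ?thesis
  proof (intro exI[of _ D] conjI ballI D(1) DU)
    fix y assume y: "y \<in> near k x D"
    \<comment> \<open>Corners of the path: the first m coordinates come from y, the others from
      x.\<close>
    define z where "z m = (\<lambda>i. if i < m then y i else x i)" for m
    have step: "\<bar>F (z (Suc m)) - F (z m) - partial m F x * (y m - x m)\<bar> \<le> e * \<bar>y m - x m\<bar>" if m: "m < k"
      for m
    proof -
      have znear: "(z m)(m := t) \<in> near k x D" if "\<bar>t - x m\<bar> < D" for t
        using y that m D(1) eopenD_zero[OF U x] by (auto simp: near_def z_def)
      \<comment> \<open>With the linear part at x removed, a bound on the derivative of
        \<open>h\<close> is a bound on the error of this edge.\<close>
      define h where "h t = F ((z m)(m := t)) - partial m F x * t" for t
      have "norm (h (y m) - h (x m)) \<le> e * norm (y m - x m)"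
      proof (rule field_differentiable_bound[of "ball (x m) D"])
        fix t assume "t \<in> ball (x m) D"
        then have t: "\<bar>t - x m\<bar> < D" by (simp add: dist_real_def abs_minus_commute)
        have "((\<lambda>s. F (((z m)(m := t))(m := s))) has_real_derivative partial m F ((z m)(m := t))) (at (((z m)(m := t)) m))"
          using C_on_SucD(2)[OF F m] znear[OF t] DU by blast
        then have "((\<lambda>s. F ((z m)(m := s))) has_real_derivative partial m F ((z m)(m := t))) (at t)"
          unfolding fun_upd_upd fun_upd_same .
        then show "(h has_field_derivative partial m F ((z m)(m := t)) - partial m F x) (at t within ball (x m) D)"
          unfolding h_def by (rule has_field_derivative_at_within[OF DERIV_diff[OF _ DERIV_cmult_Id]])
        show "norm (partial m F ((z m)(m := t)) - partial m F x) \<le> e"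
          using bound[OF m znear[OF t]] by simp
      qed (use y m D(1) in \<open>auto simp: near_def dist_real_def abs_minus_commute\<close>)
      moreover have "(z m)(m := y m) = z (Suc m)" "(z m)(m := x m) = z m"
        by (auto simp: z_def fun_eq_iff)
      ultimately show ?thesis by (simp add: h_def algebra_simps)
    qed
    have tele: "(\<Sum>m<k. F (z (Suc m)) - F (z m)) = F (z k) - F (z 0)"
      by (rule sum_lessThan_telescope)
    have "F (z k) - F (z 0) - (\<Sum>i<k. partial i F x * (y i - x i)) =
        (\<Sum>m<k. F (z (Suc m)) - F (z m) - partial m F x * (y m - x m))"
      by (simp only: tele[symmetric] sum_subtractf[symmetric])
    also have "\<bar>\<dots>\<bar> \<le> (\<Sum>m<k. e * \<bar>y m - x m\<bar>)"
      by (rule order_trans[OF sum_abs sum_mono]) (use step in auto)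
    also have "z k = y" "z 0 = x"
      using y eopenD_zero[OF U x] by (auto simp: z_def near_def fun_eq_iff)
    ultimately show "\<bar>F y - F x - (\<Sum>i<k. partial i F x * (y i - x i))\<bar> \<le> e * (\<Sum>i<k. \<bar>y i - x i\<bar>)"
      by (simp add: sum_distrib_left)
  qed
qed

text \<open>The set S allows one-sided derivatives, which the segments of measures need. The
  remainder divided by \<open>s - t\<close> is at most a small multiple of the summed difference
  quotients of the coordinates, and those stay bounded.\<close>

lemma C1_chain_rule:
  assumes U: "eopen k U" and F: "C_on (Suc 0) k U F" and x: "c t \<in> U"
    and c0: "\<And>s i. i \<ge> k \<Longrightarrow> c s i = 0"
    and c: "\<And>i. i < k \<Longrightarrow> ((\<lambda>s. c s i) has_real_derivative c' i) (at t within S)"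
  shows "((\<lambda>s. F (c s)) has_real_derivative (\<Sum>i<k. partial i F (c t) * c' i)) (at t within S)"
proof -
  define q where "q i s = (c s i - c t i) / (s - t)" for i s
  have q: "(q i \<longlongrightarrow> c' i) (at t within S)" if "i < k" for i
    using c[OF that] unfolding has_field_derivative_iff q_def .
  define R where "R y = F y - F (c t) - (\<Sum>i<k. partial i F (c t) * (y i - c t i))" for y
  have "((\<lambda>s. R (c s) / (s - t)) \<longlongrightarrow> 0) (at t within S)"
  proof (rule tendstoI)
    fix e :: real assume e: "e > 0"
    \<comment> \<open>The limit of the summed difference quotients; eventually they are below
      \<open>L + 1\<close>, which is also safe as a denominator.\<close>
    define L where "L = (\<Sum>i<k. \<bar>c' i\<bar>)"
    have L: "L \<ge> 0" unfolding L_def by (simp add: sum_nonneg)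
    have "e / (L + 1) > 0" using e L by simp
    then obtain d where d: "d > 0"
        "\<And>y. y \<in> near k (c t) d \<Longrightarrow> \<bar>R y\<bar> \<le> e / (L + 1) * (\<Sum>i<k. \<bar>y i - c t i\<bar>)"
      unfolding R_def using C1_linear_approx[OF U F x] by blast
    have "\<forall>\<^sub>F s in at t within S. \<forall>i\<in>{..<k}. \<bar>c s i - c t i\<bar> < d"
    proof (rule eventually_ball_finite)
      show "\<forall>i\<in>{..<k}. \<forall>\<^sub>F s in at t within S. \<bar>c s i - c t i\<bar> < d"
      proof
        fix i assume "i \<in> {..<k}"
        then have "((\<lambda>s. c s i) \<longlongrightarrow> c t i) (at t within S)"
          using DERIV_continuous[OF c] by (auto simp: continuous_within)
        then show "\<forall>\<^sub>F s in at t within S. \<bar>c s i - c t i\<bar> < d"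
          using d(1) by (auto simp: tendsto_iff dist_real_def)
      qed
    qed simp
    moreover have "((\<lambda>s. \<Sum>i<k. \<bar>q i s\<bar>) \<longlongrightarrow> L) (at t within S)"
      unfolding L_def using q by (intro tendsto_sum tendsto_rabs) auto
    then have "\<forall>\<^sub>F s in at t within S. (\<Sum>i<k. \<bar>q i s\<bar>) < L + 1"
      by (rule order_tendstoD) simp
    moreover have "\<forall>\<^sub>F s in at t within S. s \<noteq> t"
      by (simp add: eventually_at_filter)
    ultimately show "\<forall>\<^sub>F s in at t within S. dist (R (c s) / (s - t)) 0 < e"
    proof eventually_elim
      case (elim s)
      have "c s \<in> near k (c t) d" using elim c0 by (auto simp: near_def)
      then have "\<bar>R (c s)\<bar> \<le> e / (L + 1) * (\<Sum>i<k. \<bar>c s i - c t i\<bar>)" by (rule d(2))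
      then have "\<bar>R (c s)\<bar> / \<bar>s - t\<bar> \<le> e / (L + 1) * (\<Sum>i<k. \<bar>c s i - c t i\<bar>) / \<bar>s - t\<bar>"
        by (rule divide_right_mono) simp
      also have "\<dots> = e / (L + 1) * (\<Sum>i<k. \<bar>q i s\<bar>)"
        by (simp add: q_def sum_divide_distrib[symmetric] abs_divide)
      also have "\<dots> < e / (L + 1) * (L + 1)"
        using elim e L by (intro mult_strict_left_mono) auto
      also have "\<dots> = e" using L by simp
      finally show ?case by (simp add: abs_divide)
    qed
  qed
  moreover have "((\<lambda>s. \<Sum>i<k. partial i F (c t) * q i s) \<longlongrightarrow> (\<Sum>i<k. partial i F (c t) * c' i)) (at t within S)"
    using q by (intro tendsto_sum tendsto_mult tendsto_const) auto
  ultimately have "((\<lambda>s. R (c s) / (s - t) + (\<Sum>i<k. partial i F (c t) * q i s)) \<longlongrightarrow>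
      0 + (\<Sum>i<k. partial i F (c t) * c' i)) (at t within S)"
    by (rule tendsto_add)
  moreover have "R (c s) / (s - t) + (\<Sum>i<k. partial i F (c t) * q i s) = (F (c s) - F (c t)) / (s - t)"
    for s
    unfolding R_def q_def
      by (simp add: add_divide_distrib[symmetric] diff_divide_distrib[symmetric] times_divide_eq_right sum_divide_distrib[symmetric])
  ultimately show ?thesis
    unfolding has_field_derivative_iff by simp
qed

text \<open>Induction on the order: by the chain rule each partial is a sum of products to which the
  induction hypothesis for order r applies. Padding with 0 turns the inner functions into a point of
  the k-dimensional coordinate space.\<close>

lemma C_on_compose:
  assumes U: "eopen n U" and W: "eopen k W"
    and T: "\<And>i. i < k \<Longrightarrow> C_on r n U (\<tau> i)" and F: "C_on r k W F"
    and m: "\<And>x. x \<in> U \<Longrightarrow> (\<lambda>i. if i < k then \<tau> i x else 0) \<in> W"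
  shows "C_on r n U (\<lambda>x. F (\<lambda>i. if i < k then \<tau> i x else 0))"
  using T F
proof (induction r arbitrary: F)
  case 0
  have "continuous_on U (\<lambda>x i. if i < k then \<tau> i x else 0)"
  proof (rule continuous_on_coordinatewise_then_product)
    show "continuous_on U (\<lambda>x. if i < k then \<tau> i x else 0)" for i
      using 0 by (cases "i < k") auto
  qed
  then show ?case using 0 m continuous_on_compose2[of W F U "\<lambda>x i. if i < k then \<tau> i x else 0"] by auto
next
  case (Suc r)
  let ?c = "\<lambda>x i. if i < k then \<tau> i x else 0"
  have IH: "C_on r n U (\<lambda>x. H (?c x))" if "C_on r k W H" for H
    using Suc.IH[of H] that Suc.prems(1) C_on_Suc_imp by blast
  show ?case
  proof (rule C_on_SucI[OF U, where G = "\<lambda>j x. \<Sum>i<k. partial i F (?c x) * partial j (\<tau> i) x"])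
    show "continuous_on U (\<lambda>x. F (?c x))"
      using IH[OF C_on_Suc_imp[OF Suc.prems(2)]] C_on_continuous by blast
    show "C_on r n U (\<lambda>x. \<Sum>i<k. partial i F (?c x) * partial j (\<tau> i) x)" if "j < n" for j
      using that by (intro C_on_sum[OF U] C_on_mult[OF U] IH C_on_SucD(1)[OF Suc.prems(1)] C_on_SucD(1)[OF Suc.prems(2)]) auto
    fix j x assume jx: "j < n" "x \<in> U"
    have F1: "C_on (Suc 0) k W F"
      by (rule C_on_mono[OF _ Suc.prems(2)]) simp
    have "((\<lambda>s. F (?c (x(j := s)))) has_real_derivative
        (\<Sum>i<k. partial i F (?c (x(j := x j))) * partial j (\<tau> i) x)) (at (x j))"
    proof (rule C1_chain_rule[OF W F1])
      show "?c (x(j := x j)) \<in> W"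
        unfolding fun_upd_triv by (rule m[OF jx(2)])
      show "((\<lambda>s. ?c (x(j := s)) i) has_real_derivative partial j (\<tau> i) x) (at (x j))" if "i < k" for i
        using C_on_SucD(2)[OF Suc.prems(1)[OF that] jx] that by (simp del: fun_upd_apply)
    qed auto
    then show "((\<lambda>s. F (?c (x(j := s)))) has_real_derivative
        (\<Sum>i<k. partial i F (?c x) * partial j (\<tau> i) x)) (at (x j))"
      unfolding fun_upd_triv .
  qed
qed

section \<open>Symmetry of second partial derivatives\<close>

lemma MVT_between:
  fixes f :: "real \<Rightarrow> real"
  assumes "h > 0" "\<And>s. a \<le> s \<Longrightarrow> s \<le> a + h \<Longrightarrow> (f has_real_derivative f' s) (at s)"
  obtains s where "a < s" "s < a + h" "f (a + h) - f a = h * f' s"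
  using MVT2[of a "a + h" f f'] assms by auto

text \<open>The mean value theorem is applied in direction i and then in direction j. The second
  difference on the left is symmetric in i and j, while the order of the partials on the right is
  not; comparing the two orders as h shrinks gives \<open>partial_commute\<close>.\<close>

lemma mixed_difference:
  assumes U: "eopen k U" and F: "C_on 2 k U F" and x: "near k x d \<subseteq> U" "\<And>i. i \<ge> k \<Longrightarrow> x i = 0"
    and ij: "i < k" "j < k" "i \<noteq> j" and h: "0 < h" "h < d"
  obtains y where "y \<in> near k x d"
    "F (x(i := x i + h, j := x j + h)) - F (x(i := x i + h)) - F (x(j := x j + h)) + F x
      = h * h * partial j (partial i F) y"
proof -
  have F': "C_on (Suc (Suc 0)) k U F" using F by (simp add: numeral_2_eq_2)
  have pt: "x(i := s, j := t) \<in> near k x d" if "\<bar>s - x i\<bar> < d" "\<bar>t - x j\<bar> < d" for s t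
    using that x h ij by (auto simp: near_def)
  have Di: "((\<lambda>s. F (x(i := s, j := t))) has_real_derivative partial i F (x(i := s, j := t))) (at s)"
    if "\<bar>s - x i\<bar> < d" "\<bar>t - x j\<bar> < d" for s t
  proof -
    have "x(i := s, j := t) \<in> U" using pt[OF that] x by blast
    from C_on_SucD(2)[OF F' ij(1) this] show ?thesis
      using ij by (simp add: fun_upd_twist[of i j])
  qed
  have Dj: "((\<lambda>t. partial i F (x(i := s, j := t))) has_real_derivative partial j (partial i F) (x(i := s, j := t))) (at t)"
    if "\<bar>s - x i\<bar> < d" "\<bar>t - x j\<bar> < d" for s t
  proof -
    have "x(i := s, j := t) \<in> U" using pt[OF that] x by blast
    from C_on_SucD(2)[OF C_on_SucD(1)[OF F' ij(1)] ij(2) this] show ?thesis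
      by (simp add: fun_upd_upd)
  qed
  define A where "A s = F (x(i := s, j := x j + h)) - F (x(i := s, j := x j))" for s
  obtain s where s: "x i < s" "s < x i + h"
    "A (x i + h) - A (x i) = h * (partial i F (x(i := s, j := x j + h)) - partial i F (x(i := s, j := x j)))"
  proof (rule MVT_between[OF h(1)])
    show "(A has_real_derivative (partial i F (x(i := s, j := x j + h)) - partial i F (x(i := s, j := x j)))) (at s)"
      if "x i \<le> s" "s \<le> x i + h" for s
      unfolding A_def by (rule DERIV_diff; rule Di) (use that h in auto)
  qed
  obtain t where t: "x j < t" "t < x j + h"
    "partial i F (x(i := s, j := x j + h)) - partial i F (x(i := s, j := x j)) = h * partial j (partial i F) (x(i := s, j := t))"
  proof (rule MVT_between[OF h(1)])
    show "((\<lambda>t. partial i F (x(i := s, j := t))) has_real_derivative partial j (partial i F) (x(i := s, j := t))) (at t)"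
      if "x j \<le> t" "t \<le> x j + h" for t
      by (rule Dj) (use that h s in auto)
  qed
  show thesis
  proof (rule that[of "x(i := s, j := t)"])
    show "x(i := s, j := t) \<in> near k x d" by (rule pt) (use s t h in auto)
    have "x(i := x i + h, j := x j) = x(i := x i + h)" "x(i := x i, j := x j + h) = x(j := x j + h)" "x(i := x i, j := x j) = x"
      using ij by (auto simp: fun_eq_iff)
    then have "A (x i + h) - A (x i) = F (x(i := x i + h, j := x j + h)) - F (x(i := x i + h)) - F (x(j := x j + h)) + F x"
      by (simp add: A_def del: fun_upd_apply)
    then show "F (x(i := x i + h, j := x j + h)) - F (x(i := x i + h)) - F (x(j := x j + h)) + F x
      = h * h * partial j (partial i F) (x(i := s, j := t))"
      using s(3) t(3) by (simp del: fun_upd_apply)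
  qed
qed

lemma partial_commute:
  assumes U: "eopen k U" and F: "C_on 2 k U F" and x: "x \<in> U" and ij: "i < k" "j < k"
  shows "partial i (partial j F) x = partial j (partial i F) x"
proof (cases "i = j")
  case False
  have F': "C_on (Suc (Suc 0)) k U F" using F by (simp add: numeral_2_eq_2)
  have c: "continuous_on U (partial i (partial j F))" "continuous_on U (partial j (partial i F))"
    using C_on_continuous[OF C_on_SucD(1)[OF C_on_SucD(1)[OF F']]] ij by blast+
  have "\<bar>partial i (partial j F) x - partial j (partial i F) x\<bar> \<le> 0 + e" if "e > 0" for e
  proof -
    have e: "e / 2 > 0" using that by simp
    obtain d1 where d1: "d1 > 0" "near k x d1 \<subseteq> U"
      "\<And>y. y \<in> near k x d1 \<Longrightarrow> \<bar>partial i (partial j F) y - partial i (partial j F) x\<bar> < e / 2"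
      using continuous_near[OF U c(1) x e] by blast
    obtain d2 where d2: "d2 > 0" "near k x d2 \<subseteq> U"
      "\<And>y. y \<in> near k x d2 \<Longrightarrow> \<bar>partial j (partial i F) y - partial j (partial i F) x\<bar> < e / 2"
      using continuous_near[OF U c(2) x e] by blast
    define d where "d = min d1 d2"
    have d: "d > 0" "near k x d \<subseteq> near k x d1" "near k x d \<subseteq> near k x d2" "near k x d \<subseteq> U"
      using d1 d2 near_mono[of d d1 k x] near_mono[of d d2 k x] by (auto simp: d_def)
    define h where "h = d / 2"
    have h: "0 < h" "h < d" using d by (auto simp: h_def)
    have x0: "\<And>i. i \<ge> k \<Longrightarrow> x i = 0" using eopenD_zero[OF U x] .
    obtain y where y: "y \<in> near k x d"
        "F (x(i := x i + h, j := x j + h)) - F (x(i := x i + h)) - F (x(j := x j + h)) + F x = h * h * partial j (partial i F) y"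
      using mixed_difference[OF U F d(4) x0 ij False h] by metis
    obtain z where z: "z \<in> near k x d"
        "F (x(j := x j + h, i := x i + h)) - F (x(j := x j + h)) - F (x(i := x i + h)) + F x = h * h * partial i (partial j F) z"
      using mixed_difference[OF U F d(4) x0 ij(2,1) _ h] False by metis
    have "x(j := x j + h, i := x i + h) = x(i := x i + h, j := x j + h)"
      using False by (auto simp: fun_eq_iff)
    from z(2)[unfolded this] y(2)
    have "h * h * partial j (partial i F) y = h * h * partial i (partial j F) z"
      by linarith
    then have "partial j (partial i F) y = partial i (partial j F) z"
      using h by simp
    moreover have "\<bar>partial i (partial j F) z - partial i (partial j F) x\<bar> < e / 2"
      "\<bar>partial j (partial i F) y - partial j (partial i F) x\<bar> < e / 2"
      using d1(3) d2(3) d y z by blast+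
    ultimately show ?thesis by linarith
  qed
  then have "\<bar>partial i (partial j F) x - partial j (partial i F) x\<bar> \<le> 0"
    by (rule field_le_epsilon)
  then show ?thesis by simp
qed simp

section \<open>Hadamard's lemma and bump functions\<close>

lemma ray_mem_near:
  assumes "y \<in> near k c d" "\<And>i. i \<ge> k \<Longrightarrow> c i = 0" "0 \<le> t" "t \<le> 1"
  shows "(\<lambda>i. c i + t * (y i - c i)) \<in> near k c d"
proof -
  have "\<bar>t * (y i - c i)\<bar> < d" if "i < k" for i
  proof -
    have "\<bar>t * (y i - c i)\<bar> \<le> 1 * \<bar>y i - c i\<bar>"
      unfolding abs_mult using assms(3,4) by (intro mult_right_mono) auto
    then show ?thesis using assms(1) that by (auto simp: near_def)
  qed
  then show ?thesis using assms(1,2) by (auto simp: near_def)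
qed

lemma continuous_on_ray:
  assumes "continuous_on (near k c d) F" "\<And>i. i \<ge> k \<Longrightarrow> c i = 0"
  shows "continuous_on (near k c d \<times> {0..1}) (\<lambda>(y, t). t ^ a * F (\<lambda>i. c i + t * (y i - c i)))"
proof -
  have "continuous_on (near k c d \<times> {0..1::real}) (\<lambda>z i. c i + snd z * (fst z i - c i))"
  proof (rule continuous_on_coordinatewise_then_product)
    show "continuous_on (near k c d \<times> {0..1::real}) (\<lambda>z. c i + snd z * (fst z i - c i))" for i
    proof -
      have "continuous_on (near k c d \<times> {0..1::real}) (\<lambda>z. fst z i)"
        by (rule continuous_on_compose2[OF continuous_on_product_coordinates continuous_on_fst]) (auto intro: continuous_on_id)
      then show ?thesis by (intro continuous_intros)
    qed
  qed
  then have "continuous_on (near k c d \<times> {0..1}) (\<lambda>z. F (\<lambda>i. c i + snd z * (fst z i - c i)))"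
    using ray_mem_near[OF _ assms(2)]
    by (intro continuous_on_compose2[OF assms(1)]) auto
  then show ?thesis unfolding split_beta
    by (intro continuous_intros)
qed

text \<open>Differentiating \<open>F\<close> along the ray with respect to a coordinate of y
  produces a factor t, so the induction must carry an arbitrary power of t in the integrand.\<close>

lemma C_on_ray_integral:
  assumes "C_on r k (near k c d) F" and c: "\<And>i. i \<ge> k \<Longrightarrow> c i = 0"
  shows "C_on r k (near k c d) (\<lambda>y. integral {0..1} (\<lambda>t. t ^ a * F (\<lambda>i. c i + t * (y i - c i))))"
  using assms(1)
proof (induction r arbitrary: F a)
  case 0
  then show ?case
    using integral_continuous_on_param[of "near k c d" 0 "1::real", OF continuous_on_ray[OF _ c, folded cbox_interval]]
    by simp
next
  case (Suc r)
  let ?p = "\<lambda>t y i. c i + t * (y i - c i)"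
  show ?case
  proof (rule C_on_SucI[OF eopen_near, where G = "\<lambda>j y. integral {0..1} (\<lambda>t. t ^ Suc a * partial j F (?p t y))"])
    show "continuous_on (near k c d) (\<lambda>y. integral {0..1} (\<lambda>t. t ^ a * F (?p t y)))"
      using C_on_continuous[OF Suc.IH[OF C_on_Suc_imp[OF Suc.prems]]] .
    show "C_on r k (near k c d) (\<lambda>y. integral {0..1} (\<lambda>t. t ^ Suc a * partial j F (?p t y)))" if "j < k"
      for j
      by (rule Suc.IH[OF C_on_SucD(1)[OF Suc.prems that]])
    fix j y assume j: "j < k" and y: "y \<in> near k c d"
    define S where "S = ball (c j) d"
    have yS: "y(j := s) \<in> near k c d" if "s \<in> S" for s
      using that y j by (auto simp: S_def near_def dist_real_def abs_minus_commute)
    have upd: "?p t (y(j := s)) = (?p t y)(j := c j + t * (s - c j))" for t s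
      by auto
    have "((\<lambda>s. integral (cbox 0 1) (\<lambda>t. t ^ a * F (?p t (y(j := s))))) has_field_derivative
        integral (cbox 0 1) (\<lambda>t. t ^ Suc a * partial j F (?p t (y(j := y j))))) (at (y j) within S)"
    proof (rule leibniz_rule_field_derivative[of S 0 1 "\<lambda>s t. t ^ a * F (?p t (y(j := s)))" "\<lambda>s t. t ^ Suc a * partial j F (?p t (y(j := s)))"])
      show "((\<lambda>s. t ^ a * F (?p t (y(j := s)))) has_real_derivative t ^ Suc a * partial j F (?p t (y(j := s)))) (at s within S)"
        if "s \<in> S" "t \<in> cbox 0 1" for s t
      proof -
        have "?p t (y(j := s)) \<in> near k c d" using ray_mem_near[OF yS[OF that(1)] c] that(2) by auto
        from C_on_SucD(2)[OF Suc.prems j this]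
        have "((\<lambda>u. F ((?p t y)(j := u))) has_real_derivative partial j F (?p t (y(j := s)))) (at (c j + t * (s - c j)))"
          unfolding upd fun_upd_upd fun_upd_same .
        then have "((\<lambda>s. F ((?p t y)(j := c j + t * (s - c j)))) has_real_derivative partial j F (?p t (y(j := s))) * t) (at s within S)"
          by (rule DERIV_chain2) (auto intro!: derivative_eq_intros)
        from DERIV_cmult[OF this, of "t ^ a"] show ?thesis
          unfolding upd by (simp add: mult_ac del: fun_upd_apply)
      qed
      have cont: "continuous_on (S \<times> cbox 0 1) (\<lambda>(s, t). t ^ b * H (?p t (y(j := s))))"
        if "continuous_on (near k c d) H" for H b
      proof -
        have c1: "continuous_on (S \<times> cbox 0 1) (\<lambda>z::real \<times> real. (y(j := fst z), snd z))"
        proof (intro continuous_on_Pair continuous_on_snd continuous_on_id continuous_on_coordinatewise_then_product)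
          show "continuous_on (S \<times> cbox 0 1) (\<lambda>z::real \<times> real. (y(j := fst z)) i)" for i
            by (cases "i = j") (auto intro: continuous_intros)
        qed
        have c2: "(\<lambda>z::real \<times> real. (y(j := fst z), snd z)) ` (S \<times> cbox 0 1) \<subseteq> near k c d \<times> {0..1}"
          using yS by (auto simp del: fun_upd_apply)
        show ?thesis
          using continuous_on_compose2[OF continuous_on_ray[OF that c, of b] c1 c2]
          by (simp add: split_beta del: fun_upd_apply)
      qed
      show "continuous_on (S \<times> cbox 0 1) (\<lambda>(s, t). t ^ Suc a * partial j F (?p t (y(j := s))))"
        by (rule cont[OF C_on_continuous[OF C_on_SucD(1)[OF Suc.prems j]]])
      show "(\<lambda>t. t ^ a * F (?p t (y(j := s)))) integrable_on cbox 0 1" if "s \<in> S" for s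
      proof (rule integrable_continuous)
        have "continuous_on (cbox 0 1) (\<lambda>t::real. (s, t))" by (intro continuous_intros)
        from continuous_on_compose2[OF cont[OF C_on_continuous[OF Suc.prems], of a] this]
        show "continuous_on (cbox 0 1) (\<lambda>t. t ^ a * F (?p t (y(j := s))))"
          using that by (auto simp: image_subset_iff)
      qed
      show "y j \<in> S" using y j by (auto simp: S_def near_def dist_real_def abs_minus_commute)
      show "convex S" by (simp add: S_def)
    qed
    moreover have "at (y j) within S = at (y j)"
      using y j by (intro at_within_open) (auto simp: S_def near_def dist_real_def abs_minus_commute)
    ultimately show "((\<lambda>s. integral {0..1} (\<lambda>t. t ^ a * F (?p t (y(j := s))))) has_real_derivative
        integral {0..1} (\<lambda>t. t ^ Suc a * partial j F (?p t y))) (at (y j))"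
      unfolding fun_upd_triv cbox_interval by simp
  qed
qed

text \<open>\<open>q i\<close> is the mean of the i-th partial over the segment from c to y; the
  expansion is the fundamental theorem of calculus on that segment.\<close>

lemma hadamard:
  assumes F: "smooth_on k (near k c d) F" and c: "\<And>i. i \<ge> k \<Longrightarrow> c i = 0" and d: "d > 0"
  obtains q where "\<And>i. i < k \<Longrightarrow> smooth_on k (near k c d) (q i)"
    "\<And>i. i < k \<Longrightarrow> q i c = partial i F c"
    "\<And>y. y \<in> near k c d \<Longrightarrow> F y = F c + (\<Sum>i<k. (y i - c i) * q i y)"
proof -
  let ?p = "\<lambda>t y i. c i + t * (y i - c i)"
  have C: "C_on r k (near k c d) F" for r using F by (simp add: smooth_on_def)
  define q where "q i y = integral {0..1} (\<lambda>t. t ^ 0 * partial i F (?p t y))" for i y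
  show thesis
  proof (rule that[of q])
    show "smooth_on k (near k c d) (q i)" if "i < k" for i
      unfolding smooth_on_def q_def using C_on_ray_integral[OF C_on_SucD(1)[OF C that] c] by blast
    show "q i c = partial i F c" for i by (simp add: q_def)
    fix y assume y: "y \<in> near k c d"
    have D: "((\<lambda>t. F (?p t y)) has_real_derivative (\<Sum>i<k. partial i F (?p t y) * (y i - c i))) (at t within {0..1})"
      if "t \<in> {0..1}" for t
      by (rule C1_chain_rule[OF eopen_near C])
        (use ray_mem_near[OF y c] y that c in \<open>auto simp: near_def intro!: derivative_eq_intros\<close>)
    have "((\<lambda>t. \<Sum>i<k. partial i F (?p t y) * (y i - c i)) has_integral F (?p 1 y) - F (?p 0 y)) {0..1}"
      by (rule fundamental_theorem_of_calculus)
        (use D in \<open>auto simp: has_real_derivative_iff_has_vector_derivative\<close>)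
    moreover have "((\<lambda>t. \<Sum>i<k. partial i F (?p t y) * (y i - c i)) has_integral (\<Sum>i<k. q i y * (y i - c i))) {0..1}"
    proof (intro has_integral_sum has_integral_mult_left)
      fix i assume "i \<in> {..<k}"
      then have "continuous_on (near k c d) (partial i F)"
        using C_on_continuous[OF C_on_SucD(1)[OF C]] by blast
      from continuous_on_ray[OF this c, of 0]
      moreover have "continuous_on {0..1} (\<lambda>t::real. (y, t))"
        by (intro continuous_on_Pair continuous_on_const continuous_on_id)
      ultimately have "continuous_on {0..1} (\<lambda>t. partial i F (?p t y))"
        using continuous_on_compose2[of "near k c d \<times> {0..1}" "\<lambda>(y, t). t ^ 0 * partial i F (?p t y)" "{0..1}" "\<lambda>t. (y, t)"] y
        by (auto simp: image_subset_iff)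
      then show "((\<lambda>t. partial i F (?p t y)) has_integral q i y) {0..1}"
        unfolding q_def by (simp add: integrable_continuous_interval integrable_integral)
    qed simp
    ultimately have "F (?p 1 y) - F (?p 0 y) = (\<Sum>i<k. q i y * (y i - c i))"
      by (rule has_integral_unique)
    then show "F y = F c + (\<Sum>i<k. (y i - c i) * q i y)"
      by (simp add: mult.commute)
  qed
qed

section \<open>Flat functions and bump functions\<close>

text \<open>The classical flat function is the case \<open>m = 0\<close>. Dividing by powers of t
  makes the family closed, up to linear combinations, under differentiation, so that smoothness
  follows by one induction.\<close>

definition flat :: "nat \<Rightarrow> real \<Rightarrow> real" where
  "flat m t = (if t > 0 then exp (- (1 / t)) / t ^ m else 0)"

lemma flat_tendsto_0: "(flat m \<longlongrightarrow> 0) (at 0)"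
proof -
  have "((\<lambda>t. inverse t ^ m / exp (inverse t)) \<longlongrightarrow> 0) (at_right (0::real))"
    by (rule filterlim_compose[OF tendsto_power_div_exp_0 filterlim_inverse_at_top_right])
  moreover have "\<forall>\<^sub>F t in at_right 0. inverse t ^ m / exp (inverse t) = flat m t"
    by (rule eventually_at_rightI[of 0 1]) (auto simp: flat_def exp_minus field_simps)
  ultimately have "(flat m \<longlongrightarrow> 0) (at_right 0)" by (rule Lim_transform_eventually)
  moreover have "(flat m \<longlongrightarrow> 0) (at_left 0)"
    by (rule Lim_transform_eventually[OF tendsto_const]) (auto simp: eventually_at_filter flat_def)
  ultimately show ?thesis by (rule filterlim_split_at[rotated])
qed

lemma flat_deriv: "(flat m has_real_derivative flat (m + 2) t - real m * flat (m + 1) t) (at t)"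
proof -
  consider "t > 0" | "t < 0" | "t = 0" by linarith
  then show ?thesis
  proof cases
    case 1
    have "((\<lambda>t. exp (- (1 / t)) / t ^ m) has_real_derivative flat (m + 2) t - real m * flat (m + 1) t) (at t)"
    proof (rule DERIV_cong[OF DERIV_divide])
      show "((\<lambda>t. exp (- (1 / t))) has_real_derivative exp (- (1 / t)) / (t * t)) (at t)"
        using 1 by (auto intro!: derivative_eq_intros simp: power2_eq_square)
      show "((\<lambda>t. t ^ m) has_real_derivative real m * t ^ m / t) (at t)"
        by (rule DERIV_cong[OF DERIV_pow]) (use 1 in \<open>cases m, auto\<close>)
    qed (use 1 in \<open>auto simp: flat_def field_simps\<close>)
    then show ?thesis
      by (rule has_field_derivative_transform_within_open[of _ _ _ "{0<..}"]) (use 1 in \<open>auto simp: flat_def\<close>)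
  next
    case 2
    have "((\<lambda>t. 0) has_real_derivative flat (m + 2) t - real m * flat (m + 1) t) (at t)"
      using 2 by (simp add: flat_def)
    then show ?thesis
      by (rule has_field_derivative_transform_within_open[of _ _ _ "{..<0}"]) (use 2 in \<open>auto simp: flat_def\<close>)
  next
    case 3
    \<comment> \<open>The difference quotient at 0 is again a member of the family, even at
      \<open>s = 0\<close>, where both sides are 0 because division by 0 yields 0.\<close>
    have "flat (Suc m) = (\<lambda>s. (flat m s - flat m 0) / (s - 0))"
      by (auto simp: flat_def fun_eq_iff)
    then have "(flat m has_real_derivative 0) (at 0)"
      unfolding has_field_derivative_iff using flat_tendsto_0[of "Suc m"] by simp
    then show ?thesis using 3 by (simp add: flat_def)
  qed
qed

lemma C_on_flat:
  assumes U: "eopen k U" and "C_on r k U q"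
  shows "C_on r k U (\<lambda>y. flat m (q y))"
  using assms(2)
proof (induction r arbitrary: m)
  case 0
  have "continuous_on UNIV (flat m)"
    by (rule continuous_at_imp_continuous_on) (auto intro: DERIV_isCont flat_deriv)
  then show ?case using 0 by (auto intro: continuous_on_compose2)
next
  case (Suc r)
  show ?case
  proof (rule C_on_SucI[OF U, where G = "\<lambda>j y. (flat (m + 2) (q y) + (- real m) * flat (m + 1) (q y)) * partial j q y"])
    have "continuous_on UNIV (flat m)"
      by (rule continuous_at_imp_continuous_on) (auto intro: DERIV_isCont flat_deriv)
    then show "continuous_on U (\<lambda>y. flat m (q y))"
      by (rule continuous_on_compose2[OF _ C_on_continuous[OF Suc.prems]]) simp
    show "C_on r k U (\<lambda>y. (flat (m + 2) (q y) + (- real m) * flat (m + 1) (q y)) * partial j q y)" if "j < k"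
      for j
      using Suc.IH[OF C_on_Suc_imp[OF Suc.prems]]
      by (intro C_on_mult[OF U] C_on_add[OF U] C_on_const C_on_SucD(1)[OF Suc.prems that])
    show "((\<lambda>t. flat m (q (y(j := t)))) has_real_derivative
        (flat (m + 2) (q y) + (- real m) * flat (m + 1) (q y)) * partial j q y) (at (y j))"
      if "j < k" "y \<in> U" for j y
      using DERIV_chain2[OF flat_deriv[of m] C_on_SucD(2)[OF Suc.prems that]]
      unfolding fun_upd_triv by (simp del: fun_upd_apply)
  qed
qed

text \<open>Squares keep the argument of \<open>flat\<close> smooth. For positive d the function is
  positive exactly on the Euclidean ball of radius d (among the first k coordinates), hence it
  vanishes outside the cube of half side d.\<close>

definition bump :: "nat \<Rightarrow> (nat \<Rightarrow> real) \<Rightarrow> real \<Rightarrow> (nat \<Rightarrow> real) \<Rightarrow> real" where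
  "bump k c d y = flat 0 (d\<^sup>2 - (\<Sum>i<k. (y i - c i)\<^sup>2))"

lemma C_on_bump: "eopen k U \<Longrightarrow> C_on r k U (bump k c d)"
  unfolding bump_def
proof (rule C_on_flat)
  assume U: "eopen k U"
  have "C_on r k U (\<lambda>y. d\<^sup>2 + (-1) * (\<Sum>i<k. (y i + (- c i)) * (y i + (- c i))))"
    by (intro C_on_add[OF U] C_on_mult[OF U] C_on_sum[OF U] C_on_const C_on_coord[OF U])
  then show "C_on r k U (\<lambda>y. d\<^sup>2 - (\<Sum>i<k. (y i - c i)\<^sup>2))"
    by (simp add: power2_eq_square)
qed

lemma bump_center: "d \<noteq> 0 \<Longrightarrow> bump k c d c > 0"
  by (simp add: bump_def flat_def)

lemma bump_zero:
  assumes "i < k" "\<bar>y i - c i\<bar> \<ge> d" "d \<ge> 0"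
  shows "bump k c d y = 0"
proof -
  have "d\<^sup>2 \<le> (y i - c i)\<^sup>2" using assms by (metis abs_of_nonneg abs_le_square_iff)
  also have "\<dots> \<le> (\<Sum>i<k. (y i - c i)\<^sup>2)" by (rule member_le_sum) (use assms in auto)
  finally show ?thesis by (simp add: bump_def flat_def)
qed

lemma smooth_on_cong:
  "eopen k U \<Longrightarrow> (\<And>y. y \<in> U \<Longrightarrow> F y = G y) \<Longrightarrow> smooth_on k U F \<Longrightarrow> smooth_on k U G"
  unfolding smooth_on_def using C_on_cong by blast

lemma smooth_on_subset: "smooth_on k U F \<Longrightarrow> V \<subseteq> U \<Longrightarrow> smooth_on k V F"
  unfolding smooth_on_def using C_on_subset by blast

lemma smooth_on_local:
  assumes "eopen k U" "\<And>x. x \<in> U \<Longrightarrow> \<exists>V. eopen k V \<and> x \<in> V \<and> smooth_on k V F"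
  shows "smooth_on k U F"
  unfolding smooth_on_def
  by (intro allI C_on_local[OF assms(1)]) (use assms(2) in \<open>meson smooth_on_def\<close>)

lemma smooth_on_continuous: "smooth_on k U F \<Longrightarrow> continuous_on U F"
  unfolding smooth_on_def using C_on_continuous by blast

lemma smooth_on_const: "smooth_on k U (\<lambda>_. c)"
  by (simp add: smooth_on_def C_on_const)

lemma smooth_on_coord: "eopen k U \<Longrightarrow> smooth_on k U (\<lambda>x. x j)"
  by (simp add: smooth_on_def C_on_coord)

lemma smooth_on_add: "eopen k U \<Longrightarrow> smooth_on k U F \<Longrightarrow> smooth_on k U G \<Longrightarrow> smooth_on k U (\<lambda>x. F x + G x)"
  by (simp add: smooth_on_def C_on_add)

lemma smooth_on_mult: "eopen k U \<Longrightarrow> smooth_on k U F \<Longrightarrow> smooth_on k U G \<Longrightarrow> smooth_on k U (\<lambda>x. F x * G x)"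
  by (simp add: smooth_on_def C_on_mult)

lemma smooth_on_inverse:
  "eopen k U \<Longrightarrow> smooth_on k U F \<Longrightarrow> (\<And>x. x \<in> U \<Longrightarrow> F x \<noteq> 0) \<Longrightarrow> smooth_on k U (\<lambda>x. inverse (F x))"
  by (simp add: smooth_on_def C_on_inverse)

lemma smooth_on_compose:
  assumes "eopen n U" "eopen k W" "\<And>i. i < k \<Longrightarrow> smooth_on n U (\<tau> i)" "smooth_on k W F"
    "\<And>x. x \<in> U \<Longrightarrow> (\<lambda>i. if i < k then \<tau> i x else 0) \<in> W"
  shows "smooth_on n U (\<lambda>x. F (\<lambda>i. if i < k then \<tau> i x else 0))"
  unfolding smooth_on_def
  by (intro allI C_on_compose[OF assms(1,2) _ _ assms(5)]) (use assms(3,4) in \<open>auto simp: smooth_on_def\<close>)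

lemma smooth_on_partial: "smooth_on k U F \<Longrightarrow> i < k \<Longrightarrow> smooth_on k U (partial i F)"
  unfolding smooth_on_def using C_on_SucD(1) by blast

lemma smooth_on_deriv:
  "smooth_on k U F \<Longrightarrow> i < k \<Longrightarrow> x \<in> U \<Longrightarrow> ((\<lambda>t. F (x(i := t))) has_real_derivative partial i F x) (at (x i))"
  unfolding smooth_on_def using C_on_SucD(2) by blast

lemma smooth_on_bump: "eopen k U \<Longrightarrow> smooth_on k U (bump k c d)"
  by (simp add: smooth_on_def C_on_bump)

lemma partial_eqI: "((\<lambda>t. F (x(i := t))) has_real_derivative D) (at (x i)) \<Longrightarrow> partial i F x = D"
  unfolding partial_def by (rule DERIV_imp_deriv)

lemma partial_add:
  assumes "smooth_on k U F" "smooth_on k U G" "i < k" "x \<in> U"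
  shows "partial i (\<lambda>y. F y + G y) x = partial i F x + partial i G x"
  by (rule partial_eqI, rule DERIV_add) (rule smooth_on_deriv[OF _ assms(3,4)], rule assms)+

lemma partial_mult:
  assumes "smooth_on k U F" "smooth_on k U G" "i < k" "x \<in> U"
  shows "partial i (\<lambda>y. F y * G y) x = partial i F x * G x + F x * partial i G x"
  using partial_eqI[OF DERIV_mult[OF smooth_on_deriv[OF assms(1,3,4)] smooth_on_deriv[OF assms(2,3,4)]]]
  unfolding fun_upd_triv by simp

text \<open>Closed cubes contain the supports of cut-off functions; compactness makes their images
  in the Hausdorff manifold closed.\<close>

lemma compact_box: "compact {y :: nat \<Rightarrow> real. (\<forall>i<k. \<bar>y i - c i\<bar> \<le> (d::real)) \<and> (\<forall>i\<ge>k. y i = 0)}"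
proof -
  have "compactin (product_topology (\<lambda>i::nat. euclidean :: real topology) UNIV)
      (Pi\<^sub>E UNIV (\<lambda>i. if i < k then {c i - d..c i + d} else {0}))"
    by (subst compactin_PiE) auto
  moreover have "Pi\<^sub>E UNIV (\<lambda>i. if i < k then {c i - d..c i + d} else {0})
      = {y. (\<forall>i<k. \<bar>y i - c i\<bar> \<le> d) \<and> (\<forall>i\<ge>k. y i = 0)}" (is "?L = ?R")
  proof (rule set_eqI)
    fix y
    have "y \<in> ?L \<longleftrightarrow> (\<forall>i. y i \<in> (if i < k then {c i - d..c i + d} else {0}))"
      by (auto simp: PiE_def Pi_def)
    also have "\<dots> \<longleftrightarrow> (\<forall>i. (i < k \<longrightarrow> \<bar>y i - c i\<bar> \<le> d) \<and> (i \<ge> k \<longrightarrow> y i = 0))"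
      by (intro iff_allI) (auto simp: abs_le_iff)
    also have "\<dots> \<longleftrightarrow> y \<in> ?R" by auto
    finally show "y \<in> ?L \<longleftrightarrow> y \<in> ?R" .
  qed
  ultimately show ?thesis by (simp add: euclidean_product_topology)
qed

section \<open>Smooth functions and vector fields on a manifold\<close>

locale smooth_mfd =
  fixes M :: "'m::{t2_space,second_countable_topology} manifold"
  assumes smooth_manifold: "smooth_manifold M"
begin

abbreviation "n \<equiv> mdim M"
abbreviation "CM \<equiv> smooth_functions M"
abbreviation "XM \<equiv> vector_fields M"
abbreviation "TM \<equiv> tangent_space M"

lemma chart:
  assumes "(U, \<phi>) \<in> atlas M"
  shows "open U" "eopen n (\<phi> ` U)" "homeomorphism U (\<phi> ` U) \<phi> (inv_into U \<phi>)"
  using smooth_manifold assms unfolding smooth_manifold_def is_chart_def by blast+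

lemma chart_cover: obtains U \<phi> where "(U, \<phi>) \<in> atlas M" "x \<in> U"
  using smooth_manifold unfolding smooth_manifold_def by blast

lemma chart_inv:
  assumes "(U, \<phi>) \<in> atlas M"
  shows "x \<in> U \<Longrightarrow> inv_into U \<phi> (\<phi> x) = x" "y \<in> \<phi> ` U \<Longrightarrow> \<phi> (inv_into U \<phi> y) = y"
    "y \<in> \<phi> ` U \<Longrightarrow> inv_into U \<phi> y \<in> U"
  using homeomorphism_apply1[OF chart(3)[OF assms]] homeomorphism_apply2[OF chart(3)[OF assms]]
  by (auto intro: inv_into_into)

lemma chart_zero: "(U, \<phi>) \<in> atlas M \<Longrightarrow> x \<in> U \<Longrightarrow> i \<ge> n \<Longrightarrow> \<phi> x i = 0"
  using eopenD_zero[OF chart(2)] by blast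

lemma chart_image_open:
  assumes "(U, \<phi>) \<in> atlas M" "open V"
  shows "eopen n (\<phi> ` (U \<inter> V))"
proof -
  have "openin (top_of_set (\<phi> ` U)) (\<phi> ` (U \<inter> V))"
    by (rule homeomorphism_imp_open_map[OF chart(3)[OF assms(1)]]) (use assms in \<open>auto simp: openin_open\<close>)
  moreover have "top_of_set (\<phi> ` U) = subtopology (Euclidean_space n) (\<phi> ` U)"
    using openin_subset[OF chart(2)[OF assms(1)]]
    by (simp add: Euclidean_space_eq subtopology_subtopology inf_absorb2)
  ultimately show ?thesis
    using chart(2)[OF assms(1)] openin_trans_full by metis
qed

lemma chart_preimage_open:
  assumes "(U, \<phi>) \<in> atlas M" "eopen n W"
  shows "open (U \<inter> \<phi> -` W)"
proof -
  obtain T where T: "open T" "W = {x. \<forall>i\<ge>n. x i = 0} \<inter> T"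
    using assms(2) by (auto simp: Euclidean_space_eq openin_open)
  have "open (U \<inter> \<phi> -` T)"
    using continuous_open_preimage[OF homeomorphism_cont1[OF chart(3)[OF assms(1)]] chart(1)[OF assms(1)] T(1)] .
  moreover have "U \<inter> \<phi> -` T = U \<inter> \<phi> -` W"
    using T(2) chart_zero[OF assms(1)] by auto
  ultimately show ?thesis by simp
qed

lemma smooth_fun_chart:
  "f \<in> CM \<Longrightarrow> (U, \<phi>) \<in> atlas M \<Longrightarrow> smooth_on n (\<phi> ` U) (\<lambda>y. f (inv_into U \<phi> y))"
  unfolding smooth_functions_def by (auto simp: o_def)

text \<open>The definition asks for smoothness in every chart of the atlas. Near each point one
  chart is enough, since the smooth transition maps carry the property to the others.\<close>

lemma smooth_funI:
  assumes "\<And>x. \<exists>U \<phi> V. (U, \<phi>) \<in> atlas M \<and> open V \<and> x \<in> U \<and> x \<in> V \<and>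
     smooth_on n (\<phi> ` (U \<inter> V)) (\<lambda>y. f (inv_into U \<phi> y))"
  shows "f \<in> CM"
proof -
  have "smooth_on n (\<psi> ` W) (\<lambda>y. f (inv_into W \<psi> y))" if W: "(W, \<psi>) \<in> atlas M" for W \<psi>
  proof (rule smooth_on_local[OF chart(2)[OF W]])
    fix y assume y: "y \<in> \<psi> ` W"
    define x where "x = inv_into W \<psi> y"
    have x: "x \<in> W" "\<psi> x = y" using chart_inv[OF W] y by (auto simp: x_def)
    obtain U \<phi> V where UV: "(U, \<phi>) \<in> atlas M" "open V" "x \<in> U" "x \<in> V"
        "smooth_on n (\<phi> ` (U \<inter> V)) (\<lambda>y. f (inv_into U \<phi> y))"
      using assms by blast
    let ?Z = "\<psi> ` (W \<inter> (U \<inter> V))"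
    have Z: "eopen n ?Z"
      by (rule chart_image_open[OF W]) (use chart(1)[OF UV(1)] UV(2) in auto)
    have tr: "(\<lambda>i. if i < n then transition W \<psi> \<phi> i z else 0) = \<phi> (inv_into W \<psi> z)" if "z \<in> ?Z" for z
    proof -
      have "inv_into W \<psi> z \<in> U" using that chart_inv[OF W] by auto
      then show ?thesis
        by (auto simp: transition_def fun_eq_iff chart_zero[OF UV(1)])
    qed
    have "smooth_on n ?Z (\<lambda>z. f (inv_into U \<phi> (\<lambda>i. if i < n then transition W \<psi> \<phi> i z else 0)))"
    proof (rule smooth_on_compose[OF Z chart_image_open[OF UV(1,2)] _ UV(5)])
      show "smooth_on n ?Z (transition W \<psi> \<phi> i)" if "i < n" for i
      proof (rule smooth_on_subset)
        show "smooth_on n (\<psi> ` (W \<inter> U)) (transition W \<psi> \<phi> i)"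
          using smooth_manifold W UV(1) that unfolding smooth_manifold_def by blast
      qed auto
      show "(\<lambda>i. if i < n then transition W \<psi> \<phi> i z else 0) \<in> \<phi> ` (U \<inter> V)" if "z \<in> ?Z" for z
        unfolding tr[OF that] using that chart_inv[OF W] by auto
    qed
    then have "smooth_on n ?Z (\<lambda>z. f (inv_into W \<psi> z))"
    proof (rule smooth_on_cong[OF Z, rotated])
      fix z assume z: "z \<in> ?Z"
      then have "inv_into W \<psi> z \<in> U" using chart_inv[OF W] by auto
      then show "f (inv_into U \<phi> (\<lambda>i. if i < n then transition W \<psi> \<phi> i z else 0)) = f (inv_into W \<psi> z)"
        unfolding tr[OF z] using chart_inv[OF UV(1)] by auto
    qed
    moreover have "y \<in> ?Z" using x UV(3,4) by blast
    ultimately show "\<exists>V. eopen n V \<and> y \<in> V \<and> smooth_on n V (\<lambda>y. f (inv_into W \<psi> y))"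
      using Z by blast
  qed
  then show ?thesis unfolding smooth_functions_def by (auto simp: o_def)
qed

lemma smooth_fun_const: "(\<lambda>_. c) \<in> CM"
  unfolding smooth_functions_def by (auto simp: o_def smooth_on_const)

lemma smooth_fun_add: "f \<in> CM \<Longrightarrow> h \<in> CM \<Longrightarrow> (\<lambda>x. f x + h x) \<in> CM"
  unfolding smooth_functions_def by (auto simp: o_def intro!: smooth_on_add chart(2))

lemma smooth_fun_mult: "f \<in> CM \<Longrightarrow> h \<in> CM \<Longrightarrow> (\<lambda>x. f x * h x) \<in> CM"
  unfolding smooth_functions_def by (auto simp: o_def intro!: smooth_on_mult chart(2))

lemma smooth_fun_inverse: "f \<in> CM \<Longrightarrow> (\<And>x. f x \<noteq> 0) \<Longrightarrow> (\<lambda>x. inverse (f x)) \<in> CM"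
  unfolding smooth_functions_def by (auto simp: o_def intro!: smooth_on_inverse chart(2))

lemma smooth_fun_cmult: "f \<in> CM \<Longrightarrow> (\<lambda>x. c * f x) \<in> CM"
  by (rule smooth_fun_mult[OF smooth_fun_const])

lemma smooth_fun_minus: "f \<in> CM \<Longrightarrow> (\<lambda>x. - f x) \<in> CM"
  using smooth_fun_cmult[of f "-1"] by simp

lemma smooth_fun_diff: "f \<in> CM \<Longrightarrow> h \<in> CM \<Longrightarrow> (\<lambda>x. f x - h x) \<in> CM"
  using smooth_fun_add[OF _ smooth_fun_minus, of f h] by simp

lemma smooth_fun_sum: "(\<And>i. i \<in> I \<Longrightarrow> f i \<in> CM) \<Longrightarrow> (\<lambda>x. \<Sum>i\<in>I. f i x) \<in> CM"
  by (induction I rule: infinite_finite_induct) (auto intro: smooth_fun_const smooth_fun_add)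

lemma smooth_fun_continuous:
  assumes "f \<in> CM"
  shows "continuous_on UNIV f"
proof (rule continuous_at_imp_continuous_on, rule ballI)
  fix x
  obtain U \<phi> where U: "(U, \<phi>) \<in> atlas M" "x \<in> U" by (rule chart_cover)
  have "continuous_on U (\<lambda>x. f (inv_into U \<phi> (\<phi> x)))"
    by (rule continuous_on_compose2[OF smooth_on_continuous[OF smooth_fun_chart[OF assms U(1)]]])
      (auto intro: homeomorphism_cont1[OF chart(3)[OF U(1)]])
  then have "continuous_on U f"
    by (rule continuous_on_eq) (simp add: chart_inv[OF U(1)])
  then show "isCont f x"
    using chart(1)[OF U(1)] U(2) continuous_on_eq_continuous_at by blast
qed

definition extend0 :: "'m set \<Rightarrow> ('m \<Rightarrow> nat \<Rightarrow> real) \<Rightarrow> (nat \<Rightarrow> real) set \<Rightarrow> ((nat \<Rightarrow> real) \<Rightarrow> real) \<Rightarrow> 'm \<Rightarrow> real" where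
  "extend0 U \<phi> B F x = (if x \<in> U \<and> \<phi> x \<in> B then F (\<phi> x) else 0)"

text \<open>Two open sets cover the manifold: the preimage of the open cube, where the function is F
  in coordinates, and the complement of the image of the smaller closed cube, where it is 0. The gap
  between d' and d makes them overlap.\<close>

lemma smooth_fun_extend0:
  assumes U: "(U, \<phi>) \<in> atlas M" and B: "near n c d \<subseteq> \<phi> ` U" and d: "d' < d"
    and F: "smooth_on n (near n c d) F"
    and F0: "\<And>y i. y \<in> near n c d \<Longrightarrow> i < n \<Longrightarrow> \<bar>y i - c i\<bar> > d' \<Longrightarrow> F y = 0"
  shows "extend0 U \<phi> (near n c d) F \<in> CM"
proof (rule smooth_funI)
  let ?f = "extend0 U \<phi> (near n c d) F"
  fix x
  show "\<exists>U \<phi> V. (U, \<phi>) \<in> atlas M \<and> open V \<and> x \<in> U \<and> x \<in> V \<and>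
     smooth_on n (\<phi> ` (U \<inter> V)) (\<lambda>y. ?f (inv_into U \<phi> y))"
  proof (cases "x \<in> U \<and> \<phi> x \<in> near n c d")
    case True
    define V where "V = U \<inter> \<phi> -` near n c d"
    have V: "open V" unfolding V_def by (rule chart_preimage_open[OF U eopen_near])
    have "smooth_on n (\<phi> ` (U \<inter> V)) F"
      by (rule smooth_on_subset[OF F]) (auto simp: V_def)
    then have "smooth_on n (\<phi> ` (U \<inter> V)) (\<lambda>y. ?f (inv_into U \<phi> y))"
      by (rule smooth_on_cong[OF chart_image_open[OF U V], rotated])
        (auto simp: extend0_def V_def chart_inv[OF U])
    then show ?thesis using True U V by (intro exI[of _ U] exI[of _ \<phi>] exI[of _ V]) (auto simp: V_def)
  next
    case False
    define K where "K = {y. (\<forall>i<n. \<bar>y i - c i\<bar> \<le> d') \<and> (\<forall>i\<ge>n. y i = 0)}"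
    have K: "K \<subseteq> near n c d" using d by (force simp: K_def near_def)
    have "compact (inv_into U \<phi> ` K)"
      by (rule compact_continuous_image[OF continuous_on_subset[OF homeomorphism_cont2[OF chart(3)[OF U]]]])
        (use K B compact_box in \<open>auto simp: K_def\<close>)
    then have V: "open (- (inv_into U \<phi> ` K))"
      using compact_imp_closed by blast
    have xV: "x \<in> - (inv_into U \<phi> ` K)"
      using False K B chart_inv[OF U] by (auto simp: subset_iff)
    have zero: "?f z = 0" if "z \<in> - (inv_into U \<phi> ` K)" for z
    proof (cases "z \<in> U \<and> \<phi> z \<in> near n c d")
      case True
      then have "\<phi> z \<notin> K" using that chart_inv(1)[OF U] by (metis ComplD imageI)
      then obtain i where "i < n" "\<bar>\<phi> z i - c i\<bar> > d'"
        using True chart_zero[OF U] by (auto simp: K_def not_le)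
      then show ?thesis using F0 True by (auto simp: extend0_def)
    qed (auto simp: extend0_def)
    obtain W \<psi> where W: "(W, \<psi>) \<in> atlas M" "x \<in> W" by (rule chart_cover)
    have "smooth_on n (\<psi> ` (W \<inter> - (inv_into U \<phi> ` K))) (\<lambda>y. ?f (inv_into W \<psi> y))"
      by (rule smooth_on_cong[OF chart_image_open[OF W(1) V] _ smooth_on_const[of _ _ 0]])
        (auto simp: zero chart_inv[OF W(1)])
    then show ?thesis using W V xV by blast
  qed
qed

section \<open>Tangent vectors and vector fields\<close>

lemma tangentD:
  assumes "v \<in> TM x"
  shows "f \<in> CM \<Longrightarrow> h \<in> CM \<Longrightarrow> v (\<lambda>y. f y + h y) = v f + v h"
    "f \<in> CM \<Longrightarrow> v (\<lambda>y. c * f y) = c * v f"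
    "f \<in> CM \<Longrightarrow> h \<in> CM \<Longrightarrow> v (\<lambda>y. f y * h y) = v f * h x + f x * v h"
    "f \<notin> CM \<Longrightarrow> v f = 0"
  using assms unfolding tangent_space_def by blast+

text \<open>The product rule for \<open>1 * 1\<close> doubles the derivative of 1, which is
  therefore 0.\<close>

lemma tangent_const: "v \<in> TM x \<Longrightarrow> v (\<lambda>_. c) = 0"
  using tangentD(3)[of v x "\<lambda>_. 1" "\<lambda>_. 1"] tangentD(2)[of v x "\<lambda>_. 1" c] smooth_fun_const by auto

lemma tangent_sum:
  assumes "v \<in> TM x" "\<And>i. i \<in> I \<Longrightarrow> f i \<in> CM"
  shows "v (\<lambda>y. \<Sum>i\<in>I. f i y) = (\<Sum>i\<in>I. v (f i))"
  using assms(2)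
proof (induction I rule: infinite_finite_induct)
  case (insert i I)
  then show ?case
    using tangentD(1)[OF assms(1), of "f i" "\<lambda>y. \<Sum>i\<in>I. f i y"] smooth_fun_sum[of I f] by simp
qed (use tangent_const[OF assms(1)] in auto)

lemma tangent_diff:
  assumes "v \<in> TM x" "f \<in> CM" "h \<in> CM"
  shows "v (\<lambda>y. f y - h y) = v f - v h"
  using tangentD(1)[OF assms(1,2) smooth_fun_cmult[OF assms(3), of "-1"]] tangentD(2)[OF assms(1,3), of "-1"]
  by simp

lemma tangent_zero: "(\<lambda>f. 0) \<in> TM x"
  by (simp add: tangent_space_def)

lemma tangent_add: "v \<in> TM x \<Longrightarrow> w \<in> TM x \<Longrightarrow> (\<lambda>f. v f + w f) \<in> TM x"
  unfolding tangent_space_def by (auto simp: algebra_simps)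

lemma tangent_cmult: "v \<in> TM x \<Longrightarrow> (\<lambda>f. c * v f) \<in> TM x"
  unfolding tangent_space_def by (auto simp: algebra_simps)

lemma tangent_lincomb:
  "(\<And>i. i \<in> I \<Longrightarrow> v i \<in> TM x) \<Longrightarrow> (\<lambda>f. \<Sum>i\<in>I. a i * v i f) \<in> TM x"
proof (induction I rule: infinite_finite_induct)
  case (insert i I)
  then show ?case
    using tangent_add[OF tangent_cmult[of "v i" x "a i"], of "\<lambda>f. \<Sum>i\<in>I. a i * v i f"] by simp
qed (simp_all add: tangent_zero)

lemma vector_fieldI:
  "(\<And>x. w x \<in> TM x) \<Longrightarrow> (\<And>f. f \<in> CM \<Longrightarrow> (\<lambda>x. w x f) \<in> CM) \<Longrightarrow> w \<in> XM"
  by (simp add: vector_fields_def vapply_def)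

lemma vector_fieldD:
  assumes "w \<in> XM"
  shows "w x \<in> TM x" "f \<in> CM \<Longrightarrow> (\<lambda>x. w x f) \<in> CM"
  using assms by (auto simp: vector_fields_def vapply_def)

lemma vadd_in: "w \<in> XM \<Longrightarrow> z \<in> XM \<Longrightarrow> vadd w z \<in> XM"
  by (auto intro!: vector_fieldI tangent_add smooth_fun_add dest: vector_fieldD simp: vadd_def)

lemma vscale_in: "h \<in> CM \<Longrightarrow> w \<in> XM \<Longrightarrow> vscale h w \<in> XM"
  by (auto intro!: vector_fieldI tangent_cmult smooth_fun_mult dest: vector_fieldD simp: vscale_def)

lemma vzero_in: "vzero \<in> XM"
  by (auto intro!: vector_fieldI tangent_zero smooth_fun_const simp: vzero_def)

lemma vsum_in: "(\<And>i. i \<in> I \<Longrightarrow> h i \<in> CM) \<Longrightarrow> (\<And>i. i \<in> I \<Longrightarrow> w i \<in> XM) \<Longrightarrow>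
    (\<lambda>x f. \<Sum>i\<in>I. h i x * w i x f) \<in> XM"
  by (intro vector_fieldI tangent_lincomb smooth_fun_sum smooth_fun_mult) (auto dest: vector_fieldD)

lemma vdiff_in: "w \<in> XM \<Longrightarrow> z \<in> XM \<Longrightarrow> vdiff w z \<in> XM"
  using vadd_in[OF _ vscale_in[OF smooth_fun_const], of w z "-1"]
  by (simp add: vdiff_def vadd_def vscale_def)

text \<open>In the product rule for the bracket the cross terms, one derivative on each factor, are
  symmetric in w and z and cancel.\<close>

lemma lie_bracket_in:
  assumes w: "w \<in> XM" and z: "z \<in> XM"
  shows "lie_bracket w z \<in> XM"
proof (rule vector_fieldI)
  note T = vector_fieldD[OF w] and T' = vector_fieldD[OF z]
  fix x
  show "lie_bracket w z x \<in> TM x"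
    unfolding tangent_space_def lie_bracket_def vapply_def mem_Collect_eq
  proof (intro conjI ballI allI impI)
    fix f h c assume f: "f \<in> CM" and h: "h \<in> CM"
    show "w x (\<lambda>x. z x (\<lambda>y. f y + h y)) - z x (\<lambda>x. w x (\<lambda>y. f y + h y)) =
        (w x (\<lambda>x. z x f) - z x (\<lambda>x. w x f)) + (w x (\<lambda>x. z x h) - z x (\<lambda>x. w x h))"
      using f h T T' by (simp add: tangentD(1)[OF T(1)] tangentD(1)[OF T'(1)])
    show "w x (\<lambda>x. z x (\<lambda>y. c * f y)) - z x (\<lambda>x. w x (\<lambda>y. c * f y)) =
        c * (w x (\<lambda>x. z x f) - z x (\<lambda>x. w x f))"
      using f h T T' by (simp add: tangentD(2)[OF T(1)] tangentD(2)[OF T'(1)] algebra_simps)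
    show "w x (\<lambda>x. z x (\<lambda>y. f y * h y)) - z x (\<lambda>x. w x (\<lambda>y. f y * h y)) =
        (w x (\<lambda>x. z x f) - z x (\<lambda>x. w x f)) * h x + f x * (w x (\<lambda>x. z x h) - z x (\<lambda>x. w x h))"
      using f h T T'
      by (simp add: tangentD(1,3)[OF T(1)] tangentD(1,3)[OF T'(1)] smooth_fun_mult algebra_simps)
  next
    fix f assume "f \<notin> CM"
    then have "(\<lambda>x. z x f) = (\<lambda>_. 0)" "(\<lambda>x. w x f) = (\<lambda>_. 0)"
      using tangentD(4)[OF T(1)] tangentD(4)[OF T'(1)] by auto
    then show "w x (\<lambda>x. z x f) - z x (\<lambda>x. w x f) = 0"
      using tangent_const[OF T(1)] tangent_const[OF T'(1)] by simp
  qed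
  show "(\<lambda>x. lie_bracket w z x f) \<in> CM" if "f \<in> CM" for f
    unfolding lie_bracket_def vapply_def using T T' that by (intro smooth_fun_diff) auto
qed

section \<open>Coordinates of tangent vectors and local frames\<close>

lemma extend0_at: "(U, \<phi>) \<in> atlas M \<Longrightarrow> p \<in> U \<Longrightarrow> d > 0 \<Longrightarrow> extend0 U \<phi> (near n (\<phi> p) d) F p = F (\<phi> p)"
  using near_center[OF chart(2)] by (simp add: extend0_def)

text \<open>The bump has half the radius of the cube, which leaves the margin that extension by 0
  requires.\<close>

lemma smooth_fun_cutoff:
  assumes "(U, \<phi>) \<in> atlas M" "near n c d \<subseteq> \<phi> ` U" "d > 0" "smooth_on n (near n c d) F"
  shows "extend0 U \<phi> (near n c d) (\<lambda>y. bump n c (d / 2) y * F y) \<in> CM"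
  using assms(3,4) bump_zero[where d = "d / 2" and c = c]
  by (intro smooth_fun_extend0[OF assms(1,2), of "d / 2"] smooth_on_mult smooth_on_bump eopen_near) auto

text \<open>Hadamard's lemma, cut off by a bump function, writes a smooth function near \<open>p\<close> as a
  constant plus products of functions vanishing at \<open>p\<close> with smooth functions.\<close>

lemma tangent_coordinates:
  assumes U: "(U, \<phi>) \<in> atlas M" "p \<in> U" and v: "v \<in> TM p"
  obtains a where "\<And>f. f \<in> CM \<Longrightarrow> v f = (\<Sum>i<n. a i * partial i (\<lambda>y. f (inv_into U \<phi> y)) (\<phi> p))"
proof -
  define c where "c = \<phi> p"
  obtain d where d: "d > 0" and B: "near n c d \<subseteq> \<phi> ` U"
    using eopen_near_subset[OF chart(2)[OF U(1)]] U(2) unfolding c_def by blast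
  have c0: "c i = 0" if "i \<ge> n" for i using chart_zero[OF U] that by (simp add: c_def)
  define E where "E = extend0 U \<phi> (near n c d)"
  note E = smooth_fun_cutoff[OF U(1) B d, folded E_def]
  have Ep: "E F p = F c" for F
    unfolding E_def c_def by (rule extend0_at[OF U d])
  define X where "X = E (\<lambda>y. bump n c (d / 2) y * 1)"
  define A where "A i = E (\<lambda>y. bump n c (d / 2) y * (y i + (- c i)))" for i
  have X: "X \<in> CM" unfolding X_def by (rule E[OF smooth_on_const])
  have A: "A i \<in> CM" for i
    unfolding A_def by (intro E smooth_on_add smooth_on_const smooth_on_coord eopen_near)
  have Xp: "X p > 0" unfolding X_def Ep using bump_center d by simp
  show thesis
  \<comment> \<open>The coefficient is the derivative of the cut-off coordinate with the value of
    the cut-off at p divided out; it depends on v only.\<close>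
  proof (rule that[of "\<lambda>i. v (A i) / X p"])
    fix f assume f: "f \<in> CM"
    define F where "F y = f (inv_into U \<phi> y)" for y
    have F: "smooth_on n (near n c d) F"
      unfolding F_def by (rule smooth_on_subset[OF smooth_fun_chart[OF f U(1)] B])
    have Fc: "F c = f p" by (simp add: F_def c_def chart_inv[OF U(1)] U(2))
    obtain q where q: "\<And>i. i < n \<Longrightarrow> smooth_on n (near n c d) (q i)"
      "\<And>i. i < n \<Longrightarrow> q i c = partial i F c"
      "\<And>y. y \<in> near n c d \<Longrightarrow> F y = F c + (\<Sum>i<n. (y i - c i) * q i y)"
      by (rule hadamard[OF F c0 d]) blast+
    define Q where "Q i = E (\<lambda>y. bump n c (d / 2) y * q i y)" for i
    have Q: "Q i \<in> CM" if "i < n" for i unfolding Q_def by (rule E[OF q(1)[OF that]])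
    have fd: "(\<lambda>x. f x + (- f p)) \<in> CM" by (intro smooth_fun_add f smooth_fun_const)
    \<comment> \<open>\<open>A i\<close> and \<open>Q i\<close> each carry one cut-off factor, hence
      the square on the left. Outside the cube both sides are 0, so the identity is global and v can
      be applied to it.\<close>
    have eq: "(\<lambda>x. (X x * X x) * (f x + (- f p))) = (\<lambda>x. \<Sum>i<n. A i x * Q i x)"
    proof
      fix x
      show "(X x * X x) * (f x + (- f p)) = (\<Sum>i<n. A i x * Q i x)"
      proof (cases "x \<in> U \<and> \<phi> x \<in> near n c d")
        case True
        then have "f x + (- f p) = (\<Sum>i<n. (\<phi> x i - c i) * q i (\<phi> x))"
          using q(3)[of "\<phi> x"] Fc chart_inv[OF U(1)] by (simp add: F_def)
        then show ?thesis
          using True by (simp add: X_def A_def Q_def E_def extend0_def sum_distrib_left algebra_simps)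
      qed (auto simp: X_def A_def Q_def E_def extend0_def)
    qed
    \<comment> \<open>The last factor vanishes at p, so the derivative of the cut-off does not
      contribute.\<close>
    have "v (\<lambda>x. (X x * X x) * (f x + (- f p))) = X p * X p * v f"
      using tangentD(3)[OF v smooth_fun_mult[OF X X] fd] tangentD(1)[OF v f smooth_fun_const, of "- f p"] tangent_const[OF v]
      by simp
    moreover have "A i p = 0" "Q i p = X p * q i c" for i
      by (simp_all add: A_def Q_def X_def Ep)
    then have "v (\<lambda>x. \<Sum>i<n. A i x * Q i x) = (\<Sum>i<n. v (A i) * (X p * partial i F c))"
      using tangent_sum[OF v, of "{..<n}" "\<lambda>i x. A i x * Q i x"] smooth_fun_mult[OF A Q] tangentD(3)[OF v A Q] q(2)
      by simp
    ultimately have "X p * (X p * v f) = X p * (\<Sum>i<n. v (A i) * partial i F c)"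
      using eq by (simp add: sum_distrib_left algebra_simps)
    then have "v f = (\<Sum>i<n. v (A i) * partial i F c) / X p"
      using Xp by (simp add: field_simps)
    then show "v f = (\<Sum>i<n. v (A i) / X p * partial i (\<lambda>y. f (inv_into U \<phi> y)) (\<phi> p))"
      by (simp add: sum_divide_distrib F_def[abs_def] c_def)
  qed
qed

text \<open>The fields are cut-off coordinate fields, global on the manifold. They span wherever the
  cut-off \<rho> is nonzero; independence is tested at p on cut-off coordinates.\<close>

lemma local_frame:
  obtains e \<rho> where "\<And>i. i < n \<Longrightarrow> e i \<in> XM" "\<And>a. (\<And>f. f \<in> CM \<Longrightarrow> (\<Sum>i<n. a i * e i p f) = 0) \<Longrightarrow> (\<forall>i<n. a i = 0)"
    "\<rho> \<in> CM" "\<rho> p \<noteq> (0::real)"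
    "\<And>x v. \<rho> x \<noteq> 0 \<Longrightarrow> v \<in> TM x \<Longrightarrow> \<exists>a. v = (\<lambda>f. \<Sum>i<n. a i * e i x f)"
proof -
  obtain U \<phi> where U: "(U, \<phi>) \<in> atlas M" "p \<in> U" by (rule chart_cover)
  define c where "c = \<phi> p"
  obtain d where d: "d > 0" and B: "near n c d \<subseteq> \<phi> ` U"
    using eopen_near_subset[OF chart(2)[OF U(1)]] U(2) unfolding c_def by blast
  define E where "E = extend0 U \<phi> (near n c d)"
  note E = smooth_fun_cutoff[OF U(1) B d, folded E_def]
  have Ep: "E F p = F c" for F
    unfolding E_def c_def by (rule extend0_at[OF U d])
  define P where "P f i = partial i (\<lambda>y. f (inv_into U \<phi> y))" for f i
  have sm: "smooth_on n (near n c d) (\<lambda>y. f (inv_into U \<phi> y))" if "f \<in> CM" for f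
    by (rule smooth_on_subset[OF smooth_fun_chart[OF that U(1)] B])
  define X where "X = E (\<lambda>y. bump n c (d / 2) y * 1)"
  \<comment> \<open>The value 0 off the smooth functions is part of the definition of a tangent
    vector here.\<close>
  define e where "e i x f = (if f \<in> CM then E (\<lambda>y. bump n c (d / 2) y * P f i y) x else 0)" for i x f
  have X: "X \<in> CM" unfolding X_def by (rule E[OF smooth_on_const])
  have Xp: "X p > 0" unfolding X_def Ep using bump_center d by simp
  have e: "e i \<in> XM" if i: "i < n" for i
  proof (rule vector_fieldI)
    fix x
    show "e i x \<in> TM x"
    proof (cases "x \<in> U \<and> \<phi> x \<in> near n c d")
      case True
      then have x: "\<phi> x \<in> near n c d" "inv_into U \<phi> (\<phi> x) = x" using chart_inv[OF U(1)] by auto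
      show ?thesis
        using True x(2) i smooth_fun_add smooth_fun_mult smooth_fun_cmult
          partial_add[OF sm sm i x(1)] partial_mult[OF sm sm i x(1)] partial_mult[OF smooth_on_const sm i x(1)]
        unfolding tangent_space_def by (auto simp: e_def E_def extend0_def P_def algebra_simps)
    next
      case False
      then have "e i x = (\<lambda>f. 0)" by (auto simp: e_def E_def extend0_def fun_eq_iff)
      then show ?thesis using tangent_zero by simp
    qed
    show "(\<lambda>x. e i x f) \<in> CM" if "f \<in> CM" for f
      using E[OF smooth_on_partial[OF sm[OF that] i]] that by (simp add: e_def P_def)
  qed
  have span: "\<exists>a. v = (\<lambda>f. \<Sum>i<n. a i * e i x f)" if "X x \<noteq> 0" and v: "v \<in> TM x" for x v
  proof -
    have x: "x \<in> U" "\<phi> x \<in> near n c d" "bump n c (d / 2) (\<phi> x) = X x"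
      using that(1) by (auto simp: X_def E_def extend0_def split: if_splits)
    obtain a where a: "\<And>f. f \<in> CM \<Longrightarrow> v f = (\<Sum>i<n. a i * P f i (\<phi> x))"
      using tangent_coordinates[OF U(1) x(1) v] unfolding P_def by blast
    have "v = (\<lambda>f. \<Sum>i<n. a i / X x * e i x f)"
    proof
      fix f
      show "v f = (\<Sum>i<n. a i / X x * e i x f)"
        using a[of f] tangentD(4)[OF v, of f] x that(1)
        by (cases "f \<in> CM") (auto simp: e_def E_def extend0_def)
    qed
    then show ?thesis by (intro exI[of _ "\<lambda>i. a i / X x"])
  qed
  have indep: "\<forall>i<n. a i = 0" if "\<And>f. f \<in> CM \<Longrightarrow> (\<Sum>i<n. a i * e i p f) = 0" for a
  proof (intro allI impI)
    fix j assume j: "j < n"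
    \<comment> \<open>The j-th coordinate centred at c, cut off. It vanishes at c, so the derivative
      of the bump disappears there and \<open>e i p\<close> annihilates it unless
      \<open>i = j\<close>.\<close>
    define A where "A = E (\<lambda>y. bump n c (d / 2) y * (y j + (- c j)))"
    have smA: "smooth_on n (near n c d) (\<lambda>y. y j + (- c j))"
      by (intro smooth_on_add smooth_on_const smooth_on_coord eopen_near)
    have A: "A \<in> CM" unfolding A_def by (rule E[OF smA])
    have cc: "c \<in> near n c d" using near_center[OF chart(2)[OF U(1)]] U(2) d by (simp add: c_def)
    have "P A i c = X p * (if i = j then 1 else 0)" if i: "i < n" for i
    proof -
      have D: "((\<lambda>t. (c(i := t)) j + (- c j)) has_real_derivative (if i = j then 1 else 0)) (at (c i))"
        by (auto intro!: derivative_eq_intros)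
      have "partial i (\<lambda>y. bump n c (d / 2) y * (y j + (- c j))) c =
          partial i (bump n c (d / 2)) c * (c j + (- c j)) + bump n c (d / 2) c * partial i (\<lambda>y. y j + (- c j)) c"
        by (rule partial_mult[OF smooth_on_bump[OF eopen_near] smA i cc])
      also have "partial i (\<lambda>y. y j + (- c j)) c = (if i = j then 1 else 0)"
        by (rule partial_eqI[OF D])
      finally have "partial i (\<lambda>y. bump n c (d / 2) y * (y j + (- c j))) c = X p * (if i = j then 1 else 0)"
        by (simp add: X_def Ep)
      moreover have "((\<lambda>t. A (inv_into U \<phi> (c(i := t)))) has_real_derivative
          partial i (\<lambda>y. bump n c (d / 2) y * (y j + (- c j))) c) (at (c i))"
      proof (rule has_real_derivative_cong_eopen[OF eopen_near cc i _ smooth_on_deriv[OF _ i cc]])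
        show "bump n c (d / 2) y * (y j + (- c j)) = A (inv_into U \<phi> y)" if "y \<in> near n c d" for y
        proof -
          have "y \<in> \<phi> ` U" using that B by blast
          then show ?thesis using that by (simp add: A_def E_def extend0_def chart_inv[OF U(1)])
        qed
        show "smooth_on n (near n c d) (\<lambda>y. bump n c (d / 2) y * (y j + (- c j)))"
          by (intro smooth_on_mult smooth_on_bump eopen_near smA)
      qed
      ultimately show ?thesis
        unfolding P_def using partial_eqI[of "\<lambda>y. A (inv_into U \<phi> y)" c i] by simp
    qed
    then have "e i p A = (if i = j then X p * X p else 0)" if "i < n" for i
      using A that by (simp add: e_def Ep) (simp add: X_def Ep)
    then have "(\<Sum>i<n. a i * e i p A) = (\<Sum>i<n. if i = j then a i * (X p * X p) else 0)"
      by (intro sum.cong) auto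
    also have "\<dots> = a j * (X p * X p)" using j by simp
    finally show "a j = 0" using that[OF A] Xp by simp
  qed
  show thesis by (rule that[of e X, OF e indep X _ span]) (use Xp in auto)
qed

text \<open>Gaussian elimination over the ring of smooth functions, with the denominators collected in a
  single function \<open>P\<close>.\<close>

lemma gram_solve:
  fixes N m :: nat and G :: "nat \<Rightarrow> nat \<Rightarrow> 'm \<Rightarrow> real"
  assumes G: "\<And>i j. i < N \<Longrightarrow> j < N \<Longrightarrow> G i j \<in> CM"
    and pd: "\<And>m c. m \<le> N \<Longrightarrow> \<exists>i<m. c i \<noteq> 0 \<Longrightarrow> (\<Sum>j<m. c j * (\<Sum>i<m. c i * G i j p)) \<noteq> 0"
    and "m \<le> N"
  shows "\<exists>P\<in>CM. P p \<noteq> 0 \<and> (\<forall>k. (\<forall>j<m. k j \<in> CM) \<longrightarrow>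
    (\<exists>h. (\<forall>i<m. h i \<in> CM) \<and> (\<forall>j<m. \<forall>x. (\<Sum>i<m. h i x * G i j x) = P x * k j x)))"
  using assms(3)
proof (induction m)
  case 0
  show ?case by (rule bexI[of _ "\<lambda>_. 1"]) (auto intro: smooth_fun_const)
next
  case (Suc m)
  then obtain P where P: "P \<in> CM" "P p \<noteq> 0" and sol: "\<And>k. (\<forall>j<m. k j \<in> CM) \<Longrightarrow>
    (\<exists>h. (\<forall>i<m. h i \<in> CM) \<and> (\<forall>j<m. \<forall>x. (\<Sum>i<m. h i x * G i j x) = P x * k j x))" by auto
  have m: "m < N" using Suc.prems by simp
  have "\<forall>j<m. G m j \<in> CM" using G m by simp
  from sol[OF this] obtain z where z: "\<And>i. i < m \<Longrightarrow> z i \<in> CM"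
    "\<And>j x. j < m \<Longrightarrow> (\<Sum>i<m. z i x * G i j x) = P x * G m j x" by blast
  \<comment> \<open>P times the pivot of the next elimination step: wherever P is nonzero,
    \<open>D x / P x\<close> is the Schur complement of the leading block.\<close>
  define D where "D x = P x * G m m x - (\<Sum>i<m. z i x * G i m x)" for x
  have D: "D \<in> CM" unfolding D_def
    by (intro smooth_fun_diff smooth_fun_mult smooth_fun_sum P G m z) (use m in auto)
  have "P p * D p \<noteq> 0"
  proof -
    \<comment> \<open>By the choice of z this combination of rows is 0 in the columns before m and
      \<open>D p\<close> in column m, so the form in \<open>pd\<close> evaluates to
      \<open>P p * D p\<close>.\<close>
    define c where "c i = (if i < m then - z i p else P p)" for i
    have "(\<Sum>j<Suc m. c j * (\<Sum>i<Suc m. c i * G i j p)) \<noteq> 0"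
      by (rule pd[OF Suc.prems]) (use P(2) in \<open>auto simp: c_def intro!: exI[of _ m]\<close>)
    moreover have "(\<Sum>i<Suc m. c i * G i j p) = (if j = m then D p else 0)" if "j < Suc m" for j
      using z(2)[of j p] that by (auto simp: c_def D_def sum_negf)
    ultimately show ?thesis by (simp add: c_def)
  qed
  moreover have "\<exists>h. (\<forall>i<Suc m. h i \<in> CM) \<and> (\<forall>j<Suc m. \<forall>x. (\<Sum>i<Suc m. h i x * G i j x) = (P x * D x) * k j x)"
    if k: "\<forall>j<Suc m. k j \<in> CM" for k
  proof -
    have "\<forall>j<m. k j \<in> CM" using k by simp
    from sol[OF this] obtain h' where h': "\<And>i. i < m \<Longrightarrow> h' i \<in> CM"
      "\<And>j x. j < m \<Longrightarrow> (\<Sum>i<m. h' i x * G i j x) = P x * k j x" by blast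
    define r where "r x = P x * k m x - (\<Sum>i<m. h' i x * G i m x)" for x
    have r: "r \<in> CM" unfolding r_def
      by (intro smooth_fun_diff smooth_fun_mult smooth_fun_sum P G m h') (use m k in auto)
    \<comment> \<open>The vector with entries \<open>- z i\<close> and last entry P solves the first
      m equations with right-hand side 0, so r times it repairs the defect r of the old solution in
      equation m.\<close>
    define h where "h i = (if i < m then (\<lambda>x. D x * h' i x - r x * z i x) else (\<lambda>x. r x * P x))" for i
    have "\<forall>i<Suc m. h i \<in> CM"
      by (auto simp: h_def intro!: smooth_fun_diff smooth_fun_mult D r h' z P)
    moreover have "(\<Sum>i<Suc m. h i x * G i j x) = (P x * D x) * k j x" if j: "j < Suc m" for j x
    proof -
      have e: "(\<Sum>i<Suc m. h i x * G i j x) =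
          D x * (\<Sum>i<m. h' i x * G i j x) - r x * (\<Sum>i<m. z i x * G i j x) + r x * P x * G m j x"
        by (simp add: h_def sum_distrib_left sum_subtractf[symmetric] algebra_simps)
      show ?thesis
      proof (cases "j = m")
        case True
        have 1: "(\<Sum>i<m. h' i x * G i m x) = P x * k m x - r x" by (simp add: r_def)
        have 2: "(\<Sum>i<m. z i x * G i m x) = P x * G m m x - D x" by (simp add: D_def)
        show ?thesis using e unfolding True 1 2 by (simp add: algebra_simps)
      next
        case False
        then have "j < m" using j by simp
        then show ?thesis using e z(2)[of j x] h'(2)[of j x] by (simp add: algebra_simps)
      qed
    qed
    ultimately show ?thesis by blast
  qed
  ultimately show ?case using smooth_fun_mult[OF P(1) D]
    by (intro bexI[of _ "\<lambda>x. P x * D x"]) auto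
qed

end

section \<open>The Levi-Civita connection\<close>

locale closed_mfd = smooth_mfd M for M :: "'m::{t2_space,second_countable_topology} manifold" +
  assumes compact_M: "compact (UNIV :: 'm set)"

locale riem_mfd = closed_mfd M for M :: "'m::{t2_space,second_countable_topology} manifold" +
  fixes g :: "'m metric"
  assumes riem: "riemannian_metric M g"
begin

lemma g_left:
  assumes "v \<in> TM x" "v' \<in> TM x" "z \<in> TM x"
  shows "g x (\<lambda>f. v f + v' f) z = g x v z + g x v' z" "g x (\<lambda>f. c * v f) z = c * g x v z"
  using riem assms unfolding riemannian_metric_def by blast+

lemma g_sym: "v \<in> TM x \<Longrightarrow> z \<in> TM x \<Longrightarrow> g x v z = g x z v"
  using riem unfolding riemannian_metric_def by blast

lemma g_pos: "v \<in> TM x \<Longrightarrow> v \<noteq> (\<lambda>f. 0) \<Longrightarrow> g x v v > 0"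
  using riem unfolding riemannian_metric_def by blast

lemma g_smooth: "w \<in> XM \<Longrightarrow> z \<in> XM \<Longrightarrow> (\<lambda>x. g x (w x) (z x)) \<in> CM"
  using riem unfolding riemannian_metric_def by blast

lemma g_right:
  assumes "v \<in> TM x" "v' \<in> TM x" "z \<in> TM x"
  shows "g x z (\<lambda>f. v f + v' f) = g x z v + g x z v'" "g x z (\<lambda>f. c * v f) = c * g x z v"
  using g_left[OF assms] g_sym assms tangent_add tangent_cmult by simp_all

lemma g_zero: "z \<in> TM x \<Longrightarrow> g x (\<lambda>f. 0) z = 0" "z \<in> TM x \<Longrightarrow> g x z (\<lambda>f. 0) = 0"
  using g_left(2)[of z x z z 0] g_right(2)[of z x z z 0] by simp_all

lemma g_nonneg: "v \<in> TM x \<Longrightarrow> g x v v \<ge> 0"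
  using g_pos[of v x] g_zero by (cases "v = (\<lambda>f. 0)") auto

lemma g_sum_left:
  assumes "\<And>i. i \<in> I \<Longrightarrow> v i \<in> TM x" "z \<in> TM x"
  shows "g x (\<lambda>f. \<Sum>i\<in>I. a i * v i f) z = (\<Sum>i\<in>I. a i * g x (v i) z)"
  using assms(1)
proof (induction I rule: infinite_finite_induct)
  case (insert i I)
  then have "(\<lambda>f. \<Sum>i\<in>I. a i * v i f) \<in> TM x" "(\<lambda>f. a i * v i f) \<in> TM x" "v i \<in> TM x"
    using tangent_lincomb[of I v x a] tangent_cmult by auto
  then show ?case using insert g_left[of "\<lambda>f. a i * v i f" x "\<lambda>f. \<Sum>i\<in>I. a i * v i f" z]
     g_left(2)[of "v i" x "v i" z "a i"] assms(2) by simp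
qed (use g_zero assms(2) in auto)

lemma g_sum_right:
  assumes "\<And>i. i \<in> I \<Longrightarrow> v i \<in> TM x" "z \<in> TM x"
  shows "g x z (\<lambda>f. \<Sum>i\<in>I. a i * v i f) = (\<Sum>i\<in>I. a i * g x z (v i))"
  using g_sum_left[OF assms, where a = a] g_sym[OF assms(2)] assms tangent_lincomb[of I v x a] by simp

section \<open>Representation of tensorial functionals by vector fields\<close>

definition tensorial :: "('m vfield \<Rightarrow> 'm \<Rightarrow> real) \<Rightarrow> bool" where
  "tensorial K \<longleftrightarrow> (\<forall>v\<in>XM. K v \<in> CM) \<and>
    (\<forall>v\<in>XM. \<forall>w\<in>XM. \<forall>x. K (vadd v w) x = K v x + K w x) \<and>
    (\<forall>h\<in>CM. \<forall>v\<in>XM. \<forall>x. K (vscale h v) x = h x * K v x)"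

lemma tensorialD:
  assumes "tensorial K"
  shows "v \<in> XM \<Longrightarrow> K v \<in> CM" "v \<in> XM \<Longrightarrow> w \<in> XM \<Longrightarrow> K (vadd v w) x = K v x + K w x"
    "h \<in> CM \<Longrightarrow> v \<in> XM \<Longrightarrow> K (vscale h v) x = h x * K v x"
  using assms unfolding tensorial_def by blast+

lemma tensorial_sum:
  fixes m :: nat
  assumes K: "tensorial K" and "\<And>i. i < m \<Longrightarrow> h i \<in> CM" "\<And>i. i < m \<Longrightarrow> w i \<in> XM"
  shows "K (\<lambda>x f. \<Sum>i<m. h i x * w i x f) x = (\<Sum>i<m. h i x * K (w i) x)"
  using assms(2,3)
proof (induction m)
  case 0
  have "(\<lambda>x f. \<Sum>i<(0::nat). h i x * w i x f) = vscale (\<lambda>_. 0) vzero" by (simp add: vscale_def)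
  then show ?case using tensorialD(3)[OF K smooth_fun_const vzero_in, of 0] by simp
next
  case (Suc m)
  have e: "(\<lambda>x f. \<Sum>i<Suc m. h i x * w i x f) = vadd (\<lambda>x f. \<Sum>i<m. h i x * w i x f) (vscale (h m) (w m))"
    by (simp add: vadd_def vscale_def)
  have "K (\<lambda>x f. \<Sum>i<Suc m. h i x * w i x f) x = K (\<lambda>x f. \<Sum>i<m. h i x * w i x f) x + K (vscale (h m) (w m)) x"
    unfolding e by (rule tensorialD(2)[OF K vsum_in vscale_in]) (use Suc.prems in auto)
  then show ?case using Suc tensorialD(3)[OF K, of "h m" "w m" x] by simp
qed

text \<open>The weight Q is chosen before K. The Gram system yields a field that represents K on the
  frame; where \<rho> is nonzero the frame spans, and elsewhere the factor \<rho> makes both sides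
  0.\<close>

lemma local_riesz:
  "\<exists>Q\<in>CM. (\<forall>x. Q x \<ge> 0) \<and> Q p > 0 \<and> (\<forall>K. tensorial K \<longrightarrow>
    (\<exists>Y\<in>XM. \<forall>v\<in>XM. \<forall>x. g x (Y x) (v x) = Q x * K v x))"
proof -
  obtain e \<rho> where e: "\<And>i. i < n \<Longrightarrow> e i \<in> XM"
    and indep: "\<And>a. (\<And>f. f \<in> CM \<Longrightarrow> (\<Sum>i<n. a i * e i p f) = 0) \<Longrightarrow> (\<forall>i<n. a i = 0)"
    and \<rho>: "\<rho> \<in> CM" "\<rho> p \<noteq> (0::real)"
    and span: "\<And>x v. \<rho> x \<noteq> 0 \<Longrightarrow> v \<in> TM x \<Longrightarrow> \<exists>a. v = (\<lambda>f. \<Sum>i<n. a i * e i x f)"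
    by (rule local_frame[of p]) blast+
  have eT: "e i x \<in> TM x" if "i < n" for i x using vector_fieldD(1)[OF e[OF that]] .
  define G where "G i j x = g x (e i x) (e j x)" for i j x
  have G: "G i j \<in> CM" if "i < n" "j < n" for i j
    unfolding G_def by (rule g_smooth) (use that e in auto)
  have pd: "(\<Sum>j<m. c j * (\<Sum>i<m. c i * G i j p)) \<noteq> 0" if m: "m \<le> n" "\<exists>i<m. c i \<noteq> 0"
    for m and c :: "nat \<Rightarrow> real"
  proof -
    define u where "u = (\<lambda>f. \<Sum>i<m. c i * e i p f)"
    have u: "u \<in> TM p" unfolding u_def by (rule tangent_lincomb) (use eT m in auto)
    have "u \<noteq> (\<lambda>f. 0)"
    proof
      assume u0: "u = (\<lambda>f. 0)"
      have "\<forall>i<n. (if i < m then c i else 0) = 0"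
      proof (rule indep)
        fix f
        have "(\<Sum>i<n. (if i < m then c i else 0) * e i p f) = (\<Sum>i<m. c i * e i p f)"
          using m(1) by (intro sum.mono_neutral_cong_right) auto
        then show "(\<Sum>i<n. (if i < m then c i else 0) * e i p f) = 0"
          using fun_cong[OF u0, of f] by (simp add: u_def)
      qed
      then show False using m by (metis less_le_trans)
    qed
    then have "g p u u > 0" using g_pos[OF u] by blast
    moreover have "g p (e j p) u = (\<Sum>i<m. c i * G i j p)" if "j < m" for j
      unfolding u_def G_def
        using g_sum_right[of "{..<m}" "\<lambda>i. e i p" p "e j p" c] eT m that g_sym by auto
    then have "g p u u = (\<Sum>j<m. c j * (\<Sum>i<m. c i * G i j p))"
      using g_sum_left[of "{..<m}" "\<lambda>i. e i p" p u c] eT m u by (auto simp: u_def)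
    ultimately show ?thesis by simp
  qed
  obtain P where P: "P \<in> CM" "P p \<noteq> 0" and sol: "\<And>k. (\<forall>j<n. k j \<in> CM) \<Longrightarrow>
    (\<exists>h. (\<forall>i<n. h i \<in> CM) \<and> (\<forall>j<n. \<forall>x. (\<Sum>i<n. h i x * G i j x) = P x * k j x))"
    using gram_solve[of n G p n, OF G pd order_refl] by auto
  have solve: "\<exists>h. (\<forall>i<n. h i \<in> CM) \<and> (\<forall>j<n. \<forall>x. g x (\<lambda>f. \<Sum>i<n. h i x * e i x f) (e j x) = P x * k j x)"
    if k: "\<forall>j<n. k j \<in> CM" for k
  proof -
    obtain h where h: "\<forall>i<n. h i \<in> CM" "\<forall>j<n. \<forall>x. (\<Sum>i<n. h i x * G i j x) = P x * k j x"
      using sol[OF k] by blast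
    have "g x (\<lambda>f. \<Sum>i<n. h i x * e i x f) (e j x) = P x * k j x" if "j < n" for j x
      using g_sum_left[of "{..<n}" "\<lambda>i. e i x" x "e j x" "\<lambda>i. h i x"] eT h(2) that by (simp add: G_def)
    then show ?thesis using h(1) by blast
  qed
  show ?thesis
  \<comment> \<open>A square, so that weights belonging to different points cannot cancel when they
    are added.\<close>
  proof (rule bexI[of _ "\<lambda>x. (\<rho> x * P x) * (\<rho> x * P x)"], intro conjI allI impI)
    show "(\<lambda>x. (\<rho> x * P x) * (\<rho> x * P x)) \<in> CM" by (intro smooth_fun_mult \<rho> P)
    have "\<rho> p * P p \<noteq> 0" using \<rho>(2) P(2) by simp
    then show "(\<rho> p * P p) * (\<rho> p * P p) > 0" by (metis not_real_square_gt_zero)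
    fix K assume K: "tensorial K"
    have "\<forall>j<n. K (e j) \<in> CM" using tensorialD(1)[OF K] e by blast
    from solve[OF this] obtain h where h: "\<And>i. i < n \<Longrightarrow> h i \<in> CM"
      "\<And>j x. j < n \<Longrightarrow> g x (\<lambda>f. \<Sum>i<n. h i x * e i x f) (e j x) = P x * K (e j) x" by blast
    define Y where "Y = (\<lambda>x f. \<Sum>i<n. h i x * e i x f)"
    have Y: "Y \<in> XM" unfolding Y_def by (rule vsum_in) (use h(1) e in auto)
    \<comment> \<open>The second factor P of the weight is already supplied by the Gram system for
      Y.\<close>
    define Y' where "Y' = vscale (\<lambda>x. \<rho> x * \<rho> x * P x) Y"
    have Y': "Y' \<in> XM" unfolding Y'_def by (intro vscale_in smooth_fun_mult \<rho> P Y)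
    have "g x (Y' x) (v x) = (\<rho> x * P x) * (\<rho> x * P x) * K v x" if v: "v \<in> XM" for v x
    proof -
      have "\<forall>j<n. (\<lambda>x. g x (v x) (e j x)) \<in> CM" using g_smooth v e by blast
      from solve[OF this] obtain l where l: "\<And>i. i < n \<Longrightarrow> l i \<in> CM"
        "\<And>j x. j < n \<Longrightarrow> g x (\<lambda>f. \<Sum>i<n. l i x * e i x f) (e j x) = P x * g x (v x) (e j x)" by blast
      define W where "W = (\<lambda>x f. \<Sum>i<n. l i x * e i x f)"
      have W: "W \<in> XM" unfolding W_def by (rule vsum_in) (use l(1) e in auto)
      \<comment> \<open>The difference of W and \<open>P v\<close> is orthogonal to the frame and
        lies in its span, so it is orthogonal to itself.\<close>
      have Wv: "W x = (\<lambda>f. P x * v x f)" if rx: "\<rho> x \<noteq> 0" for x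
      proof -
        define u where "u = (\<lambda>f. W x f + - P x * v x f)"
        have T: "W x \<in> TM x" "v x \<in> TM x" "(\<lambda>f. - P x * v x f) \<in> TM x"
          using vector_fieldD(1) W v tangent_cmult by blast+
        have u: "u \<in> TM x" unfolding u_def by (rule tangent_add[OF T(1,3)])
        have orth: "g x u (e j x) = 0" if "j < n" for j
          unfolding u_def using g_left(1)[OF T(1,3) eT[OF that]] g_left(2)[OF T(2,2) eT[OF that], of "- P x"] l(2)[OF that]
          by (simp add: W_def)
        from span[OF rx u] obtain a where a: "u = (\<lambda>f. \<Sum>i<n. a i * e i x f)" ..
        have "g x u (\<lambda>f. \<Sum>i<n. a i * e i x f) = (\<Sum>i<n. a i * g x u (e i x))"
          by (rule g_sum_right[OF _ u]) (use eT in auto)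
        then have "g x u u = 0"
          unfolding a[symmetric] using orth by simp
        then have "u = (\<lambda>f. 0)" using g_pos[OF u] by force
        then have "u f = 0" for f by simp
        then show ?thesis unfolding u_def by (auto simp: fun_eq_iff)
      qed
      \<comment> \<open>K accepts only global fields, so the equality on the set where \<rho> is
        nonzero is made global by multiplying with \<rho>.\<close>
      have "vscale \<rho> W = vscale (\<lambda>x. \<rho> x * P x) v"
        using Wv by (auto simp: vscale_def fun_eq_iff)
      then have "K (vscale \<rho> W) x = K (vscale (\<lambda>x. \<rho> x * P x) v) x" by simp
      then have KW: "\<rho> x * K W x = \<rho> x * P x * K v x"
        using tensorialD(3)[OF K \<rho>(1) W] tensorialD(3)[OF K smooth_fun_mult[OF \<rho>(1) P(1)] v] by simp
      have T: "Y x \<in> TM x" "v x \<in> TM x" using vector_fieldD(1) Y v by blast+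
      have "g x (Y x) (W x) = (\<Sum>i<n. l i x * g x (Y x) (e i x))"
        unfolding W_def by (rule g_sum_right) (use eT T in auto)
      also have "\<dots> = P x * (\<Sum>i<n. l i x * K (e i) x)"
        using h(2) by (simp add: Y_def sum_distrib_left algebra_simps)
      also have "(\<Sum>i<n. l i x * K (e i) x) = K W x"
        unfolding W_def by (rule tensorial_sum[OF K, symmetric]) (use l e in auto)
      finally have gYW: "g x (Y x) (W x) = P x * K W x" .
      have "\<rho> x * g x (Y x) (W x) = \<rho> x * (P x * g x (Y x) (v x))"
        using Wv[of x] g_right(2)[OF T(2,2,1)] by (cases "\<rho> x = 0") auto
      then have eq: "\<rho> x * (P x * g x (Y x) (v x)) = P x * (\<rho> x * P x * K v x)"
        unfolding KW[symmetric] gYW by (metis mult.left_commute)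
      have "g x (Y' x) (v x) = \<rho> x * \<rho> x * P x * g x (Y x) (v x)"
        unfolding Y'_def vscale_def by (rule g_left(2)[OF T(1,1,2)])
      also have "\<dots> = \<rho> x * (P x * (\<rho> x * P x * K v x))"
        unfolding eq[symmetric] by (simp add: algebra_simps)
      finally show ?thesis by (simp add: algebra_simps)
    qed
    then show "\<exists>Y\<in>XM. \<forall>v\<in>XM. \<forall>x. g x (Y x) (v x) = \<rho> x * P x * (\<rho> x * P x) * K v x"
      using Y' by blast
  qed auto
qed

text \<open>By compactness finitely many of the nonnegative weights have a positive sum. As g is
  linear, the corresponding local solutions add up to a solution for the summed weight, by which one
  may divide.\<close>

lemma riesz:
  assumes K: "tensorial K"
  obtains Y where "Y \<in> XM" "\<And>v x. v \<in> XM \<Longrightarrow> g x (Y x) (v x) = K v x"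
proof -
  have "\<forall>p. \<exists>Q\<in>CM. (\<forall>x. Q x \<ge> 0) \<and> Q p > 0 \<and>
    (\<exists>Y\<in>XM. \<forall>v\<in>XM. \<forall>x. g x (Y x) (v x) = Q x * K v x)"
    using local_riesz K by meson
  then obtain Q Z where Q: "\<And>p. Q p \<in> CM" "\<And>p x. Q p x \<ge> 0" "\<And>p. Q p p > 0"
      and Z: "\<And>p. Z p \<in> XM" "\<And>p v x. v \<in> XM \<Longrightarrow> g x (Z p x) (v x) = Q p x * K v x" by metis
  have "open {x. Q p x > 0}" for p
    using open_Collect_less[OF continuous_on_const smooth_fun_continuous[OF Q(1)]] .
  then have "\<exists>F. finite F \<and> UNIV \<subseteq> (\<Union>p\<in>F. {x. Q p x > 0})"
    using compactE_image[OF compact_M, of UNIV "\<lambda>p. {x. Q p x > 0}"] Q(3)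
      by (metis (no_types, lifting) UNIV_I UN_iff mem_Collect_eq subsetI)
  then obtain F where F: "finite F" "\<And>x. \<exists>p\<in>F. Q p x > 0" by blast
  define q where "q x = (\<Sum>p\<in>F. Q p x)" for x
  have qpos: "q x > 0" for x
  proof -
    obtain p where "p \<in> F" "Q p x > 0" using F(2) by blast
    then show ?thesis unfolding q_def using F(1) Q(2) by (intro sum_pos2[of F p]) auto
  qed
  have q: "q \<in> CM" unfolding q_def by (rule smooth_fun_sum) (rule Q)
  have qi: "(\<lambda>x. inverse (q x)) \<in> CM"
    by (rule smooth_fun_inverse[OF q]) (use qpos in \<open>metis less_irrefl\<close>)
  define Y where "Y = (\<lambda>x f. \<Sum>p\<in>F. inverse (q x) * Z p x f)"
  show thesis
  proof (rule that[of Y])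
    show "Y \<in> XM" unfolding Y_def by (rule vsum_in) (use qi Z in auto)
    fix v x assume v: "v \<in> XM"
    have "g x (Y x) (v x) = (\<Sum>p\<in>F. inverse (q x) * g x (Z p x) (v x))"
      unfolding Y_def by (rule g_sum_left) (use vector_fieldD(1) Z v in auto)
    also have "\<dots> = inverse (q x) * (q x * K v x)"
      using Z(2)[OF v] by (simp add: q_def sum_distrib_left sum_distrib_right)
    finally show "g x (Y x) (v x) = K v x" using qpos[of x] by simp
  qed
qed

end

context smooth_mfd
begin

section \<open>Rules for connections and Lie brackets\<close>

lemma affineD:
  assumes "affine_connection M N"
  shows "w \<in> XM \<Longrightarrow> z \<in> XM \<Longrightarrow> N w z \<in> XM"
    "w \<in> XM \<Longrightarrow> w' \<in> XM \<Longrightarrow> z \<in> XM \<Longrightarrow>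
      N (vadd w w') z = vadd (N w z) (N w' z)"
    "w \<in> XM \<Longrightarrow> w' \<in> XM \<Longrightarrow> z \<in> XM \<Longrightarrow>
      N z (vadd w w') = vadd (N z w) (N z w')"
    "w \<in> XM \<Longrightarrow> z \<in> XM \<Longrightarrow> N (vscale (\<lambda>_. c) w) z = vscale (\<lambda>_. c) (N w z)"
    "w \<in> XM \<Longrightarrow> z \<in> XM \<Longrightarrow> N w (vscale (\<lambda>_. c) z) = vscale (\<lambda>_. c) (N w z)"
    "w \<notin> XM \<or> z \<notin> XM \<Longrightarrow> N w z = vzero"
  using assms unfolding affine_connection_def by (elim conjE; simp)+

lemma field_nonsmooth: "w \<in> XM \<Longrightarrow> f \<notin> CM \<Longrightarrow> w x f = 0"
  using tangentD(4) vector_fieldD(1) by blast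

lemma lie_add:
  assumes "w \<in> XM" "w' \<in> XM" "z \<in> XM"
  shows "lie_bracket (vadd w w') z = vadd (lie_bracket w z) (lie_bracket w' z)" (is ?A)
    "lie_bracket z (vadd w w') = vadd (lie_bracket z w) (lie_bracket z w')" (is ?B)
proof -
  have "z x (\<lambda>x. w x f + w' x f) = z x (\<lambda>x. w x f) + z x (\<lambda>x. w' x f)" for x f
  \<comment> \<open>Additivity of a tangent vector is available on smooth functions only; for other
    f all inner terms are 0 by convention.\<close>
  proof (cases "f \<in> CM")
    case True
    then show ?thesis using assms vector_fieldD by (intro tangentD(1)) auto
  next
    case False
    then show ?thesis using assms tangent_const[OF vector_fieldD(1)[OF assms(3)], of x 0]
      by (simp add: field_nonsmooth)
  qed
  then show ?A ?B
    by (simp_all add: lie_bracket_def vapply_def vadd_def fun_eq_iff)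
qed

lemma lie_scale:
  assumes "w \<in> XM" "z \<in> XM" "h \<in> CM"
  shows "lie_bracket w (vscale h z) = vadd (vscale h (lie_bracket w z)) (vscale (vapply w h) z)" (is ?A)
    "lie_bracket (vscale h z) w = vadd (vscale h (lie_bracket z w)) (vscale (\<lambda>x. - vapply w h x) z)" (is ?B)
proof -
  have "w x (\<lambda>x. h x * z x f) = w x h * z x f + h x * w x (\<lambda>x. z x f)" for x f
  proof (cases "f \<in> CM")
    case True
    then show ?thesis using assms vector_fieldD by (intro tangentD(3)) auto
  next
    case False
    then show ?thesis using assms tangent_const[OF vector_fieldD(1)[OF assms(1)], of x 0]
      by (simp add: field_nonsmooth)
  qed
  then show ?A ?B
    by (simp_all add: lie_bracket_def vapply_def vadd_def vscale_def fun_eq_iff algebra_simps)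
qed

lemma lie_swap: "lie_bracket z w = vscale (\<lambda>_. -1) (lie_bracket w z)"
  by (simp add: lie_bracket_def vscale_def fun_eq_iff)

lemma field_add:
  "w \<in> XM \<Longrightarrow> f \<in> CM \<Longrightarrow> h \<in> CM \<Longrightarrow> w x (\<lambda>y. f y + h y) = w x f + w x h"
  using tangentD(1) vector_fieldD(1) by blast

lemma field_mult:
  "w \<in> XM \<Longrightarrow> f \<in> CM \<Longrightarrow> h \<in> CM \<Longrightarrow> w x (\<lambda>y. f y * h y) = w x f * h x + f x * w x h"
  using tangentD(3) vector_fieldD(1) by blast

end

context riem_mfd
begin

section \<open>The Koszul formula and existence\<close>

definition gg :: "'m vfield \<Rightarrow> 'm vfield \<Rightarrow> 'm \<Rightarrow> real" where
  "gg w z = (\<lambda>x. g x (w x) (z x))"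

lemma gg_in: "w \<in> XM \<Longrightarrow> z \<in> XM \<Longrightarrow> gg w z \<in> CM"
  unfolding gg_def by (rule g_smooth)

lemma gg_sym: "w \<in> XM \<Longrightarrow> z \<in> XM \<Longrightarrow> gg w z = gg z w"
  unfolding gg_def by (intro ext g_sym vector_fieldD(1))

lemma gg_add:
  assumes "w \<in> XM" "w' \<in> XM" "z \<in> XM"
  shows "gg (vadd w w') z = (\<lambda>x. gg w z x + gg w' z x)" "gg z (vadd w w') = (\<lambda>x. gg z w x + gg z w' x)"
  unfolding gg_def vadd_def by (intro ext g_left(1) g_right(1) vector_fieldD(1) assms)+

lemma gg_scale:
  assumes "w \<in> XM" "z \<in> XM"
  shows "gg (vscale h w) z = (\<lambda>x. h x * gg w z x)" "gg z (vscale h w) = (\<lambda>x. h x * gg z w x)"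
proof -
  note T = vector_fieldD(1)[OF assms(1)] vector_fieldD(1)[OF assms(2)]
  show "gg (vscale h w) z = (\<lambda>x. h x * gg w z x)" "gg z (vscale h w) = (\<lambda>x. h x * gg z w x)"
    unfolding gg_def vscale_def by (intro ext g_left(2)[OF T(1,1,2)] g_right(2)[OF T(1,1,2)])+
qed

lemma gg_nondegenerate:
  assumes "Y \<in> XM" "Y' \<in> XM" "\<And>v. v \<in> XM \<Longrightarrow> gg Y v = gg Y' v"
  shows "Y = Y'"
proof
  fix x
  define D where "D = vadd Y (vscale (\<lambda>_. -1) Y')"
  have s: "vscale (\<lambda>_. -1) Y' \<in> XM" by (rule vscale_in[OF smooth_fun_const assms(2)])
  have D: "D \<in> XM" unfolding D_def by (rule vadd_in[OF assms(1) s])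
  have "gg D D = (\<lambda>x. gg Y D x + -1 * gg Y' D x)"
    unfolding D_def gg_add(1)[OF assms(1) s D[unfolded D_def]] gg_scale(1)[OF assms(2) D[unfolded D_def]] ..
  then have "gg D D x = 0" using assms(3)[OF D] by simp
  then have "D x = (\<lambda>f. 0)"
    using g_pos[OF vector_fieldD(1)[OF D], of x] by (force simp: gg_def)
  then show "Y x = Y' x" by (auto simp: D_def vadd_def vscale_def fun_eq_iff)
qed

text \<open>The Koszul formula: the value that g(\<nabla>_w z, v) must take for a metric
  torsion-free connection \<nabla>.\<close>

definition koszul :: "'m vfield \<Rightarrow> 'm vfield \<Rightarrow> 'm vfield \<Rightarrow> 'm \<Rightarrow> real" where
  "koszul w z v x = (1 / 2) * (w x (gg z v) + z x (gg w v) - v x (gg w z)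
     + gg (lie_bracket w z) v x - gg (lie_bracket w v) z x - gg (lie_bracket z v) w x)"

lemma koszul_in:
  assumes "w \<in> XM" "z \<in> XM" "v \<in> XM"
  shows "koszul w z v \<in> CM"
proof -
  have "(\<lambda>x. a x (gg b c)) \<in> CM" "gg (lie_bracket a b) c \<in> CM" if "a \<in> XM" "b \<in> XM" "c \<in> XM" for a b c
    using that vector_fieldD(2)[OF that(1) gg_in[OF that(2,3)]] gg_in lie_bracket_in by auto
  note this[OF assms(1,2,3)] this[OF assms(2,1,3)] this[OF assms(3,1,2)] this[OF assms(1,3,2)] this[OF assms(2,3,1)]
  then show ?thesis
    unfolding koszul_def[abs_def] by (intro smooth_fun_cmult smooth_fun_add smooth_fun_diff)
qed

lemma koszul_add:
  assumes "w \<in> XM" "z \<in> XM" "v \<in> XM" "u \<in> XM"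
  shows "koszul w z (vadd v u) x = koszul w z v x + koszul w z u x"
    "koszul (vadd v u) w z x = koszul v w z x + koszul u w z x"
    "koszul w (vadd v u) z x = koszul w v z x + koszul w u z x"
  using assms
  by (simp_all add: koszul_def gg_add lie_add lie_bracket_in field_add gg_in)
    (simp_all add: vadd_def field_simps)

text \<open>In the slots w and v the derivatives of h from the metric terms cancel against those
  from the brackets. In the slot z two equal terms survive; with the factor 1/2 they give the
  Leibniz term of a connection.\<close>

lemma koszul_scale:
  assumes "w \<in> XM" "z \<in> XM" "v \<in> XM" "h \<in> CM"
  shows "koszul w z (vscale h v) x = h x * koszul w z v x"
    "koszul (vscale h w) z v x = h x * koszul w z v x"
    "koszul w (vscale h z) v x = h x * koszul w z v x + w x h * gg z v x"
proof -
  have *: "vapply w h \<in> CM" "(\<lambda>x. - vapply w h x) \<in> CM" if "w \<in> XM" for w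
    using that assms(4) vector_fieldD(2) smooth_fun_minus unfolding vapply_def by auto
  note S = lie_scale[OF _ _ assms(4)] gg_add gg_scale lie_bracket_in vscale_in assms(4) * field_mult gg_in
  show "koszul w z (vscale h v) x = h x * koszul w z v x"
    "koszul (vscale h w) z v x = h x * koszul w z v x"
    "koszul w (vscale h z) v x = h x * koszul w z v x + w x h * gg z v x"
    using assms gg_sym[of z v] gg_sym[of w v] gg_sym[of w z]
    by (simp_all add: koszul_def S) (simp_all add: vscale_def vapply_def field_simps)
qed

text \<open>Torsion-freeness and metric compatibility of the represented connection, in terms of the
  functional.\<close>

lemma koszul_swap:
  assumes "w \<in> XM" "z \<in> XM" "v \<in> XM"
  shows "koszul w z v x - koszul z w v x = gg (lie_bracket w z) v x"
    "koszul w z v x + koszul w v z x = w x (gg z v)"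
  using assms gg_sym[of z v] gg_sym[of w v] gg_sym[of w z] lie_swap[of z w] lie_swap[of v z]
    lie_bracket_in gg_scale(1) smooth_fun_const
  by (simp_all add: koszul_def field_simps)

lemma koszul_tensorial: "w \<in> XM \<Longrightarrow> z \<in> XM \<Longrightarrow> tensorial (koszul w z)"
  unfolding tensorial_def by (simp add: koszul_in koszul_add koszul_scale)

definition nablaLC :: "'m connection" where
  "nablaLC w z = (if w \<in> XM \<and> z \<in> XM then (SOME Y. Y \<in> XM \<and> (\<forall>v\<in>XM. gg Y v = koszul w z v)) else vzero)"

lemma nablaLC:
  assumes "w \<in> XM" "z \<in> XM"
  shows "nablaLC w z \<in> XM" "v \<in> XM \<Longrightarrow> gg (nablaLC w z) v = koszul w z v"
proof -
  obtain Y where "Y \<in> XM" "\<And>v x. v \<in> XM \<Longrightarrow> g x (Y x) (v x) = koszul w z v x"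
    using riesz[OF koszul_tensorial[OF assms]] by blast
  then have "\<exists>Y. Y \<in> XM \<and> (\<forall>v\<in>XM. gg Y v = koszul w z v)"
    by (auto simp: gg_def fun_eq_iff)
  from someI_ex[OF this] show "nablaLC w z \<in> XM" "v \<in> XM \<Longrightarrow> gg (nablaLC w z) v = koszul w z v"
    using assms by (simp_all add: nablaLC_def)
qed

lemma nablaLC_eqI:
  assumes "w \<in> XM" "z \<in> XM" "Y \<in> XM" "\<And>v x. v \<in> XM \<Longrightarrow> gg Y v x = koszul w z v x"
  shows "nablaLC w z = Y"
  by (rule gg_nondegenerate[OF nablaLC(1) assms(3)]) (use assms nablaLC(2) in auto)

lemma nablaLC_affine: "affine_connection M nablaLC"
  unfolding affine_connection_def
proof (intro conjI ballI allI impI)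
  fix w w' z assume w: "w \<in> XM" "w' \<in> XM" "z \<in> XM"
  show "nablaLC (vadd w w') z = vadd (nablaLC w z) (nablaLC w' z)"
    by (rule nablaLC_eqI) (use w nablaLC in \<open>simp_all add: vadd_in gg_add koszul_add\<close>)
  show "nablaLC z (vadd w w') = vadd (nablaLC z w) (nablaLC z w')"
    by (rule nablaLC_eqI) (use w nablaLC in \<open>simp_all add: vadd_in gg_add koszul_add\<close>)
next
  fix w z c assume w: "w \<in> XM" "z \<in> XM"
  have 0: "w x (\<lambda>_. c) = 0" for x using tangent_const[OF vector_fieldD(1)[OF w(1)]] .
  show "nablaLC (vscale (\<lambda>_. c) w) z = vscale (\<lambda>_. c) (nablaLC w z)"
    by (rule nablaLC_eqI) (use w nablaLC in \<open>simp_all add: vscale_in smooth_fun_const gg_scale koszul_scale\<close>)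
  show "nablaLC w (vscale (\<lambda>_. c) z) = vscale (\<lambda>_. c) (nablaLC w z)"
    by (rule nablaLC_eqI) (use w nablaLC 0 in \<open>simp_all add: vscale_in smooth_fun_const gg_scale koszul_scale\<close>)
next
  fix w z h assume w: "w \<in> XM" "z \<in> XM" "h \<in> CM"
  have 0: "vapply w h \<in> CM" using vector_fieldD(2)[OF w(1,3)] by (simp add: vapply_def)
  show "nablaLC (vscale h w) z = vscale h (nablaLC w z)"
    by (rule nablaLC_eqI) (use w nablaLC in \<open>simp_all add: vscale_in gg_scale koszul_scale\<close>)
  show "nablaLC w (vscale h z) = vadd (vscale h (nablaLC w z)) (vscale (vapply w h) z)"
    by (rule nablaLC_eqI)
      (use w nablaLC 0 in \<open>simp_all add: vscale_in vadd_in gg_add gg_scale koszul_scale\<close>,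
       simp add: vapply_def)
qed (use nablaLC in \<open>auto simp: nablaLC_def\<close>)

lemma nablaLC_torsion_free: "torsion_free M nablaLC"
  unfolding torsion_free_def
proof (intro ballI gg_nondegenerate)
  fix w z v assume w: "w \<in> XM" "z \<in> XM" and v: "v \<in> XM"
  note N = nablaLC[OF w] nablaLC[OF w(2,1)]
  show "vdiff (nablaLC w z) (nablaLC z w) \<in> XM" "lie_bracket w z \<in> XM"
    using w N by (simp_all add: vdiff_in lie_bracket_in)
  have "vdiff (nablaLC w z) (nablaLC z w) = vadd (nablaLC w z) (vscale (\<lambda>_. -1) (nablaLC z w))"
    by (simp add: vdiff_def vadd_def vscale_def)
  then have "gg (vdiff (nablaLC w z) (nablaLC z w)) v x = koszul w z v x - koszul z w v x" for x
    using w v N by (simp add: gg_add gg_scale vscale_in smooth_fun_const)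
  then show "gg (vdiff (nablaLC w z) (nablaLC z w)) v = gg (lie_bracket w z) v"
    using koszul_swap(1)[OF w v] by auto
qed

lemma nablaLC_metric: "metric_compatible M g nablaLC"
  unfolding metric_compatible_def
proof (intro ballI ext)
  fix w z v x assume w: "w \<in> XM" "z \<in> XM" "v \<in> XM"
  have "gg z (nablaLC w v) = gg (nablaLC w v) z" by (rule gg_sym) (use w nablaLC in auto)
  then have "gg (nablaLC w z) v x + gg z (nablaLC w v) x = w x (gg z v)"
    using w nablaLC(2) koszul_swap(2)[OF w] by simp
  then show "vapply w (\<lambda>x. g x (z x) (v x)) x = g x (nablaLC w z x) (v x) + g x (z x) (nablaLC w v x)"
    by (simp add: gg_def vapply_def)
qed

end

text \<open>The difference of two metric torsion-free connections is symmetric in its two arguments, and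
  pairing it with a third one gives a form antisymmetric in the last two; such a trilinear form
  vanishes.\<close>

lemma symmetric_antisymmetric_zero:
  fixes T :: "'a \<Rightarrow> 'a \<Rightarrow> 'a \<Rightarrow> real"
  assumes "\<And>u v w. u \<in> X \<Longrightarrow> v \<in> X \<Longrightarrow> w \<in> X \<Longrightarrow> T u v w = T v u w"
    "\<And>u v w. u \<in> X \<Longrightarrow> v \<in> X \<Longrightarrow> w \<in> X \<Longrightarrow> T u v w = - T u w v"
    and "u \<in> X" "v \<in> X" "w \<in> X"
  shows "T u v w = 0"
  using assms(1)[of u v w] assms(1)[of u w v] assms(1)[of v w u]
    assms(2)[of u v w] assms(2)[of v w u] assms(2)[of w u v] assms(3-5) by simp

context riem_mfd
begin

lemma levi_civita_unique:
  assumes "affine_connection M N" "metric_compatible M g N" "torsion_free M N"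
    "affine_connection M N'" "metric_compatible M g N'" "torsion_free M N'"
  shows "N = N'"
proof (intro ext)
  fix w z x f
  have in1: "N w z \<in> XM" "N' w z \<in> XM" if "w \<in> XM" "z \<in> XM" for w z
    using affineD(1)[OF assms(1)] affineD(1)[OF assms(4)] that by auto
  define T where "T x u v w = gg (N u v) w x - gg (N' u v) w x" for x u v w
  have sym: "T x u v w = T x v u w" if X: "u \<in> XM" "v \<in> XM" "w \<in> XM" for x u v w
  proof -
    \<comment> \<open>The torsion identity is rearranged into sums, to which additivity of
      \<open>gg\<close> applies.\<close>
    have eq: "vadd (N u v) (N' v u) = vadd (N' u v) (N v u)"
    proof (intro ext)
      fix y f
      have "vdiff (N u v) (N v u) y f = vdiff (N' u v) (N' v u) y f"
        using assms(3,6) X unfolding torsion_free_def by simp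
      then show "vadd (N u v) (N' v u) y f = vadd (N' u v) (N v u) y f"
        by (simp add: vdiff_def vadd_def)
    qed
    have "gg (N u v) w x + gg (N' v u) w x = gg (N' u v) w x + gg (N v u) w x"
      using arg_cong[OF eq, of "\<lambda>Y. gg Y w x"] X in1 by (simp add: gg_add)
    then show ?thesis by (simp add: T_def)
  qed
  have anti: "T x u v w = - T x u w v" if X: "u \<in> XM" "v \<in> XM" "w \<in> XM" for x u v w
  proof -
    have "gg (N u v) w x + gg v (N u w) x = gg (N' u v) w x + gg v (N' u w) x"
      using assms(2,5) X unfolding metric_compatible_def gg_def by (simp add: fun_eq_iff)
    moreover have "gg v (N u w) = gg (N u w) v" "gg v (N' u w) = gg (N' u w) v"
      by (rule gg_sym; use X in1 in simp)+
    ultimately show ?thesis by (simp add: T_def)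
  qed
  have T0: "T x u v w = 0" if "u \<in> XM" "v \<in> XM" "w \<in> XM" for x u v w
    using sym anti that by (rule symmetric_antisymmetric_zero[where X = XM and T = "T x"])
  have "N w z = N' w z" if w: "w \<in> XM" "z \<in> XM"
  proof (rule gg_nondegenerate[OF in1[OF w]])
    show "gg (N w z) v = gg (N' w z) v" if "v \<in> XM" for v
      using T0[OF w that] by (auto simp: T_def)
  qed
  moreover have "N w z = N' w z" if "w \<notin> XM \<or> z \<notin> XM"
    using affineD(6)[OF assms(1) that] affineD(6)[OF assms(4) that] by simp
  ultimately show "N w z x f = N' w z x f" by metis
qed

lemma levi_civita:
  "affine_connection M (levi_civita M g) \<and> metric_compatible M g (levi_civita M g) \<and> torsion_free M (levi_civita M g)"
  unfolding levi_civita_def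
proof (rule theI[of _ nablaLC])
  show LC: "affine_connection M nablaLC \<and> metric_compatible M g nablaLC \<and> torsion_free M nablaLC"
    using nablaLC_affine nablaLC_metric nablaLC_torsion_free by simp
  show "N = nablaLC" if "affine_connection M N \<and> metric_compatible M g N \<and> torsion_free M N" for N
    using that LC levi_civita_unique by simp
qed

end

section \<open>Cylinder functions and cylinder vector fields\<close>

context closed_mfd
begin

abbreviation "FC \<equiv> cyl_functions M"
abbreviation "VV \<equiv> cyl_vector_fields M"
abbreviation "rep \<equiv> cyl_representation M"
abbreviation "act \<equiv> cyl_apply M"
abbreviation "nint \<equiv> nabla_int M"
abbreviation "lifted \<equiv> lifted_connection M"
abbreviation ctensor :: "('m borel_prob \<Rightarrow> real) \<Rightarrow> 'm vfield \<Rightarrow> 'm cyl_vfield"  (infixl "\<otimes>" 70)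
  where "u \<otimes> e \<equiv> \<lambda>\<mu>. vscale (\<lambda>_. u \<mu>) e"
abbreviation "pd k F f i \<mu> \<equiv> partial i F (star_point k f \<mu>)"
abbreviation "flux V f \<mu> \<equiv> pintegral \<mu> (\<lambda>x. V \<mu> x f)"

section \<open>Integrals of smooth functions and mixtures with point masses\<close>

lemma measure_of_prob:
  fixes \<mu> :: "'m borel_prob"
  shows "prob_space (measure_of_prob \<mu>)" "sets (measure_of_prob \<mu>) = sets borel"
  using measure_of_prob[of \<mu>] by auto

lemma smooth_fun_bounded:
  assumes "f \<in> CM"
  obtains B where "\<And>x. \<bar>f x\<bar> \<le> B"
proof -
  have "bounded (range f)"
    by (rule compact_imp_bounded[OF compact_continuous_image[OF smooth_fun_continuous[OF assms] compact_M]])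
  then show thesis using that by (auto simp: bounded_iff)
qed

lemma smooth_fun_measurable: "f \<in> CM \<Longrightarrow> f \<in> borel_measurable (measure_of_prob \<mu>)"
  using borel_measurable_continuous_onI[OF smooth_fun_continuous] measurable_cong_sets[OF measure_of_prob(2) refl]
  by blast

lemma smooth_fun_integrable:
  assumes "f \<in> CM"
  shows "integrable (measure_of_prob \<mu>) f"
proof -
  interpret prob_space "measure_of_prob \<mu>" by (rule measure_of_prob)
  obtain B where "\<And>x. \<bar>f x\<bar> \<le> B" using smooth_fun_bounded[OF assms] by blast
  then show ?thesis
    by (intro integrable_const_bound[of f B] smooth_fun_measurable[OF assms]) simp
qed

lemma pint_add: "f \<in> CM \<Longrightarrow> h \<in> CM \<Longrightarrow> pintegral \<mu> (\<lambda>x. f x + h x) = pintegral \<mu> f + pintegral \<mu> h"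
  unfolding pintegral_def by (rule Bochner_Integration.integral_add) (auto intro: smooth_fun_integrable)

lemma pint_cmult: "pintegral \<mu> (\<lambda>x. c * f x) = c * pintegral \<mu> f"
  unfolding pintegral_def by simp

lemma pint_zero: "pintegral \<mu> (\<lambda>x. 0) = 0"
  unfolding pintegral_def by simp

lemma pint_sum: "(\<And>i. i \<in> I \<Longrightarrow> f i \<in> CM) \<Longrightarrow> pintegral \<mu> (\<lambda>x. \<Sum>i\<in>I. f i x) = (\<Sum>i\<in>I. pintegral \<mu> (f i))"
  unfolding pintegral_def by (rule Bochner_Integration.integral_sum) (auto intro: smooth_fun_integrable)

text \<open>For t between 0 and 1 this is the convex combination of \<mu> with the point mass at x
  of weight t, obtained by tossing a biased coin between the two measures.\<close>

definition mix :: "real \<Rightarrow> 'm borel_prob \<Rightarrow> 'm \<Rightarrow> 'm borel_prob" where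
  "mix t \<mu> x = Abs_borel_prob (measure_pmf (bernoulli_pmf t) \<bind>
     (\<lambda>b. if b then return borel x else measure_of_prob \<mu>))"

lemma pint_mix:
  assumes t: "0 \<le> t" "t \<le> 1" and f: "f \<in> CM"
  shows "pintegral (mix t \<mu> x) f = pintegral \<mu> f + t * (f x - pintegral \<mu> f)"
proof -
  define N where "N b = (if b then return borel x else measure_of_prob \<mu>)" for b
  have N: "prob_space (N b)" "sets (N b) = sets borel" for b
    using measure_of_prob prob_space_return[of x borel] by (auto simp: N_def)
  have Nm: "N \<in> measurable (measure_pmf (bernoulli_pmf t)) (subprob_algebra borel)"
    using N by (auto simp: space_subprob_algebra measurable_def intro: prob_space_imp_subprob_space)
  have "prob_space (measure_pmf (bernoulli_pmf t) \<bind> N)"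
    by (rule prob_space.prob_space_bind[OF measure_pmf.prob_space_axioms _ Nm]) (use N in auto)
  moreover have "sets (measure_pmf (bernoulli_pmf t) \<bind> N) = sets borel"
    by (rule sets_bind) (use N in auto)
  ultimately have m: "measure_of_prob (mix t \<mu> x) = measure_pmf (bernoulli_pmf t) \<bind> N"
    unfolding mix_def N_def[abs_def] by (simp add: Abs_borel_prob_inverse)
  obtain B where B: "\<And>x. \<bar>f x\<bar> \<le> B" using smooth_fun_bounded[OF f] by blast
  have fb: "f \<in> borel_measurable borel"
    by (rule borel_measurable_continuous_onI[OF smooth_fun_continuous[OF f]])
  have "pintegral (mix t \<mu> x) f = (\<integral>b. integral\<^sup>L (N b) f \<partial>measure_pmf (bernoulli_pmf t))"
    unfolding pintegral_def m
    by (rule integral_bind[OF fb B Nm, of 1]) (use N in \<open>auto simp: prob_space.emeasure_space_1 measure_pmf.finite_measure_axioms\<close>)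
  also have "\<dots> = integral\<^sup>L (N True) f * t + integral\<^sup>L (N False) f * (1 - t)"
    by (rule integral_bernoulli_pmf[OF t])
  also have "integral\<^sup>L (N True) f = f x"
    by (simp add: N_def integral_return[OF _ fb])
  also have "integral\<^sup>L (N False) f = pintegral \<mu> f"
    by (simp add: N_def pintegral_def)
  finally show ?thesis by (simp add: algebra_simps)
qed

definition dirac :: "'m \<Rightarrow> 'm borel_prob" where "dirac x = mix 1 undefined x"

lemma pint_dirac: "f \<in> CM \<Longrightarrow> pintegral (dirac x) f = f x"
  unfolding dirac_def by (simp add: pint_mix)

section \<open>Cylinder functions and their differentials\<close>

abbreviation "Ek k \<equiv> topspace (Euclidean_space k)"

lemma eopen_Ek: "eopen k (Ek k)"
  by simp

lemma star_point_in: "star_point k f \<mu> \<in> Ek k"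
  by (simp add: star_point_def topspace_Euclidean_space)

lemma cyl_repI:
  "smooth_on k (Ek k) F \<Longrightarrow> (\<And>i. i < k \<Longrightarrow> f i \<in> CM) \<Longrightarrow> (\<And>\<mu>. u \<mu> = F (star_point k f \<mu>)) \<Longrightarrow> rep u k F f"
  by (auto simp: cyl_representation_def)

lemma cyl_repD:
  assumes "rep u k F f"
  shows "smooth_on k (Ek k) F" "i < k \<Longrightarrow> f i \<in> CM" "u = (\<lambda>\<mu>. F (star_point k f \<mu>))"
  using assms by (auto simp: cyl_representation_def)

lemma FC_I: "rep u k F f \<Longrightarrow> u \<in> FC"
  by (auto simp: cyl_functions_def)

text \<open>Concatenating the two lists of test functions allows sums and products of cylinder
  functions to be formed on the level of F and G.\<close>

lemma cyl_common_representation: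
  assumes "u \<in> FC" "v \<in> FC"
  obtains k F G f where "rep u k F f" "rep v k G f"
proof -
  obtain k1 F1 f1 where 1: "rep u k1 F1 f1" using assms by (auto simp: cyl_functions_def)
  obtain k2 F2 f2 where 2: "rep v k2 F2 f2" using assms by (auto simp: cyl_functions_def)
  define k where "k = k1 + k2"
  define f where "f i = (if i < k1 then f1 i else f2 (i - k1))" for i
  have f: "f i \<in> CM" if "i < k" for i
    using that cyl_repD(2)[OF 1] cyl_repD(2)[OF 2] by (auto simp: f_def k_def)
  show thesis
  proof (rule that)
    show "rep u k (\<lambda>x. F1 (\<lambda>i. if i < k1 then x i else 0)) f"
    proof (rule cyl_repI[OF _ f])
      show "smooth_on k (Ek k) (\<lambda>x. F1 (\<lambda>i. if i < k1 then x i else 0))"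
        by (rule smooth_on_compose[OF eopen_Ek eopen_Ek smooth_on_coord[OF eopen_Ek] cyl_repD(1)[OF 1]])
          (auto simp: topspace_Euclidean_space)
      have "star_point k1 f1 \<mu> = (\<lambda>i. if i < k1 then star_point k f \<mu> i else 0)" for \<mu>
        by (auto simp: star_point_def f_def k_def)
      then show "u \<mu> = F1 (\<lambda>i. if i < k1 then star_point k f \<mu> i else 0)" for \<mu>
        using cyl_repD(3)[OF 1] by simp
    qed
    show "rep v k (\<lambda>x. F2 (\<lambda>i. if i < k2 then x (k1 + i) else 0)) f"
    proof (rule cyl_repI[OF _ f])
      show "smooth_on k (Ek k) (\<lambda>x. F2 (\<lambda>i. if i < k2 then x (k1 + i) else 0))"
        by (rule smooth_on_compose[OF eopen_Ek eopen_Ek smooth_on_coord[OF eopen_Ek] cyl_repD(1)[OF 2]])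
          (auto simp: topspace_Euclidean_space)
      have "star_point k2 f2 \<mu> = (\<lambda>i. if i < k2 then star_point k f \<mu> (k1 + i) else 0)" for \<mu>
        by (auto simp: star_point_def f_def k_def)
      then show "v \<mu> = F2 (\<lambda>i. if i < k2 then star_point k f \<mu> (k1 + i) else 0)" for \<mu>
        using cyl_repD(3)[OF 2] by simp
    qed
  qed
qed

lemma cyl_rep_const: "rep (\<lambda>_. c) 0 (\<lambda>_. c) f"
  by (rule cyl_repI) (auto simp: smooth_on_const)

lemma cyl_rep_star: "f \<in> CM \<Longrightarrow> rep (\<lambda>\<mu>. pintegral \<mu> f) 1 (\<lambda>x. x 0) (\<lambda>_. f)"
  by (rule cyl_repI) (auto simp: smooth_on_coord star_point_def)

lemma cyl_rep_add: "rep u k F f \<Longrightarrow> rep v k G f \<Longrightarrow>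
    rep (\<lambda>\<mu>. u \<mu> + v \<mu>) k (\<lambda>x. F x + G x) f"
  by (rule cyl_repI) (auto simp: smooth_on_add cyl_representation_def)

lemma cyl_rep_mult: "rep u k F f \<Longrightarrow> rep v k G f \<Longrightarrow>
    rep (\<lambda>\<mu>. u \<mu> * v \<mu>) k (\<lambda>x. F x * G x) f"
  by (rule cyl_repI) (auto simp: smooth_on_mult cyl_representation_def)

lemma cyl_rep_partial: "rep u k F f \<Longrightarrow> i < k \<Longrightarrow>
    rep (\<lambda>\<mu>. pd k F f i \<mu>) k (partial i F) f"
  by (rule cyl_repI) (auto simp: smooth_on_partial cyl_representation_def)

lemma FC_const: "(\<lambda>_. c) \<in> FC"
  by (rule FC_I[OF cyl_rep_const])

lemma FC_star: "f \<in> CM \<Longrightarrow> (\<lambda>\<mu>. pintegral \<mu> f) \<in> FC"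
  by (rule FC_I[OF cyl_rep_star])

lemma FC_add: "u \<in> FC \<Longrightarrow> v \<in> FC \<Longrightarrow> (\<lambda>\<mu>. u \<mu> + v \<mu>) \<in> FC"
  using cyl_common_representation[of u v] cyl_rep_add FC_I by metis

lemma FC_mult: "u \<in> FC \<Longrightarrow> v \<in> FC \<Longrightarrow> (\<lambda>\<mu>. u \<mu> * v \<mu>) \<in> FC"
  using cyl_common_representation[of u v] cyl_rep_mult FC_I by metis

lemma FC_sum: "(\<And>i. i \<in> I \<Longrightarrow> u i \<in> FC) \<Longrightarrow> (\<lambda>\<mu>. \<Sum>i\<in>I. u i \<mu>) \<in> FC"
  by (induction I rule: infinite_finite_induct) (auto intro: FC_const FC_add)

text \<open>Along the mixtures the star point moves affinely, so this is the chain rule. The left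
  side does not mention the representation of u, which is how the differential becomes independent
  of it.\<close>

lemma rep_line_derivative:
  assumes "rep u k F f"
  shows "((\<lambda>t. u (mix t \<mu> x)) has_real_derivative
    (\<Sum>i<k. pd k F f i \<mu> * (f i x - pintegral \<mu> (f i)))) (at_right 0)"
    (is "(_ has_real_derivative ?D) _")
    and "u (mix 0 \<mu> x) = u \<mu>"
proof -
  note R = cyl_repD[OF assms]
  define c where "c t i = (if i < k then pintegral \<mu> (f i) + t * (f i x - pintegral \<mu> (f i)) else 0)"
    for t i
  have c: "star_point k f (mix t \<mu> x) = c t" if "0 \<le> t" "t \<le> 1" for t
    using that R(2) by (auto simp: star_point_def c_def pint_mix)
  have c0: "c 0 = star_point k f \<mu>" by (auto simp: star_point_def c_def)
  have "((\<lambda>t. F (c t)) has_real_derivative (\<Sum>i<k. partial i F (c 0) * (f i x - pintegral \<mu> (f i)))) (at 0 within {0<..})"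
  proof (rule C1_chain_rule[OF eopen_Ek])
    show "C_on (Suc 0) k (Ek k) F" using R(1) by (simp add: smooth_on_def del: C_on.simps)
    show "((\<lambda>s. c s i) has_real_derivative f i x - pintegral \<mu> (f i)) (at 0 within {0<..})" if "i < k"
      for i
      using that by (auto simp: c_def intro!: derivative_eq_intros)
  qed (auto simp: c_def topspace_Euclidean_space)
  moreover show u0: "u (mix 0 \<mu> x) = u \<mu>" using c[of 0] c0 R(3) by simp
  ultimately show "((\<lambda>t. u (mix t \<mu> x)) has_real_derivative ?D) (at_right 0)"
    unfolding c0 has_field_derivative_iff
  proof (elim Lim_transform_eventually, intro eventually_at_rightI[of 0 1])
    fix t :: real assume "t \<in> {0<..<1}"
    then show "(F (c t) - F (star_point k f \<mu>)) / (t - 0) = (u (mix t \<mu> x) - u (mix 0 \<mu> x)) / (t - 0)"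
      using c[of t] u0 c0 R(3) by simp
  qed simp
qed

lemma differential_in: "f \<in> CM \<Longrightarrow> differential M f \<in> one_forms M"
  unfolding one_forms_def differential_def
  using tangent_add tangent_cmult vector_fieldD by auto

lemma differential_apply: "v \<in> TM x \<Longrightarrow> differential M f x v = v f"
  by (simp add: differential_def)

text \<open>Both representations yield the same right derivative towards the Dirac measure at each
  y. This is an equality of smooth functions of y; applying the tangent vector v to it removes the
  constant integrals.\<close>

lemma rep_differential_unique:
  assumes "rep u k F f" "rep u l G h"
  shows "tensor_sum k (\<lambda>i \<mu>. pd k F f i \<mu>) (\<lambda>i. differential M (f i)) =
    tensor_sum l (\<lambda>i \<mu>. pd l G h i \<mu>) (\<lambda>i. differential M (h i))"
proof (intro ext)
  fix \<mu> x v
  define a where "a i = pd k F f i \<mu>" for i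
  define b where "b i = pd l G h i \<mu>" for i
  note R = cyl_repD(2)[OF assms(1)] cyl_repD(2)[OF assms(2)]
  show "tensor_sum k (\<lambda>i \<mu>. pd k F f i \<mu>) (\<lambda>i. differential M (f i)) \<mu> x v =
    tensor_sum l (\<lambda>i \<mu>. pd l G h i \<mu>) (\<lambda>i. differential M (h i)) \<mu> x v"
  proof (cases "v \<in> TM x")
    case True
    have eq: "(\<Sum>i<k. a i * (f i y - pintegral \<mu> (f i))) = (\<Sum>i<l. b i * (h i y - pintegral \<mu> (h i)))"
      for y
    proof (rule tendsto_unique[of "at_right (0::real)"])
      show "((\<lambda>t. (u (mix t \<mu> y) - u (mix 0 \<mu> y)) / (t - 0)) \<longlongrightarrow> (\<Sum>i<k. a i * (f i y - pintegral \<mu> (f i)))) (at_right 0)"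
        using rep_line_derivative(1)[OF assms(1), of \<mu> y] unfolding has_field_derivative_iff a_def .
      show "((\<lambda>t. (u (mix t \<mu> y) - u (mix 0 \<mu> y)) / (t - 0)) \<longlongrightarrow> (\<Sum>i<l. b i * (h i y - pintegral \<mu> (h i)))) (at_right 0)"
        using rep_line_derivative(1)[OF assms(2), of \<mu> y] unfolding has_field_derivative_iff b_def .
    qed simp
    have v: "v (\<lambda>y. \<Sum>i<m. e i * (q i y - pintegral \<mu> (q i))) = (\<Sum>i<m. e i * v (q i))"
      if q: "\<And>i. i < m \<Longrightarrow> q i \<in> CM" for m :: nat and e q
    proof -
      have "(\<lambda>y. q i y - pintegral \<mu> (q i)) \<in> CM" if "i < m" for i
        by (rule smooth_fun_diff[OF q[OF that] smooth_fun_const])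
      then show ?thesis
        using tangent_sum[OF True, of "{..<m}" "\<lambda>i y. e i * (q i y - pintegral \<mu> (q i))"]
          tangentD(2)[OF True] tangent_diff[OF True q smooth_fun_const] tangent_const[OF True] smooth_fun_cmult
        by simp
    qed
    have "(\<Sum>i<k. a i * v (f i)) = (\<Sum>i<l. b i * v (h i))"
      using v[where m = k and q = f and e = a, OF R(1)] v[where m = l and q = h and e = b, OF R(2)] eq by simp
    then show ?thesis
      by (simp add: tensor_sum_def differential_apply[OF True] a_def b_def)
  qed (simp add: tensor_sum_def differential_def)
qed

lemma cyl_differential_rep:
  assumes "rep u k F f"
  shows "cyl_differential M u =
    tensor_sum k (\<lambda>i \<mu>. pd k F f i \<mu>) (\<lambda>i. differential M (f i))" (is "_ = ?\<Theta>")
  unfolding cyl_differential_def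
proof (rule the_equality)
  have "?\<Theta> \<in> cyl_one_forms M"
    unfolding cyl_one_forms_def cyl_tensors_def
    by (intro CollectI exI conjI allI impI refl)
      (auto intro: FC_I[OF cyl_rep_partial[OF assms]] differential_in cyl_repD(2)[OF assms])
  then show "?\<Theta> \<in> cyl_one_forms M \<and> (\<exists>k F f. rep u k F f \<and>
       ?\<Theta> = tensor_sum k (\<lambda>i \<mu>. pd k F f i \<mu>) (\<lambda>i. differential M (f i)))"
    using assms by blast
  fix \<Theta> assume "\<Theta> \<in> cyl_one_forms M \<and> (\<exists>k F f. rep u k F f \<and>
       \<Theta> = tensor_sum k (\<lambda>i \<mu>. pd k F f i \<mu>) (\<lambda>i. differential M (f i)))"
  then obtain l G h where l: "rep u l G h"
    "\<Theta> = tensor_sum l (\<lambda>i \<mu>. pd l G h i \<mu>) (\<lambda>i. differential M (h i))" by blast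
  then show "\<Theta> = ?\<Theta>" using rep_differential_unique[OF l(1) assms] by simp
qed

section \<open>Cylinder vector fields and their action\<close>

lemma VV_zero: "czero \<in> VV"
  unfolding cyl_vector_fields_def cyl_tensors_def
  by (auto intro!: exI[of _ 0] simp: czero_def vzero_def tensor_sum_def)

lemma VV_step:
  assumes "V \<in> VV" "u \<in> FC" "e \<in> XM"
  shows "cadd V (u \<otimes> e) \<in> VV"
proof -
  obtain m w z where V: "\<forall>i<m. w i \<in> FC \<and> z i \<in> XM" "V = tensor_sum m w z"
    using assms(1) unfolding cyl_vector_fields_def cyl_tensors_def by blast
  have "cadd V (u \<otimes> e) = tensor_sum (Suc m) (w(m := u)) (z(m := e))"
    by (simp add: V(2) cadd_def vadd_def vscale_def tensor_sum_def)
  moreover have "\<forall>i<Suc m. (w(m := u)) i \<in> FC \<and> (z(m := e)) i \<in> XM"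
    using V(1) assms by (auto simp: less_Suc_eq)
  ultimately show ?thesis unfolding cyl_vector_fields_def cyl_tensors_def by blast
qed

text \<open>Adding one elementary tensor at a time keeps the index families of a representation out
  of the later proofs.\<close>

lemma VV_induct [consumes 1, case_names zero step]:
  assumes "V \<in> VV" and zero: "P czero"
    and step: "\<And>V u e. V \<in> VV \<Longrightarrow> P V \<Longrightarrow> u \<in> FC \<Longrightarrow> e \<in> XM \<Longrightarrow> P (cadd V (u \<otimes> e))"
  shows "P V"
proof -
  obtain m w z where V: "\<forall>i<m. w i \<in> FC \<and> z i \<in> XM" "V = tensor_sum m w z"
    using assms(1) unfolding cyl_vector_fields_def cyl_tensors_def by blast
  have "tensor_sum m w z \<in> VV \<and> P (tensor_sum m w z)" using V(1)
  proof (induction m)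
    case 0
    have "tensor_sum 0 w z = czero" by (simp add: tensor_sum_def czero_def vzero_def)
    then show ?case using zero VV_zero by simp
  next
    case (Suc m)
    have "tensor_sum (Suc m) w z = cadd (tensor_sum m w z) (\<lambda>\<mu>. vscale (\<lambda>_. w m \<mu>) (z m))"
      by (simp add: cadd_def vadd_def vscale_def tensor_sum_def)
    then show ?case using Suc step[of "tensor_sum m w z" "w m" "z m"] VV_step by simp
  qed
  then show ?thesis using V(2) by simp
qed

lemma VV_at: "V \<in> VV \<Longrightarrow> V \<mu> \<in> XM"
proof (induction V rule: VV_induct)
  case zero
  show ?case by (simp add: czero_def vzero_in)
next
  case (step V u e)
  then show ?case by (simp add: cadd_def vadd_in vscale_in smooth_fun_const)
qed

lemma VV_smooth: "V \<in> VV \<Longrightarrow> f \<in> CM \<Longrightarrow> (\<lambda>x. V \<mu> x f) \<in> CM"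
  by (rule vector_fieldD(2)[OF VV_at])

lemma VV_single: "u \<in> FC \<Longrightarrow> e \<in> XM \<Longrightarrow> (u \<otimes> e) \<in> VV"
  using VV_step[OF VV_zero] by (simp add: cadd_def czero_def vadd_def vzero_def)

lemma VV_const: "w \<in> XM \<Longrightarrow> (\<lambda>\<mu>. w) \<in> VV"
  using VV_single[OF FC_const, of w 1] by (simp add: vscale_def)

lemma VV_add:
  assumes "V \<in> VV" "Z \<in> VV"
  shows "cadd V Z \<in> VV"
  using assms(2)
proof (induction Z rule: VV_induct)
  case zero
  then show ?case using assms(1) by (simp add: cadd_def czero_def vadd_def vzero_def)
next
  case (step Z u e)
  have "cadd V (cadd Z (u \<otimes> e)) = cadd (cadd V Z) (u \<otimes> e)"
    by (simp add: cadd_def vadd_def add.assoc)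
  then show ?case using VV_step[OF step.IH step.hyps(2,3)] by simp
qed

lemma VV_scale:
  assumes v: "v \<in> FC" and "V \<in> VV"
  shows "cscale v V \<in> VV"
  using assms(2)
proof (induction V rule: VV_induct)
  case zero
  show ?case using VV_zero by (simp add: cscale_def czero_def vscale_def vzero_def)
next
  case (step V u e)
  have "cscale v (cadd V (u \<otimes> e)) = cadd (cscale v V) (\<lambda>\<mu>. vscale (\<lambda>_. v \<mu> * u \<mu>) e)"
    by (simp add: cscale_def cadd_def vadd_def vscale_def algebra_simps)
  then show ?case using VV_step[OF step.IH FC_mult[OF v step.hyps(2)] step.hyps(3)] by simp
qed

lemma VV_diff:
  assumes "V \<in> VV" "Z \<in> VV"
  shows "cdiff V Z \<in> VV"
proof -
  have "cdiff V Z = cadd V (cscale (\<lambda>_. -1) Z)"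
    by (simp add: cdiff_def cadd_def cscale_def vdiff_def vadd_def vscale_def)
  then show ?thesis using VV_add VV_scale FC_const assms by metis
qed

lemma cyl_apply_rep:
  assumes V: "V \<in> VV" and u: "rep u k F f"
  shows "act V u \<mu> = (\<Sum>i<k. pd k F f i \<mu> * flux V (f i) \<mu>)"
proof -
  have T: "V \<mu> x \<in> TM x" for x by (rule vector_fieldD(1)[OF VV_at[OF V]])
  have "act V u \<mu> = pintegral \<mu> (\<lambda>x. \<Sum>i<k. pd k F f i \<mu> * V \<mu> x (f i))"
    unfolding cyl_apply_def cyl_differential_rep[OF u] tensor_sum_def differential_apply[OF T] ..
  also have "\<dots> = (\<Sum>i<k. pintegral \<mu> (\<lambda>x. pd k F f i \<mu> * V \<mu> x (f i)))"
    by (rule pint_sum) (use cyl_repD(2)[OF u] VV_smooth[OF V] smooth_fun_cmult in auto)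
  finally show ?thesis by (simp add: pint_cmult)
qed

text \<open>The smooth functions on \<open>M\<close> depending on the measure as a cylinder function, i.e. the image
  of the tensor product of cylinder functions with smooth functions.\<close>

inductive_set CF :: "('m borel_prob \<Rightarrow> 'm \<Rightarrow> real) set" where
  CF_zero: "(\<lambda>\<mu> x. 0) \<in> CF"
| CF_step: "H \<in> CF \<Longrightarrow> u \<in> FC \<Longrightarrow> h \<in> CM \<Longrightarrow> (\<lambda>\<mu> x. H \<mu> x + u \<mu> * h x) \<in> CF"

lemma CF_add:
  assumes "H \<in> CF" "K \<in> CF"
  shows "(\<lambda>\<mu> x. H \<mu> x + K \<mu> x) \<in> CF"
  using assms(2)
proof induction
  case CF_zero
  then show ?case using assms(1) by simp
next
  case (CF_step K u h)
  then show ?case using CF.CF_step[OF CF_step(4,2,3)] by (simp add: add.assoc)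
qed

lemma CF_scale:
  assumes v: "v \<in> FC" and "H \<in> CF"
  shows "(\<lambda>\<mu> x. v \<mu> * H \<mu> x) \<in> CF"
  using assms(2)
proof induction
  case CF_zero
  then show ?case using CF.CF_zero by simp
next
  case (CF_step H u h)
  then show ?case using CF.CF_step[OF CF_step(4) FC_mult[OF v CF_step(2)] CF_step(3)]
    by (simp add: algebra_simps)
qed

lemma CF_smooth: "H \<in> CF \<Longrightarrow> H \<mu> \<in> CM"
  by (induction rule: CF.induct) (auto intro: smooth_fun_const smooth_fun_add smooth_fun_cmult)

lemma CF_FC: "H \<in> CF \<Longrightarrow> (\<lambda>\<mu>. H \<mu> x) \<in> FC"
proof (induction rule: CF.induct)
  case (CF_step H u h)
  then show ?case by (intro FC_add FC_mult[OF _ FC_const])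
qed (rule FC_const)

lemma CF_pint: "H \<in> CF \<Longrightarrow> (\<lambda>\<mu>. pintegral \<mu> (H \<mu>)) \<in> FC"
proof (induction rule: CF.induct)
  case (CF_step H u h)
  then show ?case
    using FC_add[OF CF_step(4) FC_mult[OF CF_step(2) FC_star[OF CF_step(3)]]] CF_smooth[OF CF_step(1)]
    by (simp add: pint_add pint_cmult smooth_fun_cmult)
qed (simp add: pint_zero FC_const)

lemma VV_CF: "V \<in> VV \<Longrightarrow> f \<in> CM \<Longrightarrow> (\<lambda>\<mu> x. V \<mu> x f) \<in> CF"
proof (induction V rule: VV_induct)
  case zero
  then show ?case using CF_zero by (simp add: czero_def vzero_def)
next
  case (step V u e)
  then show ?case
    using CF_step[OF step.IH[OF step.prems] step.hyps(2) vector_fieldD(2)[OF step.hyps(3) step.prems]]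
    by (simp add: cadd_def vadd_def vscale_def)
qed

lemma VV_FC: "V \<in> VV \<Longrightarrow> (\<lambda>\<mu>. V \<mu> x f) \<in> FC"
proof (induction V rule: VV_induct)
  case zero
  then show ?case by (simp add: czero_def vzero_def FC_const)
next
  case (step V u e)
  then show ?case by (simp add: cadd_def vadd_def vscale_def FC_add FC_mult FC_const)
qed

lemma cyl_apply_in:
  assumes V: "V \<in> VV" and u: "u \<in> FC"
  shows "act V u \<in> FC"
proof -
  obtain k F f where r: "rep u k F f" using u by (auto simp: cyl_functions_def)
  have "(\<lambda>\<mu>. \<Sum>i<k. pd k F f i \<mu> * flux V (f i) \<mu>) \<in> FC"
    by (intro FC_sum FC_mult FC_I[OF cyl_rep_partial[OF r]] CF_pint VV_CF[OF V] cyl_repD(2)[OF r]) auto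
  then show ?thesis by (simp add: cyl_apply_rep[OF V r, symmetric])
qed

lemma cyl_apply_const: "V \<in> VV \<Longrightarrow> act V (\<lambda>_. c) \<mu> = 0"
  using cyl_apply_rep[OF _ cyl_rep_const] by simp

lemma cyl_apply_star:
  assumes "V \<in> VV" "f \<in> CM"
  shows "act V (\<lambda>\<mu>. pintegral \<mu> f) \<mu> = flux V f \<mu>"
proof -
  have "partial 0 (\<lambda>x. x 0) (star_point 1 (\<lambda>_. f) \<mu>) = 1"
    by (rule partial_eqI) (auto intro!: derivative_eq_intros)
  then show ?thesis using cyl_apply_rep[OF assms(1) cyl_rep_star[OF assms(2)], of \<mu>] by simp
qed

lemma cyl_apply_add:
  assumes V: "V \<in> VV" and "u \<in> FC" "v \<in> FC"
  shows "act V (\<lambda>\<mu>. u \<mu> + v \<mu>) \<mu> = act V u \<mu> + act V v \<mu>"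
proof -
  obtain k F G f where u: "rep u k F f" and v: "rep v k G f"
    by (rule cyl_common_representation[OF assms(2,3)])
  have "(\<Sum>i<k. partial i (\<lambda>x. F x + G x) (star_point k f \<mu>) * flux V (f i) \<mu>) =
      (\<Sum>i<k. pd k F f i \<mu> * flux V (f i) \<mu> +
        pd k G f i \<mu> * flux V (f i) \<mu>)"
    by (rule sum.cong)
      (simp_all add: partial_add[OF cyl_repD(1)[OF u] cyl_repD(1)[OF v] _ star_point_in] distrib_right)
  then show ?thesis
    by (simp add: cyl_apply_rep[OF V cyl_rep_add[OF u v]] cyl_apply_rep[OF V u] cyl_apply_rep[OF V v] sum.distrib)
qed

lemma cyl_apply_mult:
  assumes V: "V \<in> VV" and "u \<in> FC" "v \<in> FC"
  shows "act V (\<lambda>\<mu>. u \<mu> * v \<mu>) \<mu> = act V u \<mu> * v \<mu> + u \<mu> * act V v \<mu>"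
proof -
  obtain k F G f where u: "rep u k F f" and v: "rep v k G f"
    by (rule cyl_common_representation[OF assms(2,3)])
  have "(\<Sum>i<k. partial i (\<lambda>x. F x * G x) (star_point k f \<mu>) * flux V (f i) \<mu>) =
      (\<Sum>i<k. pd k F f i \<mu> * flux V (f i) \<mu> * G (star_point k f \<mu>) +
        F (star_point k f \<mu>) * (pd k G f i \<mu> * flux V (f i) \<mu>))"
    by (rule sum.cong)
      (simp_all add: partial_mult[OF cyl_repD(1)[OF u] cyl_repD(1)[OF v] _ star_point_in] algebra_simps)
  also have "\<dots> = act V u \<mu> * G (star_point k f \<mu>) + F (star_point k f \<mu>) * act V v \<mu>"
    by (simp add: cyl_apply_rep[OF V u] cyl_apply_rep[OF V v] sum.distrib sum_distrib_left sum_distrib_right)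
  finally show ?thesis
    unfolding cyl_apply_rep[OF V cyl_rep_mult[OF u v], symmetric]
    by (simp add: fun_cong[OF cyl_repD(3)[OF u], of \<mu>] fun_cong[OF cyl_repD(3)[OF v], of \<mu>])
qed

lemma cyl_apply_sum:
  assumes V: "V \<in> VV" and "\<And>i. i \<in> I \<Longrightarrow> u i \<in> FC"
  shows "act V (\<lambda>\<mu>. \<Sum>i\<in>I. u i \<mu>) \<mu> = (\<Sum>i\<in>I. act V (u i) \<mu>)"
  using assms(2)
proof (induction I rule: infinite_finite_induct)
  case (insert i I)
  then show ?case using cyl_apply_add[OF V, of "u i" "\<lambda>\<mu>. \<Sum>i\<in>I. u i \<mu>"] FC_sum[of I u] by simp
qed (simp_all add: cyl_apply_const[OF V])

lemma cyl_apply_cadd: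
  assumes V: "V \<in> VV" "V' \<in> VV" and u: "u \<in> FC"
  shows "act (cadd V V') u \<mu> = act V u \<mu> + act V' u \<mu>"
proof -
  obtain k F f where r: "rep u k F f" using u by (auto simp: cyl_functions_def)
  have "pintegral \<mu> (\<lambda>x. cadd V V' \<mu> x (f i)) = flux V (f i) \<mu> + flux V' (f i) \<mu>"
    if "i < k" for i
    unfolding cadd_def vadd_def
    by (rule pint_add[OF VV_smooth[OF V(1)] VV_smooth[OF V(2)]]) (rule cyl_repD(2)[OF r that])+
  then show ?thesis
    using cyl_apply_rep[OF VV_add[OF V] r, of \<mu>] cyl_apply_rep[OF V(1) r, of \<mu>] cyl_apply_rep[OF V(2) r, of \<mu>]
    by (simp add: sum.distrib distrib_left)
qed

lemma cyl_apply_cscale: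
  assumes V: "V \<in> VV" and v: "v \<in> FC" and u: "u \<in> FC"
  shows "act (cscale v V) u \<mu> = v \<mu> * act V u \<mu>"
proof -
  obtain k F f where r: "rep u k F f" using u by (auto simp: cyl_functions_def)
  show ?thesis
    using cyl_apply_rep[OF VV_scale[OF v V] r, of \<mu>] cyl_apply_rep[OF V r, of \<mu>]
    by (simp add: cscale_def vscale_def pint_cmult sum_distrib_left mult_ac)
qed

text \<open>A product rule: \<mu> occurs in the integrand, which gives the first term, and as the
  measure of integration, which gives the second. Both claims share one induction, because splitting
  the first integral needs the differentiated integrand to be smooth in x.\<close>

lemma cyl_apply_pint:
  assumes V: "V \<in> VV" and "H \<in> CF"
  shows "act V (\<lambda>\<mu>. pintegral \<mu> (H \<mu>)) \<mu> =
      pintegral \<mu> (\<lambda>x. act V (\<lambda>\<nu>. H \<nu> x) \<mu>) + pintegral \<mu> (\<lambda>x. V \<mu> x (H \<mu>))"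
    and "(\<lambda>\<mu> x. act V (\<lambda>\<nu>. H \<nu> x) \<mu>) \<in> CF"
proof -
  have "act V (\<lambda>\<mu>. pintegral \<mu> (H \<mu>)) \<mu> =
      pintegral \<mu> (\<lambda>x. act V (\<lambda>\<nu>. H \<nu> x) \<mu>) + pintegral \<mu> (\<lambda>x. V \<mu> x (H \<mu>)) \<and>
    (\<lambda>\<mu> x. act V (\<lambda>\<nu>. H \<nu> x) \<mu>) \<in> CF"
    using assms(2)
  proof induction
    case CF_zero
    have "V \<mu> x (\<lambda>x. 0) = 0" for x by (rule tangent_const[OF vector_fieldD(1)[OF VV_at[OF V]]])
    then show ?case using cyl_apply_const[OF V] CF.CF_zero by (simp add: pint_zero)
  next
    case (CF_step H u h)
    note S = CF_step(1-3)
    have 1: "act V (\<lambda>\<nu>. H \<nu> x + u \<nu> * h x) = (\<lambda>\<mu>. act V (\<lambda>\<nu>. H \<nu> x) \<mu> + act V u \<mu> * h x)" for x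
      using cyl_apply_add[OF V CF_FC[OF S(1)] FC_mult[OF S(2) FC_const]]
        cyl_apply_mult[OF V S(2) FC_const] cyl_apply_const[OF V] by auto
    have "(\<lambda>\<mu> x. act V (\<lambda>\<nu>. H \<nu> x) \<mu> + act V u \<mu> * h x) \<in> CF"
      using CF.CF_step[OF _ cyl_apply_in[OF V S(2)] S(3)] CF_step(4) by blast
    moreover have "act V (\<lambda>\<mu>. pintegral \<mu> (\<lambda>x. H \<mu> x + u \<mu> * h x)) \<mu> =
      pintegral \<mu> (\<lambda>x. act V (\<lambda>\<nu>. H \<nu> x) \<mu> + act V u \<mu> * h x) +
      pintegral \<mu> (\<lambda>x. V \<mu> x (\<lambda>x. H \<mu> x + u \<mu> * h x))"
    proof -
      have "act V (\<lambda>\<mu>. pintegral \<mu> (\<lambda>x. H \<mu> x + u \<mu> * h x)) \<mu> =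
          act V (\<lambda>\<mu>. pintegral \<mu> (H \<mu>) + u \<mu> * pintegral \<mu> h) \<mu>"
        using CF_smooth[OF S(1)] S(3) by (simp add: pint_add pint_cmult smooth_fun_cmult)
      also have "\<dots> = act V (\<lambda>\<mu>. pintegral \<mu> (H \<mu>)) \<mu> +
          (act V u \<mu> * pintegral \<mu> h + u \<mu> * flux V h \<mu>)"
        using cyl_apply_add[OF V CF_pint[OF S(1)] FC_mult[OF S(2) FC_star[OF S(3)]]]
          cyl_apply_mult[OF V S(2) FC_star[OF S(3)]] cyl_apply_star[OF V S(3)] by simp
      finally have L: "act V (\<lambda>\<mu>. pintegral \<mu> (\<lambda>x. H \<mu> x + u \<mu> * h x)) \<mu> =
          pintegral \<mu> (\<lambda>x. act V (\<lambda>\<nu>. H \<nu> x) \<mu>) + pintegral \<mu> (\<lambda>x. V \<mu> x (H \<mu>)) +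
          (act V u \<mu> * pintegral \<mu> h + u \<mu> * flux V h \<mu>)"
        using CF_step(4) by simp
      have "pintegral \<mu> (\<lambda>x. act V (\<lambda>\<nu>. H \<nu> x) \<mu> + act V u \<mu> * h x) =
          pintegral \<mu> (\<lambda>x. act V (\<lambda>\<nu>. H \<nu> x) \<mu>) + act V u \<mu> * pintegral \<mu> h"
        using pint_add[of "\<lambda>x. act V (\<lambda>\<nu>. H \<nu> x) \<mu>" "\<lambda>x. act V u \<mu> * h x" \<mu>]
          CF_smooth[of "\<lambda>\<mu> x. act V (\<lambda>\<nu>. H \<nu> x) \<mu>" \<mu>] CF_step(4) smooth_fun_cmult[OF S(3)]
        by (simp add: pint_cmult)
      moreover have "V \<mu> x (\<lambda>x. H \<mu> x + u \<mu> * h x) = V \<mu> x (H \<mu>) + u \<mu> * V \<mu> x h" for x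
        using tangentD(1)[OF vector_fieldD(1)[OF VV_at[OF V]] CF_smooth[OF S(1)] smooth_fun_cmult[OF S(3)]]
          tangentD(2)[OF vector_fieldD(1)[OF VV_at[OF V]] S(3)] by simp
      then have "pintegral \<mu> (\<lambda>x. V \<mu> x (\<lambda>x. H \<mu> x + u \<mu> * h x)) =
          pintegral \<mu> (\<lambda>x. V \<mu> x (H \<mu>)) + u \<mu> * flux V h \<mu>"
        using pint_add[OF VV_smooth[OF V CF_smooth[OF S(1)]] smooth_fun_cmult[OF VV_smooth[OF V S(3)]]]
        by (simp add: pint_cmult)
      ultimately show ?thesis using L by simp
    qed
    ultimately show ?case unfolding 1 by blast
  qed
  then show "act V (\<lambda>\<mu>. pintegral \<mu> (H \<mu>)) \<mu> =
      pintegral \<mu> (\<lambda>x. act V (\<lambda>\<nu>. H \<nu> x) \<mu>) + pintegral \<mu> (\<lambda>x. V \<mu> x (H \<mu>))"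
    "(\<lambda>\<mu> x. act V (\<lambda>\<nu>. H \<nu> x) \<mu>) \<in> CF" by blast+
qed

lemma cyl_apply_multc: "V \<in> VV \<Longrightarrow> u \<in> FC \<Longrightarrow> act V (\<lambda>\<nu>. u \<nu> * c) \<mu> = act V u \<mu> * c"
  using cyl_apply_mult[OF _ _ FC_const] cyl_apply_const by simp

section \<open>The intrinsic connection\<close>

text \<open>The right side differentiates each value \<open>Z \<nu> x a\<close> as a function of the
  measure and mentions no representation of Z, so the description in the definition is
  unique.\<close>

lemma nabla_int_eq:
  assumes V: "V \<in> VV" and "Z \<in> VV"
  shows "nint V Z = (\<lambda>\<mu> x a. act V (\<lambda>\<nu>. Z \<nu> x a) \<mu>)"
  unfolding nabla_int_def
proof (rule the_equality)
  have rep: "tensor_sum m (\<lambda>i. act V (u i)) w = (\<lambda>\<mu> x a. act V (\<lambda>\<nu>. Z \<nu> x a) \<mu>)"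
    if "\<forall>i<m. u i \<in> FC \<and> w i \<in> XM" "Z = tensor_sum m u w" for m u w
  proof (intro ext)
    fix \<mu> x a
    have "act V (\<lambda>\<nu>. \<Sum>i<m. u i \<nu> * w i x a) \<mu> = (\<Sum>i<m. act V (\<lambda>\<nu>. u i \<nu> * w i x a) \<mu>)"
      by (rule cyl_apply_sum[OF V]) (use that(1) FC_mult FC_const in auto)
    also have "\<dots> = (\<Sum>i<m. act V (u i) \<mu> * w i x a)"
      by (rule sum.cong) (use that(1) cyl_apply_multc[OF V] in auto)
    finally show "tensor_sum m (\<lambda>i. act V (u i)) w \<mu> x a = act V (\<lambda>\<nu>. Z \<nu> x a) \<mu>"
      by (simp add: that(2) tensor_sum_def)
  qed
  obtain m u w where Z: "\<forall>i<m. u i \<in> FC \<and> w i \<in> XM" "Z = tensor_sum m u w"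
    using assms(2) unfolding cyl_vector_fields_def cyl_tensors_def by blast
  then show "\<exists>m u w. (\<forall>i<m. u i \<in> FC \<and> w i \<in> XM) \<and> Z = tensor_sum m u w \<and>
      (\<lambda>\<mu> x a. act V (\<lambda>\<nu>. Z \<nu> x a) \<mu>) = tensor_sum m (\<lambda>i. act V (u i)) w"
    using rep[OF Z] by metis
  fix Y assume "\<exists>m u w. (\<forall>i<m. u i \<in> FC \<and> w i \<in> XM) \<and> Z = tensor_sum m u w \<and>
      Y = tensor_sum m (\<lambda>i. act V (u i)) w"
  then show "Y = (\<lambda>\<mu> x a. act V (\<lambda>\<nu>. Z \<nu> x a) \<mu>)" using rep by metis
qed

lemma nabla_int_step:
  assumes V: "V \<in> VV" and Z: "Z \<in> VV" and u: "u \<in> FC" and e: "e \<in> XM"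
  shows "nint V (cadd Z (u \<otimes> e)) =
    cadd (nint V Z) (act V u \<otimes> e)"
  unfolding nabla_int_eq[OF V VV_step[OF Z u e]] nabla_int_eq[OF V Z]
  using cyl_apply_add[OF V VV_FC[OF Z] FC_mult[OF u FC_const]] cyl_apply_multc[OF V u]
  by (simp add: cadd_def vadd_def vscale_def)

lemma nabla_int_zero:
  assumes V: "V \<in> VV"
  shows "nint V czero = czero"
  unfolding nabla_int_eq[OF V VV_zero] using cyl_apply_const[OF V, of 0]
    by (simp add: czero_def vzero_def)

lemma nabla_int_in: "V \<in> VV \<Longrightarrow> Z \<in> VV \<Longrightarrow> nint V Z \<in> VV"
proof (rotate_tac, induction Z rule: VV_induct)
  case zero
  then show ?case by (simp add: nabla_int_zero VV_zero)
next
  case (step Z u e)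
  show ?case
    unfolding nabla_int_step[OF step.prems step.hyps]
    by (rule VV_step[OF step.IH[OF step.prems] cyl_apply_in[OF step.prems step.hyps(2)] step.hyps(3)])
qed

lemma nabla_int_add:
  assumes V: "V \<in> VV" and V': "V' \<in> VV" and Z: "Z \<in> VV"
  shows "nint (cadd V V') Z = cadd (nint V Z) (nint V' Z)"
    "nint Z (cadd V V') = cadd (nint Z V) (nint Z V')"
  unfolding nabla_int_eq[OF V Z] nabla_int_eq[OF V' Z] nabla_int_eq[OF VV_add[OF V V'] Z]
    nabla_int_eq[OF Z V] nabla_int_eq[OF Z V'] nabla_int_eq[OF Z VV_add[OF V V']]
  using cyl_apply_cadd[OF V V' VV_FC[OF Z]] cyl_apply_add[OF Z VV_FC[OF V] VV_FC[OF V']]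
  by (simp_all add: cadd_def vadd_def)

lemma nabla_int_scale:
  assumes V: "V \<in> VV" and Z: "Z \<in> VV" and v: "v \<in> FC"
  shows "nint (cscale v V) Z = cscale v (nint V Z)"
    "nint V (cscale v Z) = cadd (cscale v (nint V Z)) (cscale (act V v) Z)"
  unfolding nabla_int_eq[OF V Z] nabla_int_eq[OF VV_scale[OF v V] Z] nabla_int_eq[OF V VV_scale[OF v Z]]
  using cyl_apply_cscale[OF V v VV_FC[OF Z]] cyl_apply_mult[OF V v VV_FC[OF Z]]
  by (simp_all add: cscale_def vscale_def cadd_def vadd_def add.commute)

text \<open>Serves Lie brackets and connections alike. At a fixed measure a cylinder coefficient is
  a real number, so homogeneity over the reals suffices.\<close>

lemma bilinear_VV:
  assumes B: "\<And>w z. w \<in> XM \<Longrightarrow> z \<in> XM \<Longrightarrow> B w z \<in> XM"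
    and add: "\<And>w w' z. w \<in> XM \<Longrightarrow> w' \<in> XM \<Longrightarrow> z \<in> XM \<Longrightarrow> B (vadd w w') z = vadd (B w z) (B w' z)"
      "\<And>w w' z. w \<in> XM \<Longrightarrow> w' \<in> XM \<Longrightarrow> z \<in> XM \<Longrightarrow> B z (vadd w w') = vadd (B z w) (B z w')"
    and scale: "\<And>w z c. w \<in> XM \<Longrightarrow> z \<in> XM \<Longrightarrow> B (vscale (\<lambda>_. c) w) z = vscale (\<lambda>_. c) (B w z)"
      "\<And>w z c. w \<in> XM \<Longrightarrow> z \<in> XM \<Longrightarrow> B z (vscale (\<lambda>_. c) w) = vscale (\<lambda>_. c) (B z w)"
    and V: "V \<in> VV" and Z: "Z \<in> VV"
  shows "(\<lambda>\<mu>. B (V \<mu>) (Z \<mu>)) \<in> VV"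
proof -
  have z: "vzero = (vscale (\<lambda>_. 0) vzero :: 'm vfield)" by (simp add: vscale_def vzero_def)
  have z1: "B w vzero = vzero" "B vzero w = vzero" if "w \<in> XM" for w
    using scale(1)[OF vzero_in that, of 0] scale(2)[OF vzero_in that, of 0]
    by (simp_all add: z[symmetric] vscale_def vzero_def)
  have fixed: "(\<lambda>\<mu>. B w (Z \<mu>)) \<in> VV" if w: "w \<in> XM" for w
    using Z
  proof (induction Z rule: VV_induct)
    case zero
    then show ?case using VV_zero by (simp add: czero_def z1[OF w])
  next
    case (step Z u e)
    have "(\<lambda>\<mu>. B w (cadd Z (u \<otimes> e) \<mu>)) = cadd (\<lambda>\<mu>. B w (Z \<mu>)) (\<lambda>\<mu>. vscale (\<lambda>_. u \<mu>) (B w e))"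
      using w step.hyps VV_at by (simp add: cadd_def add scale vscale_in smooth_fun_const)
    then show ?case using VV_step[OF step.IH step.hyps(2) B[OF w step.hyps(3)]] by simp
  qed
  show ?thesis using V
  proof (induction V rule: VV_induct)
    case zero
    then show ?case using VV_zero VV_at[OF Z] by (simp add: czero_def z1)
  next
    case (step V u e)
    have "(\<lambda>\<mu>. B (cadd V (u \<otimes> e) \<mu>) (Z \<mu>)) = cadd (\<lambda>\<mu>. B (V \<mu>) (Z \<mu>)) (cscale u (\<lambda>\<mu>. B e (Z \<mu>)))"
      using VV_at[OF Z] step.hyps VV_at
        by (simp add: cadd_def cscale_def add scale vscale_in smooth_fun_const)
    then show ?case using VV_add[OF step.IH VV_scale[OF step.hyps(2) fixed[OF step.hyps(3)]]] by simp
  qed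
qed

section \<open>A cylinder field is determined by its action\<close>

text \<open>Gaussian elimination of one unknown. It supplies a nonconstant polynomial in f on which
  finitely many functionals vanish.\<close>

lemma homogeneous_system:
  fixes b :: "nat \<Rightarrow> 'i \<Rightarrow> real"
  assumes "finite J" "card J > m"
  shows "\<exists>c. (\<exists>j\<in>J. c j \<noteq> 0) \<and> (\<forall>i<m. (\<Sum>j\<in>J. c j * b i j) = 0)"
  using assms
proof (induction m arbitrary: b J)
  case 0
  then obtain j where "j \<in> J" by (auto simp: card_gt_0_iff)
  then show ?case by (intro exI[of _ "\<lambda>_. 1"]) auto
next
  case (Suc m)
  show ?case
  proof (cases "\<forall>j\<in>J. b m j = 0")
    case True
    obtain c where c: "\<exists>j\<in>J. c j \<noteq> 0" "\<forall>i<m. (\<Sum>j\<in>J. c j * b i j) = 0"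
      using Suc.IH[of J b] Suc.prems by auto
    then show ?thesis using True by (intro exI[of _ c]) (auto simp: less_Suc_eq)
  next
    case False
    then obtain k where k: "k \<in> J" "b m k \<noteq> 0" by blast
    have "card (J - {k}) > m" using Suc.prems k by simp
    then obtain c where c: "\<exists>j\<in>J - {k}. c j \<noteq> 0"
      "\<forall>i<m. (\<Sum>j\<in>J - {k}. c j * (b i j - b i k * b m j / b m k)) = 0"
      using Suc.IH[of "J - {k}" "\<lambda>i j. b i j - b i k * b m j / b m k"] Suc.prems k by auto
    \<comment> \<open>The value of the eliminated unknown that makes equation m hold.\<close>
    define s where "s = - (\<Sum>j\<in>J - {k}. c j * b m j) / b m k"
    have split: "(\<Sum>j\<in>J. (c(k := s)) j * b i j) = s * b i k + (\<Sum>j\<in>J - {k}. c j * b i j)" for i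
      using k Suc.prems(1) by (subst sum.remove[of J k]) (auto intro!: sum.cong)
    have "(\<Sum>j\<in>J. (c(k := s)) j * b i j) = 0" if "i < Suc m" for i
    proof (cases "i = m")
      case True
      then show ?thesis unfolding split using k(2) by (simp add: s_def)
    next
      case False
      then have "(\<Sum>j\<in>J - {k}. c j * (b i j - b i k * b m j / b m k)) = 0" using c(2) that by simp
      then have "(\<Sum>j\<in>J - {k}. c j * b i j) = (\<Sum>j\<in>J - {k}. c j * b m j) * b i k / b m k"
        by (simp add: right_diff_distrib sum_subtractf sum_distrib_left sum_divide_distrib mult_ac)
      then show ?thesis unfolding split by (simp add: s_def)
    qed
    then show ?thesis using c(1) by (intro exI[of _ "c(k := s)"]) auto
  qed
qed

lemma tangent_power:
  assumes v: "v \<in> TM x" and f: "f \<in> CM"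
  shows "(\<lambda>y. f y ^ j) \<in> CM \<and> v (\<lambda>y. f y ^ Suc j) = real (Suc j) * f x ^ j * v f"
proof (induction j)
  case 0
  then show ?case by (simp add: smooth_fun_const)
next
  case (Suc j)
  have s: "(\<lambda>y. f y ^ Suc j) \<in> CM" using smooth_fun_mult[OF f] Suc by simp
  have "v (\<lambda>y. f y * f y ^ Suc j) = v f * f x ^ Suc j + f x * v (\<lambda>y. f y ^ Suc j)"
    by (rule tangentD(3)[OF v f s])
  then show ?case using Suc s by (simp add: algebra_simps)
qed

text \<open>Derivations act on global functions, but their coordinate form involves only the values
  near p.\<close>

lemma tangent_locally_constant:
  assumes v: "v \<in> TM p" and f: "f \<in> CM" and "open N" "p \<in> N" "\<And>x. x \<in> N \<Longrightarrow> f x = c"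
  shows "v f = 0"
proof -
  obtain U \<phi> where U: "(U, \<phi>) \<in> atlas M" "p \<in> U" by (rule chart_cover)
  obtain a where a: "\<And>f. f \<in> CM \<Longrightarrow> v f = (\<Sum>i<n. a i * partial i (\<lambda>y. f (inv_into U \<phi> y)) (\<phi> p))"
    using tangent_coordinates[OF U v] by blast
  have "partial i (\<lambda>y. f (inv_into U \<phi> y)) (\<phi> p) = 0" if "i < n" for i
    by (rule partial_eqI, rule has_real_derivative_cong_eopen[OF chart_image_open[OF U(1) assms(3)] _ that, where F = "\<lambda>_. c"])
      (use U assms(4,5) chart_inv[OF U(1)] in auto)
  then show ?thesis using a[OF f] by simp
qed

lemma FC_tendsto_mix:
  assumes "u \<in> FC"
  shows "((\<lambda>t. u (mix t \<mu> x)) \<longlongrightarrow> u \<mu>) (at_right 0)"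
proof -
  obtain k F f where r: "rep u k F f" using assms by (auto simp: cyl_functions_def)
  show ?thesis
    using DERIV_continuous[OF rep_line_derivative(1)[OF r, of \<mu> x]] rep_line_derivative(2)[OF r, of \<mu> x]
    by (simp add: continuous_within)
qed

text \<open>For a fixed measure the field must agree with an operator of finite rank on smooth functions.
  A derivation of finite rank vanishes: some nonconstant polynomial \<open>p\<close> in \<open>f\<close> is mapped to 0, so
  \<open>f\<close> takes only roots of the derivative of \<open>p\<close> as values where the derivation does not kill it.\<close>

lemma cyl_field_zero:
  assumes D: "D \<in> VV" and zero: "\<And>f \<mu>. f \<in> CM \<Longrightarrow> flux D f \<mu> = 0"
  shows "D = czero"
proof (intro ext)
  fix \<mu> x0 f
  obtain m u w where uw: "\<And>i. i < m \<Longrightarrow> u i \<in> FC" "\<And>i. i < m \<Longrightarrow> w i \<in> XM" and Ds: "D = tensor_sum m u w"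
    using D unfolding cyl_vector_fields_def cyl_tensors_def by blast
  have T: "D \<mu> x \<in> TM x" for x by (rule vector_fieldD(1)[OF VV_at[OF D]])
  define \<beta> where "\<beta> i f = pintegral \<mu> (\<lambda>x. w i x f)" for i f
  have "\<forall>i x. \<exists>a. i < m \<longrightarrow> ((\<lambda>t. u i (mix t \<mu> x)) has_real_derivative a) (at_right 0)"
    using uw(1) rep_line_derivative(1) unfolding cyl_functions_def by blast
  then obtain \<alpha> where \<alpha>: "\<And>i x. i < m \<Longrightarrow> ((\<lambda>t. u i (mix t \<mu> x)) has_real_derivative \<alpha> i x) (at_right 0)" by metis
  have mix0: "u i (mix 0 \<mu> x) = u i \<mu>" if "i < m" for i x
    using uw(1)[OF that] rep_line_derivative(2) unfolding cyl_functions_def by blast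
  have rank: "D \<mu> x f = - (\<Sum>i<m. \<alpha> i x * \<beta> i f)" if f: "f \<in> CM" for x f
  proof -
    \<comment> \<open>The flux of D at the mixture, written out in t; the coefficients
      \<open>u i\<close> and the integrals of \<open>w i\<close> applied to f both move with
      t.\<close>
    define q where "q t = (\<Sum>i<m. u i (mix t \<mu> x) * (\<beta> i f + t * (w i x f - \<beta> i f)))" for t
    have q0: "q t = 0" if t: "0 \<le> t" "t \<le> 1" for t
    proof -
      have "pintegral (mix t \<mu> x) (\<lambda>y. D (mix t \<mu> x) y f) =
          (\<Sum>i<m. pintegral (mix t \<mu> x) (\<lambda>y. u i (mix t \<mu> x) * w i y f))"
        unfolding Ds tensor_sum_def
        by (rule pint_sum) (use vector_fieldD(2)[OF uw(2) f] smooth_fun_cmult in auto)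
      also have "\<dots> = q t"
        unfolding q_def \<beta>_def pint_cmult
        by (rule sum.cong) (simp_all add: pint_mix[OF t vector_fieldD(2)[OF uw(2) f]])
      finally show ?thesis using zero[OF f] by simp
    qed
    have "(q has_real_derivative (\<Sum>i<m. \<alpha> i x * (\<beta> i f + 0 * (w i x f - \<beta> i f)) +
        (w i x f - \<beta> i f) * u i (mix 0 \<mu> x))) (at_right 0)"
      unfolding q_def
      by (intro DERIV_sum DERIV_mult \<alpha>) (auto intro!: derivative_eq_intros)
    then have "((\<lambda>t. (q t - q 0) / (t - 0)) \<longlongrightarrow> (\<Sum>i<m. \<alpha> i x * \<beta> i f + (w i x f - \<beta> i f) * u i (mix 0 \<mu> x))) (at_right 0)"
      unfolding has_field_derivative_iff by simp
    moreover have "((\<lambda>t. (q t - q 0) / (t - 0)) \<longlongrightarrow> 0) (at_right 0)"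
      by (rule Lim_transform_eventually[OF tendsto_const], rule eventually_at_rightI[of 0 1]) (auto simp: q0)
    ultimately have "(\<Sum>i<m. \<alpha> i x * \<beta> i f + (w i x f - \<beta> i f) * u i (mix 0 \<mu> x)) = 0"
      by (intro tendsto_unique[of "at_right (0::real)"]) simp_all
    moreover have "(\<Sum>i<m. \<alpha> i x * \<beta> i f + (w i x f - \<beta> i f) * u i (mix 0 \<mu> x)) =
        (\<Sum>i<m. \<alpha> i x * \<beta> i f) + D \<mu> x f - q 0"
      unfolding q_def Ds tensor_sum_def sum.distrib[symmetric] sum_subtractf[symmetric]
      by (rule sum.cong) (simp_all add: mix0 algebra_simps)
    ultimately show ?thesis using q0[of 0] by simp
  qed
  have "D \<mu> x0 f = 0" if f: "f \<in> CM"
  proof (rule ccontr)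
    assume nz: "D \<mu> x0 f \<noteq> 0"
    have pw: "(\<lambda>y. f y ^ j) \<in> CM" for j using tangent_power[OF T f] by blast
    \<comment> \<open>There are m + 1 powers against m functionals. The exponents
      \<open>Suc j\<close> leave out the constant term, so a nontrivial combination is a nonconstant
      polynomial.\<close>
    obtain c where c: "\<exists>j\<in>{..m}. c j \<noteq> 0" "\<forall>i<m. (\<Sum>j\<in>{..m}. c j * \<beta> i (\<lambda>y. f y ^ Suc j)) = 0"
      using homogeneous_system[of "{..m}" m "\<lambda>i j. \<beta> i (\<lambda>y. f y ^ Suc j)"] by auto
    define P where "P y = (\<Sum>j\<le>m. c j * f y ^ Suc j)" for y
    have P: "P \<in> CM" unfolding P_def by (intro smooth_fun_sum smooth_fun_cmult pw)
    have lin: "v P = (\<Sum>j\<le>m. c j * v (\<lambda>y. f y ^ Suc j))" if "v \<in> TM x" for v x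
      unfolding P_def using tangent_sum[OF that, of "{..m}" "\<lambda>j y. c j * f y ^ Suc j"]
        tangentD(2)[OF that pw] smooth_fun_cmult[OF pw] by (simp del: power_Suc)
    have "\<beta> i P = 0" if "i < m" for i
    proof -
      have "\<beta> i P = pintegral \<mu> (\<lambda>x. \<Sum>j\<le>m. c j * w i x (\<lambda>y. f y ^ Suc j))"
        unfolding \<beta>_def using lin[OF vector_fieldD(1)[OF uw(2)[OF that]]] by simp
      also have "\<dots> = (\<Sum>j\<le>m. c j * \<beta> i (\<lambda>y. f y ^ Suc j))"
        unfolding \<beta>_def pint_cmult[symmetric]
        by (rule pint_sum) (intro smooth_fun_cmult vector_fieldD(2)[OF uw(2)[OF that] pw])
      finally show ?thesis using c(2) that by simp
    qed
    then have DP: "D \<mu> x P = 0" for x using rank[OF P] by simp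
    have root: "(\<Sum>j\<le>m. c j * real (Suc j) * f x ^ j) = 0" if "D \<mu> x f \<noteq> 0" for x
    proof -
      have "(\<Sum>j\<le>m. c j * real (Suc j) * f x ^ j) * D \<mu> x f = (\<Sum>j\<le>m. c j * D \<mu> x (\<lambda>y. f y ^ Suc j))"
        unfolding sum_distrib_right
        by (rule sum.cong) (simp_all only: tangent_power[OF T f, THEN conjunct2] mult.assoc)
      also have "\<dots> = 0" unfolding lin[OF T, symmetric] by (rule DP)
      finally show ?thesis using that by (metis mult_eq_0_iff)
    qed
    \<comment> \<open>Zeros of the derivative of that polynomial, whose coefficients
      \<open>c j * real (Suc j)\<close> are not all 0.\<close>
    define R where "R = {r. (\<Sum>j\<le>m. c j * real (Suc j) * r ^ j) = 0}"
    have "finite R"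
      unfolding R_def using c(1) by (subst polyfun_finite_roots) auto
    then obtain d where d: "d > 0" "\<And>r. r \<in> R \<Longrightarrow> r \<noteq> f x0 \<Longrightarrow> d \<le> dist (f x0) r"
      using finite_set_avoid[of R "f x0"] by blast
    \<comment> \<open>On N every value of f is a root and closer to \<open>f x0\<close> than any
      other root, so f is constant on this open set.\<close>
    define N where "N = {x. D \<mu> x f \<noteq> 0} \<inter> {x. \<bar>f x - f x0\<bar> < d}"
    have "open N" unfolding N_def
      by (intro open_Int open_Collect_neq open_Collect_less continuous_intros smooth_fun_continuous VV_smooth[OF D] f)
    moreover have "f x = f x0" if x: "x \<in> N" for x
    proof (rule ccontr)
      assume "f x \<noteq> f x0"
      moreover have "f x \<in> R" unfolding R_def mem_Collect_eq by (rule root) (use x in \<open>simp add: N_def\<close>)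
      ultimately have "d \<le> dist (f x0) (f x)" by (intro d(2))
      then show False using x by (simp add: N_def dist_real_def abs_minus_commute)
    qed
    moreover have "x0 \<in> N" using nz d(1) by (simp add: N_def)
    ultimately have "D \<mu> x0 f = 0" by (intro tangent_locally_constant[OF T f])
    then show False using nz by simp
  qed
  then show "D \<mu> x0 f = czero \<mu> x0 f"
    using tangentD(4)[OF T] by (auto simp: czero_def vzero_def)
qed

text \<open>Testing on the functions \<mu> \<mapsto> \<integral> f d\<mu> is enough: on them the
  action is the flux, to which \<open>cyl_field_zero\<close> applies.\<close>

lemma cyl_field_eqI:
  assumes "Y \<in> VV" "Y' \<in> VV" "\<And>u. u \<in> FC \<Longrightarrow> act Y u = act Y' u"
  shows "Y = Y'"
proof -
  have "cdiff Y Y' = czero"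
  proof (rule cyl_field_zero[OF VV_diff[OF assms(1,2)]])
    fix f \<mu> assume f: "f \<in> CM"
    have "flux Y f \<mu> = flux Y' f \<mu>"
      using assms(3)[OF FC_star[OF f]] cyl_apply_star[OF assms(1) f] cyl_apply_star[OF assms(2) f] by metis
    moreover have "pintegral \<mu> (\<lambda>x. Y \<mu> x f + -1 * Y' \<mu> x f) = flux Y f \<mu> + -1 * flux Y' f \<mu>"
      using pint_add[OF VV_smooth[OF assms(1) f] smooth_fun_cmult[OF VV_smooth[OF assms(2) f]]]
      by (simp only: pint_cmult)
    ultimately show "pintegral \<mu> (\<lambda>x. cdiff Y Y' \<mu> x f) = 0"
      by (simp add: cdiff_def vdiff_def)
  qed
  then have "cdiff Y Y' \<mu> x f = 0" for \<mu> x f by (simp add: czero_def vzero_def)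
  then show ?thesis by (simp add: cdiff_def vdiff_def fun_eq_iff)
qed

section \<open>The bracket of cylinder vector fields\<close>

lemma lie_VV:
  assumes "V \<in> VV" "Z \<in> VV"
  shows "(\<lambda>\<mu>. lie_bracket (V \<mu>) (Z \<mu>)) \<in> VV"
proof (rule bilinear_VV[where B = lie_bracket, OF _ _ _ _ _ assms])
  show "lie_bracket (vscale (\<lambda>_. c) w) z = vscale (\<lambda>_. c) (lie_bracket w z)"
    "lie_bracket z (vscale (\<lambda>_. c) w) = vscale (\<lambda>_. c) (lie_bracket z w)" if "w \<in> XM" "z \<in> XM" for w z c
    using lie_scale[OF that(2,1) smooth_fun_const, of c] tangent_const[OF vector_fieldD(1)[OF that(2)]]
    by (simp_all add: vadd_def vscale_def vapply_def)
qed (simp_all add: lie_bracket_in lie_add)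

text \<open>The double sum comes from differentiating the partials of F and is a Hessian term. The
  rest comes from differentiating the flux of Z, through its integrand and through the
  measure.\<close>

lemma cyl_apply_twice:
  assumes V: "V \<in> VV" and Z: "Z \<in> VV" and r: "rep u k F f"
  shows "act V (act Z u) \<mu> =
    (\<Sum>a<k. \<Sum>b<k. pd k (partial a F) f b \<mu> * flux V (f b) \<mu> * flux Z (f a) \<mu>) +
    (\<Sum>a<k. pd k F f a \<mu> *
      (flux (nint V Z) (f a) \<mu> + pintegral \<mu> (\<lambda>x. V \<mu> x (\<lambda>x. Z \<mu> x (f a)))))"
proof -
  note f = cyl_repD(2)[OF r]
  have FZ: "(\<lambda>\<mu>. flux Z (f a) \<mu>) \<in> FC" if "a < k" for a
    by (rule CF_pint[OF VV_CF[OF Z f[OF that]]])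
  have FF: "(\<lambda>\<mu>. pd k F f a \<mu>) \<in> FC" if "a < k" for a
    by (rule FC_I[OF cyl_rep_partial[OF r that]])
  have step: "act V (\<lambda>\<mu>. pd k F f a \<mu> * flux Z (f a) \<mu>) \<mu> =
    (\<Sum>b<k. pd k (partial a F) f b \<mu> * flux V (f b) \<mu> * flux Z (f a) \<mu>) +
  pd k F f a \<mu> *
    (flux (nint V Z) (f a) \<mu> + pintegral \<mu> (\<lambda>x. V \<mu> x (\<lambda>x. Z \<mu> x (f a))))"
    if a: "a < k" for a
    unfolding cyl_apply_mult[OF V FF[OF a] FZ[OF a]] cyl_apply_rep[OF V cyl_rep_partial[OF r a]]
        cyl_apply_pint(1)[OF V VV_CF[OF Z f[OF a]]] nabla_int_eq[OF V Z] sum_distrib_right ..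
  have "act Z u = (\<lambda>\<mu>. \<Sum>a<k. pd k F f a \<mu> * flux Z (f a) \<mu>)"
    by (rule ext) (rule cyl_apply_rep[OF Z r])
  then have "act V (act Z u) \<mu> =
      (\<Sum>a<k. act V (\<lambda>\<mu>. pd k F f a \<mu> * flux Z (f a) \<mu>) \<mu>)"
    using cyl_apply_sum[OF V, of "{..<k}" "\<lambda>a \<mu>. pd k F f a \<mu> * flux Z (f a) \<mu>"]
      FC_mult[OF FF FZ] by simp
  then show ?thesis by (simp add: step sum.distrib)
qed

lemma cyl_bracket_eq:
  assumes V: "V \<in> VV" and Z: "Z \<in> VV"
  shows "cyl_bracket M V Z = cadd (cdiff (nint V Z) (nint Z V)) (\<lambda>\<mu>. lie_bracket (V \<mu>) (Z \<mu>))" (is "_ = ?Y")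
  unfolding cyl_bracket_def
proof (rule the_equality)
  note N = nabla_int_in[OF V Z] nabla_int_in[OF Z V]
  have Y: "?Y \<in> VV" by (intro VV_add VV_diff N lie_VV V Z)
  have act: "act ?Y u = (\<lambda>\<mu>. act V (act Z u) \<mu> - act Z (act V u) \<mu>)"
    if "u \<in> FC" for u
  proof
    fix \<mu>
    obtain k F f where r: "rep u k F f" using \<open>u \<in> FC\<close> by (auto simp: cyl_functions_def)
    note f = cyl_repD(2)[OF r]
    define \<eta> where "\<eta> a = flux V (f a) \<mu>" for a
    define \<zeta> where "\<zeta> a = flux Z (f a) \<mu>" for a
    have C2: "C_on 2 k (Ek k) F" using cyl_repD(1)[OF r] unfolding smooth_on_def by blast
    \<comment> \<open>Exchanging V and Z transposes the Hessian, so this term drops out of the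
      commutator.\<close>
    have "(\<Sum>a<k. \<Sum>b<k. pd k (partial a F) f b \<mu> * \<eta> b * \<zeta> a) =
        (\<Sum>b<k. \<Sum>a<k. pd k (partial a F) f b \<mu> * \<eta> b * \<zeta> a)"
      by (rule sum.swap)
    also have "\<dots> = (\<Sum>b<k. \<Sum>a<k. pd k (partial b F) f a \<mu> * \<zeta> a * \<eta> b)"
      by (intro sum.cong refl) (simp add: partial_commute[OF eopen_Ek C2 star_point_in])
    finally have sym: "(\<Sum>a<k. \<Sum>b<k. pd k (partial a F) f b \<mu> * \<eta> b * \<zeta> a) =
        (\<Sum>a<k. \<Sum>b<k. pd k (partial a F) f b \<mu> * \<zeta> b * \<eta> a)" .
    have int: "flux ?Y (f a) \<mu> =
        flux (nint V Z) (f a) \<mu> - flux (nint Z V) (f a) \<mu> +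
        (pintegral \<mu> (\<lambda>x. V \<mu> x (\<lambda>x. Z \<mu> x (f a))) - pintegral \<mu> (\<lambda>x. Z \<mu> x (\<lambda>x. V \<mu> x (f a))))" if "a < k" for a
    proof -
      have i: "integrable (measure_of_prob \<mu>) (\<lambda>x. nint V Z \<mu> x (f a))"
        "integrable (measure_of_prob \<mu>) (\<lambda>x. nint Z V \<mu> x (f a))"
        "integrable (measure_of_prob \<mu>) (\<lambda>x. V \<mu> x (\<lambda>x. Z \<mu> x (f a)))"
        "integrable (measure_of_prob \<mu>) (\<lambda>x. Z \<mu> x (\<lambda>x. V \<mu> x (f a)))"
        using f[OF that] by (simp_all add: smooth_fun_integrable VV_smooth V Z N)
      then show ?thesis
        by (simp add: pintegral_def cadd_def cdiff_def vadd_def vdiff_def lie_bracket_def vapply_def)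
    qed
    have "act ?Y u \<mu> = (\<Sum>a<k. pd k F f a \<mu> * flux ?Y (f a) \<mu>)"
      by (rule cyl_apply_rep[OF Y r])
    also have "\<dots> = (\<Sum>a<k. pd k F f a \<mu> *
        (flux (nint V Z) (f a) \<mu> + pintegral \<mu> (\<lambda>x. V \<mu> x (\<lambda>x. Z \<mu> x (f a))))) -
        (\<Sum>a<k. pd k F f a \<mu> *
        (flux (nint Z V) (f a) \<mu> + pintegral \<mu> (\<lambda>x. Z \<mu> x (\<lambda>x. V \<mu> x (f a)))))"
      unfolding sum_subtractf[symmetric] by (rule sum.cong) (simp_all add: int algebra_simps)
    also have "\<dots> = act V (act Z u) \<mu> - act Z (act V u) \<mu>"
      unfolding cyl_apply_twice[OF V Z r] cyl_apply_twice[OF Z V r]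
      using sym by (simp add: \<eta>_def \<zeta>_def)
    finally show "act ?Y u \<mu> = act V (act Z u) \<mu> - act Z (act V u) \<mu>" .
  qed
  show "?Y \<in> VV \<and> (\<forall>u\<in>FC. act ?Y u =
        (\<lambda>\<mu>. act V (act Z u) \<mu> - act Z (act V u) \<mu>))"
    using Y act by blast
  fix Y' assume "Y' \<in> VV \<and> (\<forall>u\<in>FC. act Y' u =
        (\<lambda>\<mu>. act V (act Z u) \<mu> - act Z (act V u) \<mu>))"
  then show "Y' = ?Y" using act Y by (intro cyl_field_eqI) auto
qed

section \<open>Lifted connections\<close>

lemma pullback_in:
  assumes N: "affine_connection M nabla" and "V \<in> VV" "Z \<in> VV"
  shows "connection_pullback nabla Z V \<in> VV"
  unfolding connection_pullback_def
  by (rule bilinear_VV[where B = nabla, OF affineD(1-3)[OF N] affineD(4)[OF N] affineD(5)[OF N] assms(2,3)])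

lemma lifted_eq:
  "V \<in> VV \<Longrightarrow> Z \<in> VV \<Longrightarrow> lifted nabla V Z = cadd (nint V Z) (connection_pullback nabla Z V)"
  by (simp add: lifted_connection_def)

lemma lifted_in:
  "affine_connection M nabla \<Longrightarrow> V \<in> VV \<Longrightarrow> Z \<in> VV \<Longrightarrow> lifted nabla V Z \<in> VV"
  by (simp add: lifted_eq VV_add nabla_int_in pullback_in)

text \<open>At each measure v is a real number, so the pullback is linear over cylinder functions in
  both arguments; the Leibniz term comes from the intrinsic part alone.\<close>

lemma lifted_scale:
  assumes N: "affine_connection M nabla" and V: "V \<in> VV" and Z: "Z \<in> VV" and v: "v \<in> FC"
  shows "lifted nabla (cscale v V) Z = cscale v (lifted nabla V Z)"
    "lifted nabla V (cscale v Z) =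
      cadd (cscale v (lifted nabla V Z)) (cscale (act V v) Z)"
  unfolding lifted_eq[OF V Z] lifted_eq[OF VV_scale[OF v V] Z] lifted_eq[OF V VV_scale[OF v Z]]
    nabla_int_scale[OF V Z v] connection_pullback_def
  by (simp_all add: cscale_def cadd_def affineD(4,5)[OF N VV_at[OF V] VV_at[OF Z]])
    (simp_all add: vadd_def vscale_def algebra_simps)

lemma lifted_affine:
  assumes N: "affine_connection M nabla"
  shows "cyl_affine_connection M (lifted nabla)"
  unfolding cyl_affine_connection_def
proof (intro conjI ballI allI impI)
  fix V V' Z assume V: "V \<in> VV" and V': "V' \<in> VV" and Z: "Z \<in> VV"
  note A = affineD(2,3)[OF N VV_at[OF V] VV_at[OF V'] VV_at[OF Z]]
  show "lifted nabla (cadd V V') Z = cadd (lifted nabla V Z) (lifted nabla V' Z)"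
    "lifted nabla Z (cadd V V') = cadd (lifted nabla Z V) (lifted nabla Z V')"
    unfolding lifted_eq[OF VV_add[OF V V'] Z] lifted_eq[OF V Z] lifted_eq[OF V' Z]
      lifted_eq[OF Z VV_add[OF V V']] lifted_eq[OF Z V] lifted_eq[OF Z V'] nabla_int_add[OF V V' Z]
      connection_pullback_def
    by (simp_all add: cadd_def A) (simp_all add: vadd_def algebra_simps)
next
  fix V Z c assume V: "V \<in> VV" and Z: "Z \<in> VV"
  \<comment> \<open>Real homogeneity is the case of a constant cylinder function, whose derivative
    along V is 0.\<close>
  have "act V (\<lambda>_. c) = (\<lambda>_. 0)" using cyl_apply_const[OF V] by auto
  then show "lifted nabla (cscale (\<lambda>_. c) V) Z = cscale (\<lambda>_. c) (lifted nabla V Z)"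
    "lifted nabla V (cscale (\<lambda>_. c) Z) = cscale (\<lambda>_. c) (lifted nabla V Z)"
    using lifted_scale[OF N V Z FC_const, of c]
      by (simp_all add: cadd_def cscale_def vadd_def vscale_def)
qed (simp_all add: lifted_in[OF N] lifted_scale[OF N], auto simp: lifted_connection_def)

lemma lifted_torsion_free_iff:
  assumes N: "affine_connection M nabla"
  shows "cyl_torsion_free M (lifted nabla) \<longleftrightarrow> torsion_free M nabla"
proof -
  have eq: "cdiff (lifted nabla V Z) (lifted nabla Z V) = cyl_bracket M V Z \<longleftrightarrow>
      (\<forall>\<mu>. vdiff (nabla (V \<mu>) (Z \<mu>)) (nabla (Z \<mu>) (V \<mu>)) = lie_bracket (V \<mu>) (Z \<mu>))"
    if V: "V \<in> VV" and Z: "Z \<in> VV" for V Z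
    unfolding lifted_eq[OF V Z] lifted_eq[OF Z V] cyl_bracket_eq[OF V Z]
    by (simp add: cdiff_def cadd_def vdiff_def vadd_def connection_pullback_def fun_eq_iff algebra_simps)
  show ?thesis
  proof
    assume L: "cyl_torsion_free M (lifted nabla)"
    show "torsion_free M nabla"
      unfolding torsion_free_def
    proof (intro ballI)
      fix w z assume w: "w \<in> XM" and z: "z \<in> XM"
      show "vdiff (nabla w z) (nabla z w) = lie_bracket w z"
        using L eq[OF VV_const[OF w] VV_const[OF z]] VV_const[OF w] VV_const[OF z]
        unfolding cyl_torsion_free_def by blast
    qed
  next
    assume "torsion_free M nabla"
    then show "cyl_torsion_free M (lifted nabla)"
      unfolding cyl_torsion_free_def torsion_free_def using eq VV_at by simp
  qed
qed

end

context riem_mfd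
begin

section \<open>The metric on measures and uniqueness\<close>

lemma gg_zero: "w \<in> XM \<Longrightarrow> gg w vzero x = 0" "w \<in> XM \<Longrightarrow> gg vzero w x = 0"
  using g_zero vector_fieldD(1) by (simp_all add: gg_def vzero_def)

lemma gg_step:
  assumes "w \<in> XM" "z \<in> XM" "e \<in> XM"
  shows "gg w (vadd z (vscale (\<lambda>_. c) e)) x = gg w z x + c * gg w e x"
    "gg (vadd z (vscale (\<lambda>_. c) e)) w x = gg z w x + c * gg e w x"
  using assms vscale_in[OF smooth_fun_const assms(3), of c] by (simp_all add: gg_add gg_scale)

text \<open>One argument is frozen as a field on the manifold, so that each induction moves a single
  argument.\<close>

lemma gg_CF_fixed:
  assumes w: "w \<in> XM" and "Z \<in> VV"
  shows "(\<lambda>\<mu> x. gg w (Z \<mu>) x) \<in> CF"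
  using assms(2)
proof (induction Z rule: VV_induct)
  case zero
  then show ?case using CF_zero by (simp add: czero_def gg_zero[OF w])
next
  case (step Z u e)
  have "(\<lambda>\<mu> x. gg w (cadd Z (u \<otimes> e) \<mu>) x) = (\<lambda>\<mu> x. gg w (Z \<mu>) x + u \<mu> * gg w e x)"
    using gg_step(1)[OF w VV_at[OF step.hyps(1)] step.hyps(3)] by (simp add: cadd_def)
  then show ?case using CF_step[OF step.IH step.hyps(2) gg_in[OF w step.hyps(3)]] by simp
qed

lemma gg_CF:
  assumes "V \<in> VV" and Z: "Z \<in> VV"
  shows "(\<lambda>\<mu> x. gg (V \<mu>) (Z \<mu>) x) \<in> CF"
  using assms(1)
proof (induction V rule: VV_induct)
  case zero
  then show ?case using CF_zero by (simp add: czero_def gg_zero(2)[OF VV_at[OF Z]])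
next
  case (step V u e)
  have "(\<lambda>\<mu> x. gg (cadd V (u \<otimes> e) \<mu>) (Z \<mu>) x) = (\<lambda>\<mu> x. gg (V \<mu>) (Z \<mu>) x + u \<mu> * gg e (Z \<mu>) x)"
    using gg_step(2)[OF VV_at[OF Z] VV_at[OF step.hyps(1)] step.hyps(3)] by (simp add: cadd_def)
  then show ?case using CF_add[OF step.IH CF_scale[OF step.hyps(2) gg_CF_fixed[OF step.hyps(3) Z]]] by simp
qed

lemma cyl_apply_gg_fixed:
  assumes V: "V \<in> VV" and w: "w \<in> XM" and "Z \<in> VV"
  shows "act V (\<lambda>\<nu>. gg w (Z \<nu>) x) \<mu> = gg w (nint V Z \<mu>) x"
  using assms(3)
proof (induction Z rule: VV_induct)
  case zero
  then show ?case using cyl_apply_const[OF V]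
    by (simp add: nabla_int_zero[OF V]) (simp add: czero_def gg_zero[OF w])
next
  case (step Z u e)
  have "act V (\<lambda>\<nu>. gg w (cadd Z (u \<otimes> e) \<nu>) x) \<mu> =
      act V (\<lambda>\<nu>. gg w (Z \<nu>) x + u \<nu> * gg w e x) \<mu>"
    using gg_step(1)[OF w VV_at[OF step.hyps(1)] step.hyps(3)] by (simp add: cadd_def)
  also have "\<dots> = gg w (nint V Z \<mu>) x + act V u \<mu> * gg w e x"
    using cyl_apply_add[OF V CF_FC[OF gg_CF_fixed[OF w step.hyps(1)]] FC_mult[OF step.hyps(2) FC_const]]
      cyl_apply_multc[OF V step.hyps(2)] step.IH by simp
  also have "\<dots> = gg w (nint V (cadd Z (u \<otimes> e)) \<mu>) x"
    unfolding nabla_int_step[OF V step.hyps] unfolding cadd_def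
    by (rule gg_step(1)[OF w VV_at[OF nabla_int_in[OF V step.hyps(1)]] step.hyps(3), symmetric])
  finally show ?case .
qed

text \<open>The metric at a fixed x does not depend on the measure, so the intrinsic connection is
  already metric pointwise, before integration.\<close>

lemma cyl_apply_gg:
  assumes V: "V \<in> VV" and "W \<in> VV" and Z: "Z \<in> VV"
  shows "act V (\<lambda>\<nu>. gg (W \<nu>) (Z \<nu>) x) \<mu> = gg (nint V W \<mu>) (Z \<mu>) x + gg (W \<mu>) (nint V Z \<mu>) x"
  using assms(2)
proof (induction W rule: VV_induct)
  case zero
  have n: "nint V Z \<mu> \<in> XM" by (rule VV_at[OF nabla_int_in[OF V Z]])
  show ?case using cyl_apply_const[OF V]
    by (simp add: nabla_int_zero[OF V]) (simp add: czero_def gg_zero(2)[OF VV_at[OF Z]] gg_zero(2)[OF n])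
next
  case (step W u e)
  note e = step.hyps(3)
  have F: "(\<lambda>\<nu>. gg e (Z \<nu>) x) \<in> FC" by (rule CF_FC[OF gg_CF_fixed[OF e Z]])
  have "act V (\<lambda>\<nu>. gg (cadd W (u \<otimes> e) \<nu>) (Z \<nu>) x) \<mu> =
      act V (\<lambda>\<nu>. gg (W \<nu>) (Z \<nu>) x + u \<nu> * gg e (Z \<nu>) x) \<mu>"
    using gg_step(2)[OF VV_at[OF Z] VV_at[OF step.hyps(1)] e] by (simp add: cadd_def)
  also have "\<dots> = gg (nint V W \<mu>) (Z \<mu>) x + gg (W \<mu>) (nint V Z \<mu>) x +
      (act V u \<mu> * gg e (Z \<mu>) x + u \<mu> * gg e (nint V Z \<mu>) x)"
    using cyl_apply_add[OF V CF_FC[OF gg_CF[OF step.hyps(1) Z]] FC_mult[OF step.hyps(2) F]]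
      cyl_apply_mult[OF V step.hyps(2) F] cyl_apply_gg_fixed[OF V e Z] step.IH by simp
  also have "\<dots> = gg (nint V (cadd W (u \<otimes> e)) \<mu>) (Z \<mu>) x +
      gg (cadd W (u \<otimes> e) \<mu>) (nint V Z \<mu>) x"
    unfolding nabla_int_step[OF V step.hyps] unfolding cadd_def
      gg_step(2)[OF VV_at[OF Z] VV_at[OF nabla_int_in[OF V step.hyps(1)]] e]
      gg_step(2)[OF VV_at[OF nabla_int_in[OF V Z]] VV_at[OF step.hyps(1)] e]
    by simp
  finally show ?case .
qed

lemma G_der_eq: "G_der g V Z = (\<lambda>\<mu>. pintegral \<mu> (gg (V \<mu>) (Z \<mu>)))"
  by (simp add: G_der_def gg_def)

text \<open>The last term comes from the moving measure; it is what the pullback of a metric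
  connection has to balance.\<close>

lemma cyl_apply_G_der:
  assumes V: "V \<in> VV" and W: "W \<in> VV" and Z: "Z \<in> VV"
  shows "act V (G_der g W Z) \<mu> =
    G_der g (nint V W) Z \<mu> + G_der g W (nint V Z) \<mu> + pintegral \<mu> (\<lambda>x. V \<mu> x (gg (W \<mu>) (Z \<mu>)))"
proof -
  note N = nabla_int_in[OF V W] nabla_int_in[OF V Z]
  have "pintegral \<mu> (\<lambda>x. gg (nint V W \<mu>) (Z \<mu>) x + gg (W \<mu>) (nint V Z \<mu>) x) =
      pintegral \<mu> (gg (nint V W \<mu>) (Z \<mu>)) + pintegral \<mu> (gg (W \<mu>) (nint V Z \<mu>))"
    by (rule pint_add) (intro gg_in VV_at N W Z)+
  then show ?thesis
    unfolding G_der_eq cyl_apply_pint(1)[OF V gg_CF[OF W Z]] cyl_apply_gg[OF V W Z] by simp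
qed

lemma G_der_add:
  assumes "V \<in> VV" "V' \<in> VV" "Z \<in> VV"
  shows "G_der g (cadd V V') Z \<mu> = G_der g V Z \<mu> + G_der g V' Z \<mu>"
    "G_der g Z (cadd V V') \<mu> = G_der g Z V \<mu> + G_der g Z V' \<mu>"
  unfolding G_der_eq cadd_def gg_add[OF VV_at[OF assms(1)] VV_at[OF assms(2)] VV_at[OF assms(3)]]
  by (rule pint_add; intro gg_in VV_at assms)+

lemma G_der_sym: "V \<in> VV \<Longrightarrow> Z \<in> VV \<Longrightarrow> G_der g V Z = G_der g Z V"
  unfolding G_der_eq using gg_sym[OF VV_at VV_at, of V Z] by simp

lemma lifted_metric_iff:
  assumes N: "affine_connection M nabla"
  shows "cyl_metric_compatible M g (lifted nabla) \<longleftrightarrow> metric_compatible M g nabla"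
proof -
  have eq: "act V (G_der g W Z) \<mu> =
      G_der g (lifted nabla V W) Z \<mu> + G_der g W (lifted nabla V Z) \<mu> \<longleftrightarrow>
      pintegral \<mu> (\<lambda>x. V \<mu> x (gg (W \<mu>) (Z \<mu>))) =
      pintegral \<mu> (gg (nabla (V \<mu>) (W \<mu>)) (Z \<mu>)) + pintegral \<mu> (gg (W \<mu>) (nabla (V \<mu>) (Z \<mu>)))"
    if V: "V \<in> VV" and W: "W \<in> VV" and Z: "Z \<in> VV" for V W Z \<mu>
    unfolding lifted_eq[OF V W] lifted_eq[OF V Z] cyl_apply_G_der[OF V W Z]
      G_der_add(1)[OF nabla_int_in[OF V W] pullback_in[OF N V W] Z]
      G_der_add(2)[OF nabla_int_in[OF V Z] pullback_in[OF N V Z] W]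
    by (auto simp: G_der_eq connection_pullback_def)
  show ?thesis
  proof
    assume L: "cyl_metric_compatible M g (lifted nabla)"
    show "metric_compatible M g nabla"
      unfolding metric_compatible_def
    proof (intro ballI ext)
      fix w1 w2 w3 x assume w: "w1 \<in> XM" "w2 \<in> XM" "w3 \<in> XM"
      note c = VV_const[OF w(1)] VV_const[OF w(2)] VV_const[OF w(3)]
      have "pintegral (dirac x) (\<lambda>x. w1 x (gg w2 w3)) =
        pintegral (dirac x) (gg (nabla w1 w2) w3) + pintegral (dirac x) (gg w2 (nabla w1 w3))"
        using L eq[OF c, of "dirac x"] c unfolding cyl_metric_compatible_def by (simp add: fun_eq_iff)
      then have "w1 x (gg w2 w3) = gg (nabla w1 w2) w3 x + gg w2 (nabla w1 w3) x"
        using vector_fieldD(2)[OF w(1) gg_in[OF w(2,3)]] gg_in affineD(1)[OF N] w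
          by (simp add: pint_dirac)
      then show "vapply w1 (\<lambda>x. g x (w2 x) (w3 x)) x = g x (nabla w1 w2 x) (w3 x) + g x (w2 x) (nabla w1 w3 x)"
        by (simp add: vapply_def gg_def)
    qed
  next
    assume L: "metric_compatible M g nabla"
    show "cyl_metric_compatible M g (lifted nabla)"
      unfolding cyl_metric_compatible_def
    proof (intro ballI ext)
      fix V W Z \<mu> assume V: "V \<in> VV" and W: "W \<in> VV" and Z: "Z \<in> VV"
      note at = VV_at[OF V, of \<mu>] VV_at[OF W, of \<mu>] VV_at[OF Z, of \<mu>]
      have "V \<mu> x (gg (W \<mu>) (Z \<mu>)) = gg (nabla (V \<mu>) (W \<mu>)) (Z \<mu>) x + gg (W \<mu>) (nabla (V \<mu>) (Z \<mu>)) x"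
        for x
        using L at unfolding metric_compatible_def vapply_def gg_def by (simp add: fun_eq_iff)
      then show "act V (G_der g W Z) \<mu> =
          G_der g (lifted nabla V W) Z \<mu> + G_der g W (lifted nabla V Z) \<mu>"
        unfolding eq[OF V W Z] using at affineD(1)[OF N] by (simp add: pint_add gg_in)
    qed
  qed
qed

lemma pint_nonneg: "(\<And>x. f x \<ge> 0) \<Longrightarrow> pintegral \<mu> f \<ge> 0"
  unfolding pintegral_def by (rule Bochner_Integration.integral_nonneg) simp

text \<open>Testing at measures with an atom at \<open>x\<close> makes the field vanish at \<open>x\<close>; let the mass of the atom
  tend to 0.\<close>

lemma G_der_definite:
  assumes D: "D \<in> VV" and "\<And>\<mu>. G_der g D D \<mu> = 0"
  shows "D = czero"
proof (intro ext)
  fix \<mu> x f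
  have "D (mix t \<mu> x) x f = 0" if t: "0 < t" "t < 1" for t
  proof -
    define \<nu> where "\<nu> = mix t \<mu> x"
    define q where "q = gg (D \<nu>) (D \<nu>)"
    have T: "D \<nu> y \<in> TM y" for y by (rule vector_fieldD(1)[OF VV_at[OF D]])
    have q: "q \<in> CM" "q y \<ge> 0" for y
      using gg_in[OF VV_at[OF D] VV_at[OF D]] g_nonneg[OF T] by (simp_all add: q_def gg_def)
    have "pintegral \<nu> q = 0" using assms(2)[of \<nu>] by (simp add: G_der_eq q_def)
    moreover have "pintegral \<nu> q = (1 - t) * pintegral \<mu> q + t * q x"
      unfolding \<nu>_def using pint_mix[OF _ _ q(1)] t by (simp add: algebra_simps)
    moreover have "(1 - t) * pintegral \<mu> q \<ge> 0" using pint_nonneg[of q \<mu>] q(2) t by simp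
    ultimately have "t * q x \<le> 0" by linarith
    then have "q x = 0" using q(2)[of x] t by (simp add: mult_le_0_iff)
    then have "D \<nu> x = (\<lambda>f. 0)" using g_pos[OF T, of x] by (auto simp: q_def gg_def)
    then show ?thesis by (simp add: \<nu>_def)
  qed
  then have "((\<lambda>t. D (mix t \<mu> x) x f) \<longlongrightarrow> 0) (at_right 0)"
    by (intro Lim_transform_eventually[OF tendsto_const] eventually_at_rightI[of 0 1]) auto
  then have "D \<mu> x f = 0"
    using FC_tendsto_mix[OF VV_FC[OF D], where \<mu> = \<mu> and x = x]
    by (intro tendsto_unique[of "at_right (0::real)"]) simp_all
  then show "D \<mu> x f = czero \<mu> x f" by (simp add: czero_def vzero_def)
qed

text \<open>At a single measure \<open>G_der\<close> is blind to what happens on null sets, so the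
  difference of the two connections is tested at all measures before \<open>G_der_definite\<close>
  is applied.\<close>

lemma cyl_connection_unique:
  assumes "cyl_affine_connection M N" "cyl_metric_compatible M g N" "cyl_torsion_free M N"
    "cyl_affine_connection M N'" "cyl_metric_compatible M g N'" "cyl_torsion_free M N'"
  shows "N = N'"
proof (intro ext)
  have in1: "N V Z \<in> VV" "N' V Z \<in> VV" if "V \<in> VV" "Z \<in> VV" for V Z
    using assms(1,4) that unfolding cyl_affine_connection_def by simp_all
  define T where "T \<mu> U V W = G_der g (N U V) W \<mu> - G_der g (N' U V) W \<mu>" for \<mu> U V W
  have sym: "T \<mu> U V W = T \<mu> V U W" if X: "U \<in> VV" "V \<in> VV" "W \<in> VV" for \<mu> U V W
  proof -
    have "cdiff (N U V) (N V U) = cdiff (N' U V) (N' V U)"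
      using assms(3,6) X unfolding cyl_torsion_free_def by simp
    then have "cadd (N U V) (N' V U) = cadd (N' U V) (N V U)"
      by (simp add: cdiff_def vdiff_def cadd_def vadd_def fun_eq_iff) (simp add: algebra_simps)
    then have "G_der g (cadd (N U V) (N' V U)) W \<mu> = G_der g (cadd (N' U V) (N V U)) W \<mu>" by simp
    then show ?thesis using X in1 by (simp add: T_def G_der_add)
  qed
  have anti: "T \<mu> U V W = - T \<mu> U W V" if X: "U \<in> VV" "V \<in> VV" "W \<in> VV" for \<mu> U V W
  proof -
    have "G_der g (N U V) W \<mu> + G_der g V (N U W) \<mu> = G_der g (N' U V) W \<mu> + G_der g V (N' U W) \<mu>"
      using assms(2,5) X unfolding cyl_metric_compatible_def by (simp add: fun_eq_iff)
    then show ?thesis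
      using G_der_sym[OF X(2) in1(1)[OF X(1,3)]] G_der_sym[OF X(2) in1(2)[OF X(1,3)]]
        by (simp add: T_def)
  qed
  have T0: "T \<mu> U V W = 0" if "U \<in> VV" "V \<in> VV" "W \<in> VV" for \<mu> U V W
    using sym anti that by (rule symmetric_antisymmetric_zero[where X = VV and T = "T \<mu>"])
  fix V Z \<mu> x f
  show "N V Z \<mu> x f = N' V Z \<mu> x f"
  proof (cases "V \<in> VV \<and> Z \<in> VV")
    case True
    then have V: "V \<in> VV" and Z: "Z \<in> VV" by auto
    define D where "D = cdiff (N V Z) (N' V Z)"
    have D: "D \<in> VV" unfolding D_def by (rule VV_diff[OF in1[OF V Z]])
    have ND: "N V Z = cadd (N' V Z) D"
      by (simp add: D_def cadd_def cdiff_def vadd_def vdiff_def)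
    \<comment> \<open>The third argument of \<open>T\<close> is taken to be the difference D
      itself.\<close>
    have "G_der g D D \<mu> = 0" for \<mu>
      using T0[OF V Z D, of \<mu>] G_der_add(1)[OF in1(2)[OF V Z] D D, of \<mu>]
        by (simp add: T_def ND[symmetric])
    then have "D = czero" by (rule G_der_definite[OF D])
    then have "D \<mu> x f = 0" by (simp add: czero_def vzero_def)
    then show ?thesis by (simp add: D_def cdiff_def vdiff_def)
  next
    case False
    then have "N V Z = czero" "N' V Z = czero"
      using assms(1,4) unfolding cyl_affine_connection_def by blast+
    then show ?thesis by simp
  qed
qed

end

theorem theorem2p19:
  fixes M :: "'m::{t2_space,second_countable_topology} manifold"
    and g :: "'m metric"
  assumes "smooth_manifold M" and "oriented M"
    and "compact (UNIV :: 'm set)" and "connected (UNIV :: 'm set)"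
    and "riemannian_metric M g"
  shows
    "(\<forall>nabla. affine_connection M nabla \<longrightarrow>
        (cyl_torsion_free M (lifted_connection M nabla) \<longleftrightarrow> torsion_free M nabla) \<and>
        (cyl_metric_compatible M g (lifted_connection M nabla) \<longleftrightarrow> metric_compatible M g nabla) \<and>
        (cyl_metric_compatible M g (lifted_connection M nabla) \<and>
           cyl_torsion_free M (lifted_connection M nabla) \<longleftrightarrow> nabla = levi_civita M g)) \<and>
     (cyl_affine_connection M (lifted_connection M (levi_civita M g)) \<and>
      cyl_metric_compatible M g (lifted_connection M (levi_civita M g)) \<and>
      cyl_torsion_free M (lifted_connection M (levi_civita M g)) \<and>
      (\<forall>Nabla. cyl_affine_connection M Nabla \<and> cyl_metric_compatible M g Nabla \<and>
         cyl_torsion_free M Nabla \<longrightarrow> Nabla = lifted_connection M (levi_civita M g)))"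
proof -
  interpret riem_mfd M g
    by unfold_locales (use assms in auto)
  have LC: "affine_connection M (levi_civita M g)" "metric_compatible M g (levi_civita M g)"
    "torsion_free M (levi_civita M g)"
    using levi_civita by auto
  note lift = lifted_affine[OF LC(1)] lifted_metric_iff[OF LC(1), THEN iffD2, OF LC(2)]
    lifted_torsion_free_iff[OF LC(1), THEN iffD2, OF LC(3)]
  show ?thesis
  proof (intro conjI allI impI lift)
    fix nabla assume N: "affine_connection M nabla"
    show "cyl_torsion_free M (lifted_connection M nabla) \<longleftrightarrow> torsion_free M nabla"
      by (rule lifted_torsion_free_iff[OF N])
    show "cyl_metric_compatible M g (lifted_connection M nabla) \<longleftrightarrow> metric_compatible M g nabla"
      by (rule lifted_metric_iff[OF N])
    show "cyl_metric_compatible M g (lifted_connection M nabla) \<and>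
        cyl_torsion_free M (lifted_connection M nabla) \<longleftrightarrow> nabla = levi_civita M g"
      unfolding lifted_torsion_free_iff[OF N] lifted_metric_iff[OF N]
      using levi_civita_unique[OF N _ _ LC] LC by auto
  next
    fix Nabla assume "cyl_affine_connection M Nabla \<and> cyl_metric_compatible M g Nabla \<and> cyl_torsion_free M Nabla"
    then show "Nabla = lifted_connection M (levi_civita M g)"
      using cyl_connection_unique[OF _ _ _ lift] by blast
  qed
qed

end
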